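(* Every almost strongly proper forcing has the $\omega_1$-approximation property.
   Context: For a set $Z$, $[Z]^{\omega}$ is the set of countably infinite subsets of $Z$. An algebra over $Z$ is a function $F:[Z]^{<\omega}\to Z$; $A\subseteq Z$ is $F$-closed if $F(s)\in A$ for all finite $s\subseteq A$. For conditions $r,q$, $r\,\|\,q$ means that $r$ and $q$ are compatible. Let $\mathbb P$ be a forcing and $M\prec H_\vartheta$ with $[\mathbb P]^\omega\in M$. A condition $p\in\mathbb P$ is $(M,\mathbb P)$-almost strongly generic if for every $q\le p$ the set $$S_q=\{Y\in[\mathbb P]^\omega:\ \exists\, q'\in Y\ \ \forall r\in Y\ (r\le q'\Rightarrow r\,\|\,q)\}$$ is $M$-stationary, i.e. for every algebra $F\in M$ over $\mathbb P$ there is an $F$-closed $A\in M\cap S_q$. The forcing $\mathbb P$ is almost strongly proper (a.s.p.) if for every sufficiently large regular cardinal $\vartheta$ there is a club (in $[H_\vartheta]^\omega$) of countable models $M\prec H_\vartheta$ with $[\mathbb P]^\omega\in M$ such that every $p\in M\cap\mathbb P$ can be extended to an $(M,\mathbb P)$-almost strongly generic condition. A forcing $\mathbb P$ has the $\omega_1$-approximation property if for every $V$-generic filter $G\subseteq\mathbb P$: every set of ordinals $x\in V[G]$ such that $x\cap a\in V$ for every $a\in V$ which is countable in $V$, belongs to $V$. *)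

theory Defs
  imports Main
begin

text \<open>
  Forcing is done over a transitive model V of ZFC. Up to its Mostowski collapse, such a model is
  a type \<open>'v\<close> together with the map \<open>elts\<close> sending a set x of V to \<open>{y. y \<in> x}\<close>, subject to
  well-foundedness, extensionality and the remaining (first-order) axioms of ZFC. Thus a term of
  type \<open>'v\<close> is an element of V, while a term of type \<open>'v set\<close> is an arbitrary subset of V (for
  instance a filter), which need not belong to V. All set-theoretic notions below are those of V:
  functions, bijections, clubs, etc. range over elements of V.
\<close>

text \<open>First-order formulas of the language of set theory, with de Bruijn indices.\<close>

datatype fm = Mem nat nat | Equal nat nat | Neg fm | Conj fm fm | Exists fm

locale membership =
  fixes elts :: "'v \<Rightarrow> 'v set"
begin

primrec sat :: "'v set \<Rightarrow> fm \<Rightarrow> (nat \<Rightarrow> 'v) \<Rightarrow> bool" where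
  "sat A (Mem i j) e \<longleftrightarrow> e i \<in> elts (e j)"
| "sat A (Equal i j) e \<longleftrightarrow> e i = e j"
| "sat A (Neg \<phi>) e \<longleftrightarrow> \<not> sat A \<phi> e"
| "sat A (Conj \<phi> \<psi>) e \<longleftrightarrow> sat A \<phi> e \<and> sat A \<psi> e"
| "sat A (Exists \<phi>) e \<longleftrightarrow> (\<exists>x\<in>A. sat A \<phi> (case_nat x e))"

text \<open>
  In the two schemes the environment e supplies the parameters. Foundation is subsumed by the
  (external) well-foundedness of the membership relation.
\<close>

definition transitive_ZFC_model :: bool where
  "transitive_ZFC_model \<longleftrightarrow>
     wf {(x, y). x \<in> elts y} \<and>
     \<comment> \<open>extensionality\<close>
     inj elts \<and>
     \<comment> \<open>pairing, union, power set\<close>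
     (\<forall>x y. \<exists>z. elts z = {x, y}) \<and>
     (\<forall>x. \<exists>z. elts z = (\<Union>y\<in>elts x. elts y)) \<and>
     (\<forall>x. \<exists>z. elts z = {y. elts y \<subseteq> elts x}) \<and>
     \<comment> \<open>infinity\<close>
     (\<exists>w. (\<exists>z\<in>elts w. elts z = {}) \<and>
          (\<forall>x\<in>elts w. \<exists>y\<in>elts w. elts y = insert x (elts x))) \<and>
     \<comment> \<open>separation\<close>
     (\<forall>\<phi> e a. \<exists>b. elts b = {x \<in> elts a. sat UNIV \<phi> (case_nat x e)}) \<and>
     \<comment> \<open>replacement\<close>
     (\<forall>\<phi> e a. (\<forall>x\<in>elts a. \<exists>!y. sat UNIV \<phi> (case_nat x (case_nat y e))) \<longrightarrow>
        (\<exists>b. elts b = {y. \<exists>x\<in>elts a. sat UNIV \<phi> (case_nat x (case_nat y e))})) \<and>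
     \<comment> \<open>choice\<close>
     (\<forall>a. (\<forall>x\<in>elts a. elts x \<noteq> {}) \<and>
          (\<forall>x\<in>elts a. \<forall>y\<in>elts a. x \<noteq> y \<longrightarrow> elts x \<inter> elts y = {}) \<longrightarrow>
          (\<exists>c. \<forall>x\<in>elts a. \<exists>!y. y \<in> elts x \<and> y \<in> elts c))"


subsection \<open>Basic set theory in V\<close>

text \<open>
  \<open>vset S\<close> is the element of V with extension S; it is meaningful only if there is one. It is
  applied below only to subsets of V that do belong to V, by the axioms of ZFC.
\<close>

definition vset :: "'v set \<Rightarrow> 'v" where
  "vset S = (THE x. elts x = S)"

definition opair :: "'v \<Rightarrow> 'v \<Rightarrow> 'v" where
  "opair x y = vset {vset {x}, vset {x, y}}"

definition func :: "'v \<Rightarrow> 'v \<Rightarrow> 'v \<Rightarrow> bool" where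
  "func f a b \<longleftrightarrow>
     elts f \<subseteq> {opair x y | x y. x \<in> elts a \<and> y \<in> elts b} \<and>
     (\<forall>x\<in>elts a. \<exists>!y. opair x y \<in> elts f)"

definition app :: "'v \<Rightarrow> 'v \<Rightarrow> 'v" where
  "app f x = (THE y. opair x y \<in> elts f)"

definition equipollent :: "'v \<Rightarrow> 'v \<Rightarrow> bool" where
  "equipollent a b \<longleftrightarrow> (\<exists>f. func f a b \<and> bij_betw (app f) (elts a) (elts b))"

definition transitive :: "'v \<Rightarrow> bool" where
  "transitive x \<longleftrightarrow> (\<forall>y\<in>elts x. elts y \<subseteq> elts x)"

definition ordinal :: "'v \<Rightarrow> bool" where
  "ordinal x \<longleftrightarrow> transitive x \<and> (\<forall>y\<in>elts x. transitive y)"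

definition natural :: "'v \<Rightarrow> bool" where
  "natural n \<longleftrightarrow> ordinal n \<and>
     (\<forall>m\<in>insert n (elts n). elts m = {} \<or> (\<exists>k. elts m = insert k (elts k)))"

definition omega :: 'v where
  "omega = vset {n. natural n}"

text \<open>Finite sets are countable.\<close>

definition countable_in_V :: "'v \<Rightarrow> bool" where
  "countable_in_V a \<longleftrightarrow> (\<exists>f. func f a omega \<and> inj_on (app f) (elts a))"

definition fin_subsets :: "'v \<Rightarrow> 'v" where
  "fin_subsets Z = vset {s. elts s \<subseteq> elts Z \<and> (\<exists>n. natural n \<and> equipollent s n)}"

definition ctbl_subsets :: "'v \<Rightarrow> 'v" where
  "ctbl_subsets Z = vset {Y. elts Y \<subseteq> elts Z \<and> equipollent Y omega}"

definition cardinal :: "'v \<Rightarrow> bool" where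
  "cardinal \<kappa> \<longleftrightarrow> ordinal \<kappa> \<and> (\<forall>\<alpha>\<in>elts \<kappa>. \<not> equipollent \<alpha> \<kappa>)"

definition regular_cardinal :: "'v \<Rightarrow> bool" where
  "regular_cardinal \<kappa> \<longleftrightarrow> cardinal \<kappa> \<and> elts omega \<subseteq> elts \<kappa> \<and>
     (\<forall>\<alpha>\<in>elts \<kappa>. \<forall>f. func f \<alpha> \<kappa> \<longrightarrow> (\<exists>\<beta>\<in>elts \<kappa>. \<forall>\<xi>\<in>elts \<alpha>. app f \<xi> \<in> elts \<beta>))"

definition trcl :: "'v \<Rightarrow> 'v" where
  "trcl x = vset (\<Inter>{elts t | t. transitive t \<and> elts x \<subseteq> elts t})"

definition H :: "'v \<Rightarrow> 'v" where
  "H \<theta> = vset {x. \<exists>\<alpha>\<in>elts \<theta>. equipollent (trcl x) \<alpha>}"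

text \<open>
  Since V is transitive, its natural numbers and its formulas are the standard ones, so
  satisfaction in structures belonging to V may be computed outside V.
\<close>

definition elementary :: "'v \<Rightarrow> 'v \<Rightarrow> bool" where
  "elementary M N \<longleftrightarrow> elts M \<subseteq> elts N \<and>
     (\<forall>\<phi> e. range e \<subseteq> elts M \<longrightarrow> (sat (elts M) \<phi> e \<longleftrightarrow> sat (elts N) \<phi> e))"

definition club :: "'v \<Rightarrow> 'v \<Rightarrow> bool" where
  "club C Z \<longleftrightarrow>
     elts C \<subseteq> elts (ctbl_subsets Z) \<and>
     (\<forall>X\<in>elts (ctbl_subsets Z). \<exists>Y\<in>elts C. elts X \<subseteq> elts Y) \<and>
     (\<forall>f. func f omega C \<and>
          (\<forall>n\<in>elts omega. \<forall>m\<in>elts n. elts (app f m) \<subseteq> elts (app f n)) \<longrightarrow>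
          vset (\<Union>n\<in>elts omega. elts (app f n)) \<in> elts C)"

definition algebra :: "'v \<Rightarrow> 'v \<Rightarrow> bool" where
  "algebra F Z \<longleftrightarrow> func F (fin_subsets Z) Z"

definition closed_under :: "'v \<Rightarrow> 'v \<Rightarrow> bool" where
  "closed_under F A \<longleftrightarrow> (\<forall>s\<in>elts (fin_subsets A). app F s \<in> elts A)"


subsection \<open>Almost strongly proper forcing\<close>

definition forcing :: "'v \<Rightarrow> 'v \<Rightarrow> bool" where
  "forcing P le \<longleftrightarrow>
     elts P \<noteq> {} \<and>
     elts le \<subseteq> {opair p q | p q. p \<in> elts P \<and> q \<in> elts P} \<and>
     (\<forall>p\<in>elts P. opair p p \<in> elts le) \<and>
     (\<forall>p q r. opair p q \<in> elts le \<and> opair q r \<in> elts le \<longrightarrow> opair p r \<in> elts le)"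

definition compatible :: "'v \<Rightarrow> 'v \<Rightarrow> 'v \<Rightarrow> 'v \<Rightarrow> bool" where
  "compatible P le r q \<longleftrightarrow> (\<exists>s\<in>elts P. opair s r \<in> elts le \<and> opair s q \<in> elts le)"

definition S :: "'v \<Rightarrow> 'v \<Rightarrow> 'v \<Rightarrow> 'v set" where
  "S P le q = {Y \<in> elts (ctbl_subsets P).
     \<exists>q'\<in>elts Y. \<forall>r\<in>elts Y. opair r q' \<in> elts le \<longrightarrow> compatible P le r q}"

definition stationary :: "'v \<Rightarrow> 'v \<Rightarrow> 'v set \<Rightarrow> bool" where
  "stationary M P T \<longleftrightarrow>
     (\<forall>F\<in>elts M. algebra F P \<longrightarrow> (\<exists>A\<in>elts M \<inter> T. closed_under F A))"

definition almost_strongly_generic :: "'v \<Rightarrow> 'v \<Rightarrow> 'v \<Rightarrow> 'v \<Rightarrow> bool" where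
  "almost_strongly_generic M P le p \<longleftrightarrow> p \<in> elts P \<and>
     (\<forall>q\<in>elts P. opair q p \<in> elts le \<longrightarrow> stationary M P (S P le q))"

definition almost_strongly_proper :: "'v \<Rightarrow> 'v \<Rightarrow> bool" where
  "almost_strongly_proper P le \<longleftrightarrow>
     (\<exists>\<theta>\<^sub>0. ordinal \<theta>\<^sub>0 \<and> (\<forall>\<theta>. regular_cardinal \<theta> \<and> \<theta>\<^sub>0 \<in> elts \<theta> \<longrightarrow>
       (\<exists>C. club C (H \<theta>) \<and>
         (\<forall>M\<in>elts C. elementary M (H \<theta>) \<and> ctbl_subsets P \<in> elts M \<and>
           (\<forall>p\<in>elts M \<inter> elts P. \<exists>q\<in>elts P. opair q p \<in> elts le \<and>
              almost_strongly_generic M P le q)))))"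


subsection \<open>Generic extensions\<close>

definition generic_filter :: "'v \<Rightarrow> 'v \<Rightarrow> 'v set \<Rightarrow> bool" where
  "generic_filter P le G \<longleftrightarrow>
     G \<subseteq> elts P \<and> G \<noteq> {} \<and>
     (\<forall>p\<in>G. \<forall>q\<in>elts P. opair p q \<in> elts le \<longrightarrow> q \<in> G) \<and>
     (\<forall>p\<in>G. \<forall>q\<in>G. \<exists>r\<in>G. opair r p \<in> elts le \<and> opair r q \<in> elts le) \<and>
     (\<forall>D. elts D \<subseteq> elts P \<and> (\<forall>p\<in>elts P. \<exists>d\<in>elts D. opair d p \<in> elts le) \<longrightarrow>
        G \<inter> elts D \<noteq> {})"

text \<open>
  V[G] consists of the values \<open>\<tau>\<^sub>G = {\<sigma>\<^sub>G | \<sigma>. \<exists>p\<in>G. (\<sigma>, p) \<in> \<tau>}\<close> for \<open>\<tau>\<close> in V. Every element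
  of V counts as a name; members that are not of the form \<open>(\<sigma>, p)\<close> with p a condition do not
  affect the value. Values are not of type \<open>'v\<close>, so \<open>\<tau>\<^sub>G\<close> is represented by the set of all
  names having the same value. By extensionality, \<open>\<sigma>\<^sub>G = \<tau>\<^sub>G\<close> is determined by the recursion
  below; as V is well-founded, this recursion has exactly one solution.
\<close>

inductive same_value :: "'v set \<Rightarrow> 'v \<Rightarrow> 'v \<Rightarrow> bool" for G where
  "\<lbrakk>\<forall>\<rho> p. p \<in> G \<and> opair \<rho> p \<in> elts \<sigma> \<longrightarrow>
      (\<exists>\<rho>' p'. p' \<in> G \<and> opair \<rho>' p' \<in> elts \<tau> \<and> same_value G \<rho> \<rho>');
    \<forall>\<rho>' p'. p' \<in> G \<and> opair \<rho>' p' \<in> elts \<tau> \<longrightarrow>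
      (\<exists>\<rho> p. p \<in> G \<and> opair \<rho> p \<in> elts \<sigma> \<and> same_value G \<rho> \<rho>')\<rbrakk>
   \<Longrightarrow> same_value G \<sigma> \<tau>"

definition val :: "'v set \<Rightarrow> 'v \<Rightarrow> 'v set" where
  "val G \<tau> = {\<sigma>. same_value G \<sigma> \<tau>}"

definition extension :: "'v set \<Rightarrow> 'v set set" where
  "extension G = range (val G)"

text \<open>The members, in V[G], of an element x of V[G].\<close>

definition ext_elts :: "'v set \<Rightarrow> 'v set \<Rightarrow> 'v set set" where
  "ext_elts G x = {val G \<sigma> | \<sigma> \<tau> p. x = val G \<tau> \<and> p \<in> G \<and> opair \<sigma> p \<in> elts \<tau>}"

text \<open>
  The canonical name of x. As a forcing need not have a largest condition, all conditions are
  attached to each member.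
\<close>

definition check :: "'v \<Rightarrow> 'v \<Rightarrow> 'v" where
  "check P = wfrec {(y, x). y \<in> elts x}
     (\<lambda>c x. vset {opair (c y) p | y p. y \<in> elts x \<and> p \<in> elts P})"

text \<open>The inclusion of V in V[G].\<close>

definition ground :: "'v \<Rightarrow> 'v set \<Rightarrow> 'v \<Rightarrow> 'v set" where
  "ground P G x = val G (check P x)"

definition omega1_approximation :: "'v \<Rightarrow> 'v \<Rightarrow> bool" where
  "omega1_approximation P le \<longleftrightarrow>
     (\<forall>G. generic_filter P le G \<longrightarrow>
       (\<forall>x\<in>extension G.
          ext_elts G x \<subseteq> ground P G ` {\<alpha>. ordinal \<alpha>} \<and>
          (\<forall>a. countable_in_V a \<longrightarrow>
             (\<exists>b. ext_elts G (ground P G b) = ext_elts G x \<inter> ext_elts G (ground P G a))) \<longrightarrow>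
          x \<in> range (ground P G)))"

end

end

theory Submission imports Defs begin

text \<open>
  Let G be generic and let x be a set of ordinals in V[G] all of whose countable pieces lie in V, and
  suppose that x is not in V. In V there is a set W of pairs \<open>(y, p)\<close>, downward closed in p, such that
  y is in x if and only if \<open>(y, p) \<in> W\<close> for some \<open>p \<in> G\<close>. It is obtained from the relation "p forces
  the name \<open>\<sigma>\<close> to be y". As the clauses for that relation are positive, its restriction to a set is
  the greatest fixed point of a monotone operator, and neither a general forcing theorem nor a
  transfinite recursion is needed for it.

  As x is not in V, some condition \<open>p\<^sub>0 \<in> G\<close> is such that every \<open>u \<le> p\<^sub>0\<close> has two extensions that
  decide the membership of some y differently. Let F be an algebra on P that picks such a pair of
  extensions for each condition that has one. By genericity, G contains a condition that is almost
  strongly generic for some countable M containing F, and below it, as the intersection of x and M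
  lies in V, a condition \<open>q \<le> p\<^sub>0\<close> in G deciding that intersection. An F-closed set \<open>A \<in> M\<close> in \<open>S\<^sub>q\<close>
  contains q' such that all \<open>r \<le> q'\<close> in A are compatible with q. Then q' is compatible with \<open>p\<^sub>0\<close>, so
  F provides two extensions of q' in A that decide the membership of some \<open>y \<in> M\<close> differently.
  Both are compatible with q, which is impossible.
\<close>

subsection \<open>Definable classes\<close>

text \<open>The model is seen from outside, so a collection of its elements belongs to it only by an
  axiom, and Separation and Replacement speak of first-order formulas. Every set formed below, and
  every dense class that G is made to meet, thus comes with a proof of definability. Elementarity of
  M is a statement about all formulas made outside V, and no definition of it in V is at hand; so it
  is used up first, and genericity is applied to the combinatorial consequence
  \<open>good_model\<close>.

  That the witness y lies in M has a cause left implicit above. Besides F, the model M contains each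
  natural number, a set E that enumerates every countable set of conditions by natural numbers, and
  a set D that attaches to two disagreeing conditions the points at which they disagree. From A
  \<in> M, elementarity yields A \<subseteq> M through E and then a point y \<in> M through D. For
  this, \<theta> has to be so large that E and D lie in H \<theta>.\<close>

primrec ren :: "fm \<Rightarrow> (nat \<Rightarrow> nat) \<Rightarrow> fm" where
  "ren (Mem i j) r = Mem (r i) (r j)"
| "ren (Equal i j) r = Equal (r i) (r j)"
| "ren (Neg \<phi>) r = Neg (ren \<phi> r)"
| "ren (Conj \<phi> \<psi>) r = Conj (ren \<phi> r) (ren \<psi> r)"
| "ren (Exists \<phi>) r = Exists (ren \<phi> (case_nat 0 (\<lambda>n. Suc (r n))))"

definition mix :: "(nat \<Rightarrow> 'v) \<Rightarrow> (nat \<Rightarrow> 'v) \<Rightarrow> nat \<Rightarrow> 'v" where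
  "mix e p n = (if even n then e (n div 2) else p (n div 2))"

text \<open>Formulas are written out only for elementarity, which speaks of satisfaction in M and in
  H \<theta>; definability below always refers to satisfaction in all of V.\<close>

definition all_fm :: "fm \<Rightarrow> fm" where "all_fm \<phi> = Neg (Exists (Neg \<phi>))"
definition or_fm :: "fm \<Rightarrow> fm \<Rightarrow> fm" where "or_fm \<phi> \<psi> = Neg (Conj (Neg \<phi>) (Neg \<psi>))"
definition iff_fm :: "fm \<Rightarrow> fm \<Rightarrow> fm" where
  "iff_fm \<phi> \<psi> = Conj (or_fm (Neg \<phi>) \<psi>) (or_fm (Neg \<psi>) \<phi>)"
definition pair_fm :: "nat \<Rightarrow> nat \<Rightarrow> nat \<Rightarrow> fm" where
  "pair_fm z x y = all_fm (iff_fm (Mem 0 (Suc z)) (or_fm (Equal 0 (Suc x)) (Equal 0 (Suc y))))"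
definition opair_fm :: "nat \<Rightarrow> nat \<Rightarrow> nat \<Rightarrow> fm" where
  "opair_fm z x y = Exists (Exists (Conj (pair_fm (Suc (Suc z)) 1 0)
     (Conj (pair_fm 1 (Suc (Suc x)) (Suc (Suc x))) (pair_fm 0 (Suc (Suc x)) (Suc (Suc y))))))"

context membership
begin

lemma sat_ren: "sat A (ren \<phi> r) e \<longleftrightarrow> sat A \<phi> (\<lambda>n. e (r n))"
proof (induction \<phi> arbitrary: r e)
  case (Exists \<phi>)
  have "(\<lambda>n. case_nat x e (case_nat 0 (\<lambda>n. Suc (r n)) n)) = case_nat x (\<lambda>n. e (r n))" for x
    by (auto split: nat.split)
  with Exists show ?case by simp
qed auto

text \<open>
  \<open>dfn Q\<close>: the class Q is first-order definable with parameters. The variables sit at the even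
  positions of the environment and the parameters at the odd ones, so that quantification and
  conjunction only rename indices. The definability of a compound predicate is then found by
  \<open>intro\<close>, without ever writing a formula.
\<close>

definition dfn :: "((nat \<Rightarrow> 'v) \<Rightarrow> bool) \<Rightarrow> bool" where
  "dfn Q \<longleftrightarrow> (\<exists>\<phi> p. \<forall>e. Q e \<longleftrightarrow> sat UNIV \<phi> (mix e p))"

text \<open>The language has no terms, so a class function is represented by its graph: variable 0
  holds the value and the arguments move up by one.\<close>

definition dft :: "((nat \<Rightarrow> 'v) \<Rightarrow> 'v) \<Rightarrow> bool" where
  "dft t \<longleftrightarrow> dfn (\<lambda>e. e 0 = t (\<lambda>n. e (Suc n)))"

lemma dfnI: "(\<And>e. Q e \<longleftrightarrow> sat UNIV \<phi> (\<lambda>n. mix e p (r n))) \<Longrightarrow> dfn Q"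
  unfolding dfn_def by (rule exI[of _ "ren \<phi> r"], rule exI[of _ p]) (simp add: sat_ren)

lemma dfn_rename:
  assumes "dfn Q"
  shows "dfn (\<lambda>e. Q (\<lambda>n. e (r n)))"
proof -
  obtain \<phi> p where 1: "\<And>e. Q e \<longleftrightarrow> sat UNIV \<phi> (mix e p)" using assms unfolding dfn_def by blast
  have 2: "(\<lambda>n. mix e p (if even n then 2 * r (n div 2) else n)) = mix (\<lambda>n. e (r n)) p" for e
    by (rule ext) (auto simp: mix_def)
  show ?thesis by (rule dfnI[of _ \<phi> p "\<lambda>n. if even n then 2 * r (n div 2) else n"]) (simp only: 1 2)
qed

lemma dfn_not: "dfn Q \<Longrightarrow> dfn (\<lambda>e. \<not> Q e)"
  unfolding dfn_def
  apply (elim exE)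
  subgoal for \<phi> p by (rule exI[of _ "Neg \<phi>"], rule exI[of _ p]) simp
  done

lemma dfn_conj:
  assumes "dfn Q" "dfn R"
  shows "dfn (\<lambda>e. Q e \<and> R e)"
proof -
  obtain \<phi> p where 1: "\<And>e. Q e \<longleftrightarrow> sat UNIV \<phi> (mix e p)" using assms unfolding dfn_def by blast
  obtain \<psi> q where 2: "\<And>e. R e \<longleftrightarrow> sat UNIV \<psi> (mix e q)" using assms unfolding dfn_def by blast
  \<comment> \<open>Parameter k of \<open>p\<close> becomes parameter 2k of \<open>mix p q\<close>
    and moves from position 2k+1 to 4k+1; parameter k of \<open>q\<close> becomes parameter 2k+1 and
    moves to 4k+3.\<close>
  have 3: "(\<lambda>n. mix e (mix p q) (if even n then n else 2 * n - 1)) = mix e p" for e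
  proof (rule ext)
    fix n :: nat
    consider k where "n = 2 * k" | k where "n = Suc (2 * k)" by (metis evenE oddE Suc_eq_plus1)
    then show "mix e (mix p q) (if even n then n else 2 * n - 1) = mix e p n"
      by cases (simp_all add: mix_def)
  qed
  have 4: "(\<lambda>n. mix e (mix p q) (if even n then n else 2 * n + 1)) = mix e q" for e
    by (rule ext) (auto simp: mix_def elim!: oddE)
  show ?thesis unfolding dfn_def
    by (rule exI[of _ "Conj (ren \<phi> (\<lambda>n. if even n then n else 2 * n - 1))
                           (ren \<psi> (\<lambda>n. if even n then n else 2 * n + 1))"],
        rule exI[of _ "mix p q"]) (simp only: sat.simps sat_ren 1 2 3 4 simp_thms)
qed

lemma dfn_ex:
  assumes "dfn (\<lambda>e. Q (e 0) (\<lambda>n. e (Suc n)))"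
  shows "dfn (\<lambda>e. \<exists>x. Q x e)"
proof -
  obtain \<phi> p where 1: "\<And>e. Q (e 0) (\<lambda>n. e (Suc n)) \<longleftrightarrow> sat UNIV \<phi> (mix e p)"
    using assms unfolding dfn_def by blast
  \<comment> \<open>The binder puts x in front of the interleaved list and upsets the parity: a
    variable expected at an even n > 0 is found at n-1, a parameter expected at an odd n is found at
    n+1.\<close>
  have 2: "(\<lambda>n. case_nat x (mix e p) (if n = 0 then 0 else if even n then n - 1 else n + 1))
      = mix (case_nat x e) p" for x e
  proof (rule ext)
    fix n :: nat
    consider "n = 0" | k where "n = 2 * Suc k" | k where "n = Suc (2 * k)"
      by (metis evenE oddE Suc_eq_plus1 not0_implies_Suc mult_0_right)
    then show "case_nat x (mix e p) (if n = 0 then 0 else if even n then n - 1 else n + 1)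
      = mix (case_nat x e) p n"
      by cases (simp_all add: mix_def)
  qed
  have 3: "Q x e \<longleftrightarrow> sat UNIV \<phi> (mix (case_nat x e) p)" for x e
    using 1[of "case_nat x e"] by simp
  show ?thesis unfolding dfn_def
    by (rule exI[of _ "Exists (ren \<phi> (\<lambda>n. if n = 0 then 0 else if even n then n - 1 else n + 1))"],
        rule exI[of _ p]) (simp only: sat.simps sat_ren 2 3 bex_UNIV simp_thms)
qed

lemma dfn_mem0: "dfn (\<lambda>e. e i \<in> elts (e j))"
  by (rule dfnI[of _ "Mem (2*i) (2*j)" undefined "\<lambda>n. n"]) (simp add: mix_def)

lemma dfn_eq0: "dfn (\<lambda>e. e i = e j)"
  by (rule dfnI[of _ "Equal (2*i) (2*j)" undefined "\<lambda>n. n"]) (simp add: mix_def)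

lemma dft_var: "dft (\<lambda>e. e i)"
  unfolding dft_def by (rule dfn_eq0)

lemma dft_const: "dft (\<lambda>e. c)"
  unfolding dft_def
  by (rule dfnI[of _ "Equal 0 1" "\<lambda>_. c" "\<lambda>n. n"]) (simp add: mix_def)

text \<open>A term is traded for a quantifier: Q is asserted of some x that equals
  \<open>s e\<close>.\<close>

lemma dfn_subst:
  assumes "dfn Q" "dft s"
  shows "dfn (\<lambda>e. Q (case_nat (s e) e))"
proof -
  have "dfn (\<lambda>e. \<exists>x. x = s e \<and> Q (case_nat x e))"
    apply (rule dfn_ex)
    apply (rule dfn_conj)
    using assms(2) unfolding dft_def apply simp
    apply (rule back_subst[of dfn, OF assms(1)])
    apply (rule ext, rule arg_cong[of _ _ Q])
    apply (auto split: nat.split)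
    done
  then show ?thesis by simp
qed

lemma dft_shift: "dft t \<Longrightarrow> dft (\<lambda>e. t (\<lambda>n. e (r n)))"
  unfolding dft_def using dfn_rename[of "\<lambda>e. e 0 = t (\<lambda>n. e (Suc n))" "case_nat 0 (\<lambda>n. Suc (r n))"]
  by simp

lemma dfn_subst1:
  assumes "dfn (\<lambda>e. R (e 0))" "dft s"
  shows "dfn (\<lambda>e. R (s e))"
  using dfn_subst[OF assms] by simp

lemma dfn_subst2:
  assumes "dfn (\<lambda>e. R (e 0) (e (Suc 0)))" "dft s" "dft t"
  shows "dfn (\<lambda>e. R (s e) (t e))"
proof -
  have "dfn (\<lambda>e. R (e 0) (t (\<lambda>n. e (Suc n))))"
    using dfn_subst[OF dfn_rename[OF assms(1), of "\<lambda>n. if n = 0 then 1 else 0"]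
      dft_shift[OF assms(3), of Suc]] by simp
  from dfn_subst[OF this assms(2)] show ?thesis by simp
qed

lemma dfn_subst3:
  assumes "dfn (\<lambda>e. R (e 0) (e (Suc 0)) (e (Suc (Suc 0))))" "dft s" "dft t" "dft u"
  shows "dfn (\<lambda>e. R (s e) (t e) (u e))"
proof -
  have "dfn (\<lambda>e. R (e 0) (e 1) (u (\<lambda>n. e (Suc (Suc n)))))"
    using dfn_subst[OF dfn_rename[OF assms(1), of "\<lambda>n. if n = 0 then 1 else if n = 1 then 2 else 0"]
      dft_shift[OF assms(4), of "\<lambda>n. Suc (Suc n)"]] by simp
  from dfn_subst[OF dfn_rename[OF this, of "\<lambda>n. if n = 0 then 1 else if n = 1 then 0 else n"]
      dft_shift[OF assms(3), of Suc]]
  have "dfn (\<lambda>e. R (e 0) (t (\<lambda>n. e (Suc n))) (u (\<lambda>n. e (Suc n))))" by simp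
  from dfn_subst[OF this assms(2)] show ?thesis by simp
qed

lemma dfn_mem: "dft s \<Longrightarrow> dft t \<Longrightarrow> dfn (\<lambda>e. s e \<in> elts (t e))"
  by (rule dfn_subst2[OF dfn_mem0[of 0 "Suc 0"]])

lemma dfn_eq: "dft s \<Longrightarrow> dft t \<Longrightarrow> dfn (\<lambda>e. s e = t e)"
  by (rule dfn_subst2[OF dfn_eq0[of 0 "Suc 0"]])

lemma dfn_const: "dfn (\<lambda>e. b)"
  using dfn_eq0[of 0 0] dfn_not[OF dfn_eq0[of 0 0]] by (cases b) auto

lemma dfn_disj: "dfn Q \<Longrightarrow> dfn R \<Longrightarrow> dfn (\<lambda>e. Q e \<or> R e)"
  using dfn_not[OF dfn_conj[OF dfn_not dfn_not], of Q R] by simp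

lemma dfn_imp: "dfn Q \<Longrightarrow> dfn R \<Longrightarrow> dfn (\<lambda>e. Q e \<longrightarrow> R e)"
  unfolding imp_conv_disj by (intro dfn_disj dfn_not)

lemma dfn_iff: "dfn Q \<Longrightarrow> dfn R \<Longrightarrow> dfn (\<lambda>e. Q e \<longleftrightarrow> R e)"
  unfolding iff_conv_conj_imp by (intro dfn_conj dfn_imp)

lemma dfn_all:
  assumes "dfn (\<lambda>e. Q (e 0) (\<lambda>n. e (Suc n)))"
  shows "dfn (\<lambda>e. \<forall>x. Q x e)"
  using dfn_not[OF dfn_ex[of "\<lambda>x e. \<not> Q x e", OF dfn_not[OF assms]]] by simp

lemma dfn_bex:
  assumes "dft a" "dfn (\<lambda>e. Q (e 0) (\<lambda>n. e (Suc n)))"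
  shows "dfn (\<lambda>e. \<exists>x\<in>elts (a e). Q x e)"
  unfolding Bex_def by (intro dfn_ex dfn_conj dfn_mem dft_var dft_shift[OF assms(1)] assms(2))

lemma dfn_ball:
  assumes "dft a" "dfn (\<lambda>e. Q (e 0) (\<lambda>n. e (Suc n)))"
  shows "dfn (\<lambda>e. \<forall>x\<in>elts (a e). Q x e)"
  unfolding Ball_def by (intro dfn_all dfn_imp dfn_mem dft_var dft_shift[OF assms(1)] assms(2))

lemma dfn_ex1:
  assumes "dfn (\<lambda>e. Q (e 0) (\<lambda>n. e (Suc n)))"
  shows "dfn (\<lambda>e. \<exists>!x. Q x e)"
proof -
  have "dfn (\<lambda>e. \<exists>x. Q x e \<and> (\<forall>y. Q y e \<longrightarrow> y = x))"
    apply (intro dfn_ex dfn_conj dfn_all dfn_imp dfn_eq dft_var assms)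
    using dfn_rename[OF assms, of "\<lambda>n. if n = 0 then 0 else Suc n"] by simp
  then show ?thesis unfolding Ex1_def .
qed

lemma dfn_sub:
  assumes "dft s" "dft t"
  shows "dfn (\<lambda>e. elts (s e) \<subseteq> elts (t e))"
  unfolding subset_iff
  by (intro dfn_all dfn_imp dfn_mem dft_var dft_shift[OF assms(1)] dft_shift[OF assms(2)])

lemmas dfn_intros = dfn_const dfn_mem dfn_eq dfn_sub dfn_bex dfn_ball dfn_ex dfn_all
  dfn_ex1 dfn_not dfn_conj dfn_disj dfn_imp dfn_iff dft_const dft_var

lemma dft_subst1:
  assumes "dft (\<lambda>e. T (e 0))" "dft s"
  shows "dft (\<lambda>e. T (s e))"
  unfolding dft_def
  by (rule dfn_subst2[of "\<lambda>y x. y = T x", OF dfn_rename[OF assms(1)[unfolded dft_def],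
        of "\<lambda>n. n"] dft_var dft_shift[OF assms(2)]])

lemma dft_subst2:
  assumes "dft (\<lambda>e. T (e 0) (e (Suc 0)))" "dft s" "dft t"
  shows "dft (\<lambda>e. T (s e) (t e))"
  unfolding dft_def
  by (rule dfn_subst3[of "\<lambda>y x z. y = T x z", OF dfn_rename[OF assms(1)[unfolded dft_def],
        of "\<lambda>n. n"] dft_var dft_shift[OF assms(2)] dft_shift[OF assms(3)]])

end

subsection \<open>Sets of the model\<close>

locale zfc_model = membership elts for elts :: "'v \<Rightarrow> 'v set" +
  assumes zfc: transitive_ZFC_model
begin

lemma wf_mem: "wf {(x, y). x \<in> elts y}"
  using zfc unfolding transitive_ZFC_model_def by - (elim conjE, assumption)

lemma elts_inject: "elts x = elts y \<longleftrightarrow> x = y"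
  using zfc unfolding transitive_ZFC_model_def by (auto dest: injD)

lemma mem_induct [case_names step]: "(\<And>x. (\<And>y. y \<in> elts x \<Longrightarrow> Q y) \<Longrightarrow> Q x) \<Longrightarrow> Q a"
  using wf_induct[OF wf_mem, of Q a] by blast

lemma mem_trancl_induct [case_names step]:
  "(\<And>x. (\<And>y. (y, x) \<in> {(x, y). x \<in> elts y}\<^sup>+ \<Longrightarrow> Q y) \<Longrightarrow> Q x) \<Longrightarrow> Q a"
  using wf_induct[OF wf_trancl[OF wf_mem], of Q a] by blast

lemma mem_irrefl: "x \<notin> elts x"
  using wf_mem by (metis case_prodI mem_Collect_eq wf_irrefl)

definition small :: "'v set \<Rightarrow> bool" where
  "small A \<longleftrightarrow> A \<in> range elts"

lemma small_elts [simp, intro]: "small (elts x)"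
  by (simp add: small_def)

lemma vset_elts [simp]: "vset (elts x) = x"
  by (simp add: vset_def elts_inject)

lemma elts_vset: "small A \<Longrightarrow> elts (vset A) = A"
  by (auto simp: small_def)

lemma smallE: assumes "small A" obtains a where "elts a = A"
  using assms by (auto simp: small_def)

lemma small_iff: "small A \<longleftrightarrow> (\<exists>a. elts a = A)"
  by (auto simp: small_def)

lemma small_pair [simp]: "small {x, y}"
proof -
  have "\<forall>x y. \<exists>z. elts z = {x, y}" using zfc unfolding transitive_ZFC_model_def by - (elim conjE, assumption)
  then show ?thesis by (simp add: small_iff)
qed

lemma small_sing [simp]: "small {x}"
  using small_pair[of x x] by simp

lemma small_Union: "small A \<Longrightarrow> small (\<Union>y\<in>A. elts y)"
proof -
  assume "small A"
  then obtain a where a: "elts a = A" by (rule smallE)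
  have "\<forall>x. \<exists>z. elts z = (\<Union>y\<in>elts x. elts y)"
    using zfc unfolding transitive_ZFC_model_def by - (elim conjE, assumption)
  then show ?thesis by (simp add: small_iff a[symmetric])
qed

lemma small_Pow: "small {y. elts y \<subseteq> elts x}"
proof -
  have "\<forall>x. \<exists>z. elts z = {y. elts y \<subseteq> elts x}"
    using zfc unfolding transitive_ZFC_model_def by - (elim conjE, assumption)
  then show ?thesis by (simp add: small_iff)
qed

text \<open>The schemes put one variable in front of the parameters. As Q looks at variable 0 alone,
  all even positions may read x while the odd ones read the parameters.\<close>

lemma dfn_fm1:
  assumes "dfn (\<lambda>e. Q (e 0))"
  obtains \<phi> p where "\<And>x. Q x \<longleftrightarrow> sat UNIV \<phi> (case_nat x p)"
proof -
  obtain \<phi> p where 1: "\<And>e. Q (e 0) \<longleftrightarrow> sat UNIV \<phi> (mix e p)" using assms unfolding dfn_def by blast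
  have 2: "(\<lambda>n. case_nat x p (if even n then 0 else Suc (n div 2))) = mix (\<lambda>_. x) p" for x
    by (rule ext) (auto simp: mix_def)
  have "Q x \<longleftrightarrow> sat UNIV (ren \<phi> (\<lambda>n. if even n then 0 else Suc (n div 2))) (case_nat x p)" for x
    unfolding sat_ren 2 1[symmetric] ..
  then show ?thesis by (rule that)
qed

lemma dfn_fm2:
  assumes "dfn (\<lambda>e. Q (e 0) (e (Suc 0)))"
  obtains \<phi> p where "\<And>x y. Q x y \<longleftrightarrow> sat UNIV \<phi> (case_nat x (case_nat y p))"
proof -
  obtain \<phi> p where 1: "\<And>e. Q (e 0) (e (Suc 0)) \<longleftrightarrow> sat UNIV \<phi> (mix e p)"
    using assms unfolding dfn_def by blast
  have 2: "(\<lambda>n. case_nat x (case_nat y p) (if n = 0 then 0 else if even n then 1 else n div 2 + 2))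
      = mix (case_nat x (\<lambda>_. y)) p" for x y
  proof (rule ext)
    fix n :: nat
    consider "n = 0" | k where "n = 2 * Suc k" | k where "n = Suc (2 * k)"
      by (metis evenE oddE Suc_eq_plus1 not0_implies_Suc mult_0_right)
    then show "case_nat x (case_nat y p) (if n = 0 then 0 else if even n then 1 else n div 2 + 2)
        = mix (case_nat x (\<lambda>_. y)) p n"
      by cases (simp_all add: mix_def)
  qed
  have "Q x y \<longleftrightarrow> sat UNIV (ren \<phi> (\<lambda>n. if n = 0 then 0 else if even n then 1 else n div 2 + 2))
      (case_nat x (case_nat y p))" for x y
    unfolding sat_ren 2 1[symmetric] by simp
  then show ?thesis by (rule that)
qed

lemma small_sep:
  assumes "small A" "dfn (\<lambda>e. Q (e 0))"
  shows "small {x \<in> A. Q x}"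
proof -
  obtain a where a: "elts a = A" using assms(1) by (rule smallE)
  obtain \<phi> p where 1: "\<And>x. Q x \<longleftrightarrow> sat UNIV \<phi> (case_nat x p)" by (rule dfn_fm1[OF assms(2)]) blast
  have "\<forall>\<phi> e a. \<exists>b. elts b = {x \<in> elts a. sat UNIV \<phi> (case_nat x e)}"
    using zfc unfolding transitive_ZFC_model_def by - (elim conjE, assumption)
  then show ?thesis by (simp add: small_iff 1 a[symmetric])
qed

text \<open>B is a collection outside V, and a subset of an element of V need not lie in V; hence
  the premise on definability.\<close>

lemma small_mono:
  assumes "small A" "B \<subseteq> A" "dfn (\<lambda>e. e 0 \<in> B)"
  shows "small B"
proof -
  have "B = {x \<in> A. x \<in> B}" using assms(2) by blast
  then show ?thesis using small_sep[OF assms(1,3)] by simp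
qed

lemma small_repl_rel:
  assumes "small A" "dfn (\<lambda>e. Q (e 0) (e (Suc 0)))" "\<And>x. x \<in> A \<Longrightarrow> \<exists>!y. Q x y"
  shows "small {y. \<exists>x\<in>A. Q x y}"
proof -
  obtain a where a: "elts a = A" using assms(1) by (rule smallE)
  obtain \<phi> p where 1: "\<And>x y. Q x y \<longleftrightarrow> sat UNIV \<phi> (case_nat x (case_nat y p))"
    by (rule dfn_fm2[OF assms(2)]) blast
  have "\<forall>\<phi> e a. (\<forall>x\<in>elts a. \<exists>!y. sat UNIV \<phi> (case_nat x (case_nat y e))) \<longrightarrow>
        (\<exists>b. elts b = {y. \<exists>x\<in>elts a. sat UNIV \<phi> (case_nat x (case_nat y e))})"
    using zfc unfolding transitive_ZFC_model_def by - (elim conjE, assumption)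
  then show ?thesis using assms(3) unfolding small_iff 1 a[symmetric] by blast
qed

lemma small_image:
  assumes "small A" "dft (\<lambda>e. T (e 0))"
  shows "small (T ` A)"
proof -
  have "dfn (\<lambda>e. e (Suc 0) = T (e 0))" by (intro dfn_intros dft_subst1[OF assms(2)])
  from small_repl_rel[OF assms(1) this] have "small {y. \<exists>x\<in>A. y = T x}" by simp
  moreover have "{y. \<exists>x\<in>A. y = T x} = T ` A" by blast
  ultimately show ?thesis by simp
qed

lemma small_Un: "small A \<Longrightarrow> small B \<Longrightarrow> small (A \<union> B)"
  using small_Union[of "{vset A, vset B}"] by (simp add: elts_vset)

lemma small_insert: "small A \<Longrightarrow> small (insert x A)"
  using small_Un[of "{x}" A] by simp

lemma small_empty [simp]: "small {}"
  using small_sep[of "elts undefined" "\<lambda>_. False"] dfn_const by simp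

text \<open>\<open>vset\<close> is a description. Once it denotes in every environment,
  extensionality eliminates it: y is the set in question if and only if it has exactly the required
  members.\<close>

lemma dft_vset:
  assumes "\<And>e. small {z. Q z e}" "dfn (\<lambda>e. Q (e 0) (\<lambda>n. e (Suc n)))"
  shows "dft (\<lambda>e. vset {z. Q z e})"
proof -
  have 1: "y = vset {z. Q z e} \<longleftrightarrow> (\<forall>z. z \<in> elts y \<longleftrightarrow> Q z e)" for y e
    using elts_vset[OF assms(1), of e] vset_elts[of y] by (metis mem_Collect_eq set_eqI elts_inject)
  have "dfn (\<lambda>e. \<forall>z. z \<in> elts (e 0) \<longleftrightarrow> Q z (\<lambda>n. e (Suc n)))"
    using dfn_rename[OF assms(2), of "\<lambda>n. if n = 0 then 0 else Suc n"] by (intro dfn_intros) simp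
  then show ?thesis unfolding dft_def 1 .
qed

lemma elts_opair: "elts (opair x y) = {vset {x}, vset {x, y}}"
  by (simp add: opair_def elts_vset)

lemma vset_inject: "small A \<Longrightarrow> small B \<Longrightarrow> vset A = vset B \<longleftrightarrow> A = B"
  by (metis elts_vset)

lemma opair_inject [simp]: "opair x y = opair x' y' \<longleftrightarrow> x = x' \<and> y = y'"
proof
  assume "opair x y = opair x' y'"
  then have "{vset {x}, vset {x, y}} = {vset {x'}, vset {x', y'}}" by (metis elts_opair)
  then show "x = x' \<and> y = y'" by (auto simp: doubleton_eq_iff vset_inject)
qed auto

lemma dft_sing0: "dft (\<lambda>e. vset {e i})"
proof -
  have "dft (\<lambda>e. vset {z. z = e i})"
    by (rule dft_vset) (simp, intro dfn_intros)
  then show ?thesis by simp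
qed

lemma dft_pair0: "dft (\<lambda>e. vset {e i, e j})"
proof -
  have 1: "{z. z = x \<or> z = y} = {x, y}" for x y :: 'v by blast
  have "dft (\<lambda>e. vset {z. z = e i \<or> z = e j})"
    by (rule dft_vset) (simp add: 1, intro dfn_intros)
  then show ?thesis by (simp add: 1)
qed

lemma dft_pair: "dft s \<Longrightarrow> dft t \<Longrightarrow> dft (\<lambda>e. vset {s e, t e})"
  by (rule dft_subst2[of "\<lambda>x y. vset {x, y}", OF dft_pair0])

lemma dft_sing: "dft s \<Longrightarrow> dft (\<lambda>e. vset {s e})"
  by (rule dft_subst1[of "\<lambda>x. vset {x}", OF dft_sing0])

lemma dft_opair: "dft s \<Longrightarrow> dft t \<Longrightarrow> dft (\<lambda>e. opair (s e) (t e))"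
  unfolding opair_def by (intro dft_pair dft_sing)

lemma small_prod: assumes "small A" "small B" shows "small {opair x y | x y. x \<in> A \<and> y \<in> B}"
proof -
  obtain a where a: "elts a = A" using assms(1) by (rule smallE)
  obtain b where b: "elts b = B" using assms(2) by (rule smallE)
  have s: "small {z. \<exists>y\<in>elts b. z = opair x y}" for x
  proof -
    have "dft (\<lambda>e. opair x (e 0))" by (intro dft_opair dft_const dft_var)
    from small_image[OF small_elts this, of b] show ?thesis by (simp add: image_def)
  qed
  have "dft (\<lambda>e. vset {z. \<exists>y\<in>elts b. z = opair (e 0) y})"
    by (rule dft_vset) (rule s, intro dfn_intros dft_opair)
  from small_Union[OF small_image[OF assms(1) this]]
  have "small (\<Union>x\<in>A. {z. \<exists>y\<in>elts b. z = opair x y})"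
    by (simp add: elts_vset[OF s])
  moreover have "(\<Union>x\<in>A. {z. \<exists>y\<in>elts b. z = opair x y}) = {opair x y | x y. x \<in> A \<and> y \<in> B}"
    using b by blast
  ultimately show ?thesis by simp
qed

definition prods :: "'v \<Rightarrow> 'v \<Rightarrow> 'v" where
  "prods a b = vset {opair x y | x y. x \<in> elts a \<and> y \<in> elts b}"

lemma elts_prods: "elts (prods a b) = {opair x y | x y. x \<in> elts a \<and> y \<in> elts b}"
  unfolding prods_def by (rule elts_vset[OF small_prod]) auto

lemma opair_in_prods [simp]: "opair x y \<in> elts (prods a b) \<longleftrightarrow> x \<in> elts a \<and> y \<in> elts b"
  by (auto simp: elts_prods)

definition powr :: "'v \<Rightarrow> 'v" where "powr x = vset {y. elts y \<subseteq> elts x}"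

lemma elts_powr [simp]: "elts (powr x) = {y. elts y \<subseteq> elts x}"
  unfolding powr_def by (rule elts_vset[OF small_Pow])

lemma dft_powr0: "dft (\<lambda>e. powr (e 0))"
  unfolding powr_def by (rule dft_vset) (rule small_Pow, intro dfn_intros)

subsection \<open>Functions\<close>

lemma func_alt: "func f a b \<longleftrightarrow> (\<forall>z\<in>elts f. \<exists>x\<in>elts a. \<exists>y\<in>elts b. z = opair x y) \<and>
   (\<forall>x\<in>elts a. \<exists>!y. opair x y \<in> elts f)"
  unfolding func_def by (auto 0 4 simp: subset_iff)

lemma dfn_func0: "dfn (\<lambda>e. func (e 0) (e (Suc 0)) (e (Suc (Suc 0))))"
  unfolding func_alt by (intro dfn_intros dft_opair)

lemma func_app: "func f a b \<Longrightarrow> x \<in> elts a \<Longrightarrow> opair x (app f x) \<in> elts f"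
  unfolding func_def app_def by (rule theI') blast

lemma func_mem:
  assumes "func f a b" "opair x y \<in> elts f"
  shows "x \<in> elts a \<and> y \<in> elts b \<and> y = app f x"
proof -
  have 1: "x \<in> elts a" "y \<in> elts b" using assms unfolding func_alt by fastforce+
  then show ?thesis using func_app[OF assms(1)] assms unfolding func_alt by blast
qed

lemma func_app_iff: "func f a b \<Longrightarrow> x \<in> elts a \<Longrightarrow> opair x y \<in> elts f \<longleftrightarrow> y = app f x"
  using func_app func_mem by metis

lemma func_in: "func f a b \<Longrightarrow> x \<in> elts a \<Longrightarrow> app f x \<in> elts b"
  using func_app func_mem by metis

text \<open>The axiom of choice of the model selects from disjoint families. Tagging each candidate
  y with its x makes the sets of candidates disjoint, and a selector for them, restricted to such
  pairs, is the function.\<close>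

lemma choice:
  assumes Q: "dfn (\<lambda>e. Q (e 0) (e (Suc 0)))" and ex: "\<And>x. x \<in> elts a \<Longrightarrow> \<exists>y\<in>elts b. Q x y"
  obtains f where "func f a b" "\<And>x. x \<in> elts a \<Longrightarrow> Q x (app f x)"
proof -
  define c where "c = (\<lambda>x. vset {z. z \<in> elts (prods a b) \<and> (\<exists>y\<in>elts b. Q x y \<and> z = opair x y)})"
  note d = dfn_subst2[OF Q] dft_opair
  have s: "small {z. z \<in> elts (prods a b) \<and> (\<exists>y\<in>elts b. Q x y \<and> z = opair x y)}" for x
    by (rule small_sep) (simp, intro dfn_intros d)
  have c: "elts (c x) = {z. z \<in> elts (prods a b) \<and> (\<exists>y\<in>elts b. Q x y \<and> z = opair x y)}" for x
    unfolding c_def by (rule elts_vset[OF s])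
  have "dft (\<lambda>e. c (e 0))" unfolding c_def
    by (rule dft_vset) (rule s, intro dfn_intros d)
  then obtain F where F: "elts F = c ` elts a"
    using small_image[OF small_elts, of c a] by (auto simp: small_iff)
  have ac: "\<forall>a. (\<forall>x\<in>elts a. elts x \<noteq> {}) \<and>
          (\<forall>x\<in>elts a. \<forall>y\<in>elts a. x \<noteq> y \<longrightarrow> elts x \<inter> elts y = {}) \<longrightarrow>
          (\<exists>c. \<forall>x\<in>elts a. \<exists>!y. y \<in> elts x \<and> y \<in> elts c)"
    using zfc unfolding transitive_ZFC_model_def by - (elim conjE, assumption)
  have ne: "\<forall>x\<in>elts F. elts x \<noteq> {}"
  proof -
    have "elts (c x) \<noteq> {}" if x: "x \<in> elts a" for x
    proof -
      obtain y where "y \<in> elts b" "Q x y" using ex[OF x] by blast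
      then have "opair x y \<in> elts (c x)" using x by (simp add: c)
      then show ?thesis by blast
    qed
    then show ?thesis by (simp add: F)
  qed
  have dj: "\<forall>x\<in>elts F. \<forall>y\<in>elts F. x \<noteq> y \<longrightarrow> elts x \<inter> elts y = {}" by (auto simp: F c)
  obtain C where "\<forall>x\<in>elts F. \<exists>!y. y \<in> elts x \<and> y \<in> elts C"
    using ac[THEN spec, THEN mp, OF conjI, OF ne dj] by (rule exE)
  then have C: "\<exists>!z. z \<in> elts (c x) \<and> z \<in> elts C" if "x \<in> elts a" for x using that F by auto
  have "small {z. z \<in> elts (prods a b) \<and> (z \<in> elts C \<and> (\<exists>x\<in>elts a. \<exists>y\<in>elts b. Q x y \<and> z = opair x y))}"
    by (rule small_sep) (simp, intro dfn_intros d)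
  then obtain f where f: "elts f =
      {z. z \<in> elts (prods a b) \<and> (z \<in> elts C \<and> (\<exists>x\<in>elts a. \<exists>y\<in>elts b. Q x y \<and> z = opair x y))}"
    by (auto simp: small_iff)
  have f': "opair x y \<in> elts f \<longleftrightarrow> opair x y \<in> elts (c x) \<and> opair x y \<in> elts C" if "x \<in> elts a" for x y
    using that by (auto simp: f c)
  have u: "\<exists>!y. opair x y \<in> elts f" if x: "x \<in> elts a" for x
  proof -
    obtain z where z: "z \<in> elts (c x)" "z \<in> elts C" "\<And>z'. z' \<in> elts (c x) \<Longrightarrow> z' \<in> elts C \<Longrightarrow> z' = z"
      using C[OF x] by blast
    obtain y where "z = opair x y" using z(1) by (auto simp: c)
    then show ?thesis using z f'[OF x] by (metis opair_inject)
  qed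
  have fn: "func f a b" unfolding func_alt using u by (auto simp: f)
  moreover have "Q x (app f x)" if "x \<in> elts a" for x
    using func_app[OF fn that] by (auto simp: f)
  ultimately show ?thesis by (rule that)
qed

lemma equipollent_alt: "equipollent a b \<longleftrightarrow> (\<exists>f. func f a b \<and>
    (\<forall>x\<in>elts a. \<forall>x'\<in>elts a. \<forall>y\<in>elts b. opair x y \<in> elts f \<and> opair x' y \<in> elts f \<longrightarrow> x = x') \<and>
    (\<forall>y\<in>elts b. \<exists>x\<in>elts a. opair x y \<in> elts f))"
  unfolding equipollent_def
proof (rule arg_cong[of _ _ Ex], rule ext, rule conj_cong[OF refl])
  fix f assume f: "func f a b"
  show "bij_betw (app f) (elts a) (elts b) \<longleftrightarrow>
    (\<forall>x\<in>elts a. \<forall>x'\<in>elts a. \<forall>y\<in>elts b. opair x y \<in> elts f \<and> opair x' y \<in> elts f \<longrightarrow> x = x') \<and>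
    (\<forall>y\<in>elts b. \<exists>x\<in>elts a. opair x y \<in> elts f)"
    using func_in[OF f] by (auto simp: bij_betw_def inj_on_def func_app_iff[OF f])
qed

lemma dfn_equipollent: "dft s \<Longrightarrow> dft t \<Longrightarrow> dfn (\<lambda>e. equipollent (s e) (t e))"
proof (rule dfn_subst2)
  show "dfn (\<lambda>e. equipollent (e 0) (e (Suc 0)))"
    unfolding equipollent_alt by (intro dfn_intros dft_opair dfn_subst3[OF dfn_func0])
qed

lemma dfn_transitive: "dft s \<Longrightarrow> dfn (\<lambda>e. transitive (s e))"
proof (rule dfn_subst1)
  show "dfn (\<lambda>e. transitive (e 0))" unfolding transitive_def by (intro dfn_intros)
qed

lemma dfn_ordinal: "dft s \<Longrightarrow> dfn (\<lambda>e. ordinal (s e))"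
proof (rule dfn_subst1)
  show "dfn (\<lambda>e. ordinal (e 0))" unfolding ordinal_def by (intro dfn_intros dfn_transitive)
qed

subsection \<open>Recursion\<close>

lemma transitiveD: "transitive t \<Longrightarrow> y \<in> elts x \<Longrightarrow> x \<in> elts t \<Longrightarrow> y \<in> elts t"
  unfolding transitive_def by blast

lemma least_transitive:
  assumes "transitive t" "elts x \<subseteq> elts t"
  shows "small (\<Inter>{elts t | t. transitive t \<and> elts x \<subseteq> elts t})"
proof -
  have "small {z. z \<in> elts t \<and> (\<forall>t'. transitive t' \<and> elts x \<subseteq> elts t' \<longrightarrow> z \<in> elts t')}"
    by (rule small_sep) (simp, intro dfn_intros dfn_transitive)
  moreover have "{z. z \<in> elts t \<and> (\<forall>t'. transitive t' \<and> elts x \<subseteq> elts t' \<longrightarrow> z \<in> elts t')}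
    = \<Inter>{elts t | t. transitive t \<and> elts x \<subseteq> elts t}" using assms by blast
  ultimately show ?thesis by simp
qed

lemma trcl_eq_iff:
  assumes "transitive t" "elts x \<subseteq> elts t"
  shows "u = trcl x \<longleftrightarrow> transitive u \<and> elts x \<subseteq> elts u \<and>
     (\<forall>t. transitive t \<and> elts x \<subseteq> elts t \<longrightarrow> elts u \<subseteq> elts t)" (is "_ \<longleftrightarrow> ?R u")
proof -
  have e: "elts (trcl x) = \<Inter>{elts t | t. transitive t \<and> elts x \<subseteq> elts t}"
    unfolding trcl_def by (rule elts_vset[OF least_transitive[OF assms]])
  have 1: "?R (trcl x)" unfolding transitive_def e by blast
  have "u = v" if "?R u" "?R v" for u v using that by (metis subset_antisym elts_inject)
  with 1 show ?thesis by blast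
qed

text \<open>By induction on membership, the members of x have transitive closures; Replacement
  collects these, and their union together with the members of x is transitive.\<close>

lemma transitive_superset: "\<exists>t. transitive t \<and> elts x \<subseteq> elts t"
proof (induction x rule: mem_induct)
  case (step x)
  \<comment> \<open>Closures are described by minimality, because the definability of
    \<open>trcl\<close> rests on the existence that is being proved.\<close>
  define R where "R = (\<lambda>y u. transitive u \<and> elts y \<subseteq> elts u \<and>
     (\<forall>t. transitive t \<and> elts y \<subseteq> elts t \<longrightarrow> elts u \<subseteq> elts t))"
  have R: "R y u \<longleftrightarrow> u = trcl y" if "y \<in> elts x" for y u
    using step[OF that] trcl_eq_iff[of _ y u] unfolding R_def by metis
  have "small {u. \<exists>y\<in>elts x. R y u}"
  proof (rule small_repl_rel)
    show "dfn (\<lambda>e. R (e 0) (e (Suc 0)))" unfolding R_def by (intro dfn_intros dfn_transitive)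
  qed (auto simp: R)
  then have "small (elts x \<union> (\<Union>u\<in>{u. \<exists>y\<in>elts x. R y u}. elts u))"
    by (intro small_Un small_Union small_elts)
  then obtain t where t: "elts t = elts x \<union> (\<Union>u\<in>{u. \<exists>y\<in>elts x. R y u}. elts u)"
    by (auto simp: small_iff)
  have "transitive t" unfolding transitive_def
  proof (intro ballI subsetI)
    fix y z assume y: "y \<in> elts t" and z: "z \<in> elts y"
    show "z \<in> elts t"
    proof (cases "y \<in> elts x")
      case True
      then have "R y (trcl y)" by (simp add: R)
      then show ?thesis using True z unfolding t R_def by blast
    next
      case False
      then obtain w u where "w \<in> elts x" "R w u" "y \<in> elts u" using y unfolding t by blast
      moreover from this have "z \<in> elts u" using z unfolding R_def transitive_def by blast
      ultimately show ?thesis unfolding t by blast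
    qed
  qed
  then show ?case using t by blast
qed

lemma trcl_iff: "u = trcl x \<longleftrightarrow> transitive u \<and> elts x \<subseteq> elts u \<and>
     (\<forall>t. transitive t \<and> elts x \<subseteq> elts t \<longrightarrow> elts u \<subseteq> elts t)"
  using transitive_superset[of x] trcl_eq_iff by blast

lemma transitive_trcl: "transitive (trcl x)" and trcl_sub: "elts x \<subseteq> elts (trcl x)"
  and trcl_least: "transitive t \<Longrightarrow> elts x \<subseteq> elts t \<Longrightarrow> elts (trcl x) \<subseteq> elts t"
  using trcl_iff[of "trcl x" x] by blast+

lemma dft_trcl: "dft s \<Longrightarrow> dft (\<lambda>e. trcl (s e))"
proof (erule dft_subst1[rotated])
  show "dft (\<lambda>e. trcl (e 0))"
    unfolding dft_def trcl_iff by (intro dfn_intros dfn_transitive)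
qed

text \<open>The recursion runs outside V, but T receives the graph of the earlier values as an
  element of V. That this graph is a set when T is definable is shown below.\<close>

definition mrec :: "('v \<Rightarrow> 'v) \<Rightarrow> 'v \<Rightarrow> 'v" where
  "mrec T = wfrec {(y, x). y \<in> elts x} (\<lambda>f x. T (vset {opair y (f y) | y. y \<in> elts x}))"

text \<open>The approximations that make recursively defined class functions first-order definable.\<close>

definition attempt :: "('v \<Rightarrow> 'v) \<Rightarrow> 'v \<Rightarrow> bool" where
  "attempt T f \<longleftrightarrow> (\<forall>u v. opair u v \<in> elts f \<longrightarrow>
     (\<exists>g. (\<forall>z. z \<in> elts g \<longleftrightarrow> z \<in> elts f \<and> (\<exists>w\<in>elts u. \<exists>v'. z = opair w v')) \<and> v = T g) \<and>
     (\<forall>w\<in>elts u. \<exists>v'. opair w v' \<in> elts f))"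

lemma mrec: "mrec T x = T (vset {opair y (mrec T y) | y. y \<in> elts x})"
proof -
  have 1: "{opair y (cut f {(y, x). y \<in> elts x} x y) | y. y \<in> elts x} = {opair y (f y) | y. y \<in> elts x}"
    for f :: "'v \<Rightarrow> 'v"
    by (auto simp: cut_def)
  show ?thesis
    by (subst mrec_def, subst wfrec[OF wf_mem], simp only: 1 mrec_def[symmetric])
qed

lemma attemptD1: "attempt T f \<Longrightarrow> opair u v \<in> elts f \<Longrightarrow>
    \<exists>g. (\<forall>z. z \<in> elts g \<longleftrightarrow> z \<in> elts f \<and> (\<exists>w\<in>elts u. \<exists>v'. z = opair w v')) \<and> v = T g"
  unfolding attempt_def by (elim allE impE conjE)

lemma attemptD2: "attempt T f \<Longrightarrow> opair u v \<in> elts f \<Longrightarrow> w \<in> elts u \<Longrightarrow> \<exists>v'. opair w v' \<in> elts f"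
  unfolding attempt_def by blast

text \<open>An approximation defined at u is defined on all members of u and is correct there by
  induction, so what it feeds to T at u is the true graph.\<close>

lemma attempt_eq: "attempt T f \<Longrightarrow> opair u v \<in> elts f \<Longrightarrow> v = mrec T u"
proof (induction u arbitrary: v rule: mem_induct)
  case (step u)
  obtain g where g: "\<And>z. z \<in> elts g \<longleftrightarrow> z \<in> elts f \<and> (\<exists>w\<in>elts u. \<exists>v'. z = opair w v')" "v = T g"
    and d: "\<And>w. w \<in> elts u \<Longrightarrow> \<exists>v'. opair w v' \<in> elts f"
    using attemptD1[OF step(2,3)] attemptD2[OF step(2,3)] by blast
  have "elts g = {opair y (mrec T y) | y. y \<in> elts u}"
  proof (intro set_eqI iffI)
    fix z assume "z \<in> elts g"
    then obtain w v' where "z \<in> elts f" "w \<in> elts u" "z = opair w v'" using g(1) by blast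
    moreover from this have "v' = mrec T w" using step.IH[OF _ step.prems(1)] by simp
    ultimately show "z \<in> {opair y (mrec T y) | y. y \<in> elts u}" by blast
  next
    fix z assume "z \<in> {opair y (mrec T y) | y. y \<in> elts u}"
    then obtain w where w: "w \<in> elts u" "z = opair w (mrec T w)" by blast
    obtain v' where v': "opair w v' \<in> elts f" using d[OF w(1)] by blast
    then have "v' = mrec T w" using step.IH[OF w(1) step.prems(1)] by simp
    then show "z \<in> elts g" unfolding g(1) using v' w by blast
  qed
  then show ?case using g(2) mrec[of T u] by (metis vset_elts)
qed

context
  fixes T :: "'v \<Rightarrow> 'v"
  assumes T: "dft (\<lambda>e. T (e 0))"
begin

lemma dfn_attempt: "dfn (\<lambda>e. attempt T (e i))"
  unfolding attempt_def by (intro dfn_intros dft_opair dft_subst1[OF T])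

text \<open>The points of the transitive closure of x that some approximation reaches form a
  transitive set, which contains the members of x by induction; so they are the whole closure. As
  approximations agree, their values on the closure, together with the value at x, make up a single
  approximation.\<close>

lemma ex_attempt: "\<exists>f. attempt T f \<and> opair x (mrec T x) \<in> elts f"
proof (induction x rule: mem_induct)
  case (step x)
  define A where "A = (\<lambda>u v. \<exists>f. attempt T f \<and> opair u v \<in> elts f)"
  have A: "A u v \<Longrightarrow> v = mrec T u" for u v using attempt_eq unfolding A_def by blast
  have dA: "dfn (\<lambda>e. A (e 0) (e (Suc 0)))"
    unfolding A_def by (intro dfn_intros dft_opair dfn_attempt)
  have "small {u \<in> elts (trcl x). \<exists>v. A u v}"
    by (rule small_sep) (simp, intro dfn_intros dfn_subst2[OF dA])
  then obtain t where t: "elts t = {u \<in> elts (trcl x). \<exists>v. A u v}" by (auto simp: small_iff)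
  have "transitive t" unfolding transitive_def t
  proof clarify
    fix u v w assume u: "u \<in> elts (trcl x)" "A u v" "w \<in> elts u"
    then have "w \<in> elts (trcl x)" using transitiveD[OF transitive_trcl] by blast
    moreover have "\<exists>v. A w v" using u attemptD2 unfolding A_def by blast
    ultimately show "w \<in> elts (trcl x) \<and> (\<exists>v. A w v)" by blast
  qed
  moreover have "elts x \<subseteq> elts t" using trcl_sub[of x] step unfolding t A_def by blast
  ultimately have "elts (trcl x) \<subseteq> elts t" by (rule trcl_least)
  then have At: "A u (mrec T u)" if "u \<in> elts (trcl x)" for u
    using that A unfolding t by blast
  have "small {z. \<exists>u\<in>elts (trcl x). \<exists>v. A u v \<and> z = opair u v}"
    
  proof (rule small_repl_rel)
    show "dfn (\<lambda>e. \<exists>v. A (e 0) v \<and> e (Suc 0) = opair (e 0) v)"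
      by (intro dfn_intros dfn_subst2[OF dA] dft_opair)
    show "\<exists>!z. \<exists>v. A u v \<and> z = opair u v" if "u \<in> elts (trcl x)" for u
    proof (rule ex1I)
      show "\<exists>v. A u v \<and> opair u (mrec T u) = opair u v" using At[OF that] by blast
      show "z = opair u (mrec T u)" if "\<exists>v. A u v \<and> z = opair u v" for z using that A by blast
    qed
  qed simp
  then have "small (insert (opair x (mrec T x)) {z. \<exists>u\<in>elts (trcl x). \<exists>v. A u v \<and> z = opair u v})"
    by (rule small_insert)
  then obtain f where
    f: "elts f = insert (opair x (mrec T x)) {z. \<exists>u\<in>elts (trcl x). \<exists>v. A u v \<and> z = opair u v}"
    by (auto simp: small_iff)
  have f': "opair u v \<in> elts f \<longleftrightarrow> (u = x \<or> u \<in> elts (trcl x)) \<and> v = mrec T u" for u v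
    unfolding f using A At by auto
  have "attempt T f" unfolding attempt_def
  proof (intro allI impI)
    fix u v assume uv: "opair u v \<in> elts f"
    have el: "w \<in> elts (trcl x)" if "w \<in> elts u" for w
      using uv that trcl_sub[of x] transitiveD[OF transitive_trcl] unfolding f' by blast
    have "small {z \<in> elts f. \<exists>w\<in>elts u. \<exists>v'. z = opair w v'}"
      by (rule small_sep) (simp, intro dfn_intros dft_opair)
    then obtain g where g: "elts g = {z \<in> elts f. \<exists>w\<in>elts u. \<exists>v'. z = opair w v'}"
      by (auto simp: small_iff)
    have "elts g = {opair y (mrec T y) | y. y \<in> elts u}"
      unfolding g using el f' by auto
    then have "v = T g" using uv mrec[of T u] unfolding f' by (metis vset_elts)
    then show "(\<exists>g. (\<forall>z. z \<in> elts g \<longleftrightarrow> z \<in> elts f \<and> (\<exists>w\<in>elts u. \<exists>v'. z = opair w v')) \<and> v = T g) \<and>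
     (\<forall>w\<in>elts u. \<exists>v'. opair w v' \<in> elts f)" using g el f' by auto
  qed
  then show ?case using f' by blast
qed

lemma mrec_iff: "y = mrec T x \<longleftrightarrow> (\<exists>f. attempt T f \<and> opair x y \<in> elts f)"
  using ex_attempt attempt_eq by blast

lemma dft_mrec: "dft s \<Longrightarrow> dft (\<lambda>e. mrec T (s e))"
proof (erule dft_subst1[rotated])
  show "dft (\<lambda>e. mrec T (e 0))"
    unfolding dft_def mrec_iff by (intro dfn_intros dft_opair dfn_attempt)
qed

lemma small_mrec_graph: "small {opair y (mrec T y) | y. y \<in> elts x}"
proof -
  have "dft (\<lambda>e. opair (e 0) (mrec T (e 0)))" by (intro dft_opair dft_var dft_mrec)
  from small_image[OF small_elts this, of x] show ?thesis by (simp add: image_def Bex_def conj_commute)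
qed

end

lemma small_range: "small {v. \<exists>y. opair y v \<in> elts g}"
proof (rule small_mono)
  show "small (\<Union>z\<in>(\<Union>y\<in>elts g. elts y). elts z)" by (intro small_Union small_elts)
  show "{v. \<exists>y. opair y v \<in> elts g} \<subseteq> (\<Union>z\<in>(\<Union>y\<in>elts g. elts y). elts z)"
    by (auto simp: elts_opair elts_vset intro!: bexI[of _ "opair _ _"])
  show "dfn (\<lambda>e. e 0 \<in> {v. \<exists>y. opair y v \<in> elts g})"
    unfolding mem_Collect_eq by (intro dfn_intros dft_opair)
qed

lemma small_domain: "small {y. \<exists>v. opair y v \<in> elts g}"
proof (rule small_mono)
  show "small (\<Union>z\<in>(\<Union>y\<in>elts g. elts y). elts z)" by (intro small_Union small_elts)
  show "{y. \<exists>v. opair y v \<in> elts g} \<subseteq> (\<Union>z\<in>(\<Union>y\<in>elts g. elts y). elts z)"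
  proof clarify
    fix y v assume "opair y v \<in> elts g"
    moreover have "vset {y, v} \<in> elts (opair y v)" "y \<in> elts (vset {y, v})"
      by (simp_all add: elts_opair elts_vset)
    ultimately show "y \<in> (\<Union>z\<in>(\<Union>y\<in>elts g. elts y). elts z)" by blast
  qed
  show "dfn (\<lambda>e. e 0 \<in> {y. \<exists>v. opair y v \<in> elts g})"
    unfolding mem_Collect_eq by (intro dfn_intros dft_opair)
qed

subsection \<open>A cumulative hierarchy over a given set\<close>

text \<open>The von Neumann hierarchy over t, each stage being t together with the power sets of the
  earlier ones, but indexed by arbitrary sets in place of ordinals. The index \<omega> will give a
  set closed under pairing; a name as index will bound the sets of V that the name can
  denote.\<close>

definition hier :: "'v \<Rightarrow> 'v \<Rightarrow> 'v" where
  "hier t = mrec (\<lambda>g. vset {z. z \<in> elts t \<or> (\<exists>v. (\<exists>y. opair y v \<in> elts g) \<and> elts z \<subseteq> elts v)})"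

lemma small_hier: "small {z. z \<in> elts t \<or> (\<exists>v. (\<exists>y. opair y v \<in> elts g) \<and> elts z \<subseteq> elts v)}"
proof -
  have "{z. z \<in> elts t \<or> (\<exists>v. (\<exists>y. opair y v \<in> elts g) \<and> elts z \<subseteq> elts v)} =
    elts t \<union> (\<Union>u\<in>powr ` {v. \<exists>y. opair y v \<in> elts g}. elts u)" by auto
  then show ?thesis
    by (simp only:) (intro small_Un small_elts small_Union small_image small_range dft_powr0)
qed

lemma dft_hier_step:
  "dft (\<lambda>e. vset {z. z \<in> elts t \<or> (\<exists>v. (\<exists>y. opair y v \<in> elts (e 0)) \<and> elts z \<subseteq> elts v)})"
  by (rule dft_vset) (rule small_hier, intro dfn_intros dft_opair)

lemma elts_hier: "elts (hier t x) = elts t \<union> {z. \<exists>y\<in>elts x. elts z \<subseteq> elts (hier t y)}"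
proof -
  have "hier t x = vset {z. z \<in> elts t \<or> (\<exists>v. (\<exists>y. opair y v \<in> elts (vset {opair y (hier t y) | y. y \<in> elts x})) \<and> elts z \<subseteq> elts v)}"
    unfolding hier_def by (rule mrec)
  then have "elts (hier t x) = {z. z \<in> elts t \<or> (\<exists>v. (\<exists>y. opair y v \<in> elts (vset {opair y (hier t y) | y. y \<in> elts x})) \<and> elts z \<subseteq> elts v)}"
    by (simp only: elts_vset[OF small_hier])
  moreover have "elts (vset {opair y (hier t y) | y. y \<in> elts x}) = {opair y (hier t y) | y. y \<in> elts x}"
    unfolding hier_def by (rule elts_vset[OF small_mrec_graph[OF dft_hier_step]])
  ultimately show ?thesis by auto
qed

lemma transitive_hier: "transitive t \<Longrightarrow> transitive (hier t x)"
proof (induction x rule: mem_induct)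
  case (step x)
  show ?case unfolding transitive_def
  proof (intro ballI subsetI)
    fix z w assume z: "z \<in> elts (hier t x)" and w: "w \<in> elts z"
    show "w \<in> elts (hier t x)"
    proof (cases "z \<in> elts t")
      case True
      then show ?thesis using w transitiveD[OF step.prems] elts_hier[of t x] by blast
    next
      case False
      then obtain y where y: "y \<in> elts x" "elts z \<subseteq> elts (hier t y)"
        using z elts_hier[of t x] by blast
      then have "elts w \<subseteq> elts (hier t y)"
        using w step.IH[OF y(1) step.prems] unfolding transitive_def by blast
      then show ?thesis using y(1) elts_hier[of t x] by blast
    qed
  qed
qed

lemma hier_mono: "transitive t \<Longrightarrow> y \<in> elts x \<Longrightarrow> elts (hier t y) \<subseteq> elts (hier t x)"
  using transitive_hier[of t y] elts_hier[of t x] unfolding transitive_def by blast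

subsection \<open>Canonical names\<close>

definition check_step :: "'v \<Rightarrow> 'v \<Rightarrow> 'v" where
  "check_step P g = vset {z. \<exists>y v p. opair y v \<in> elts g \<and> p \<in> elts P \<and> z = opair v p}"

lemma small_check: "small {z. \<exists>y v p. opair y v \<in> elts g \<and> p \<in> elts P \<and> z = opair v p}"
proof -
  have "{z. \<exists>y v p. opair y v \<in> elts g \<and> p \<in> elts P \<and> z = opair v p} =
    {opair v p | v p. v \<in> {v. \<exists>y. opair y v \<in> elts g} \<and> p \<in> elts P}" by auto
  then show ?thesis by (simp only: small_prod[OF small_range small_elts])
qed

lemma elts_check_step:
  "elts (check_step P g) = {z. \<exists>y v p. opair y v \<in> elts g \<and> p \<in> elts P \<and> z = opair v p}"
  unfolding check_step_def by (rule elts_vset[OF small_check])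

lemma dft_check_step: "dft (\<lambda>e. check_step P (e 0))"
  unfolding check_step_def by (rule dft_vset) (rule small_check, intro dfn_intros dft_opair)

lemma elts_mrec_check:
  "elts (mrec (check_step P) x) = {opair (mrec (check_step P) y) p | y p. y \<in> elts x \<and> p \<in> elts P}"
proof -
  have "elts (mrec (check_step P) x) =
      elts (check_step P (vset {opair y (mrec (check_step P) y) | y. y \<in> elts x}))"
    by (subst mrec) (rule refl)
  then show ?thesis
    unfolding elts_check_step elts_vset[OF small_mrec_graph[OF dft_check_step]] by auto
qed

text \<open>The recursion that defines \<open>check\<close> uses \<open>vset\<close>, which is known
  to denote only for \<open>mrec\<close>; induction on membership shows that both agree.\<close>

lemma check_eq_mrec: "check P x = mrec (check_step P) x"
proof (induction x rule: mem_induct)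
  case (step x)
  have 1: "{opair (cut f {(y, x). y \<in> elts x} x y) p | y p. y \<in> elts x \<and> p \<in> elts P} =
      {opair (f y) p | y p. y \<in> elts x \<and> p \<in> elts P}" for f :: "'v \<Rightarrow> 'v"
    by (auto simp: cut_def)
  have "check P x = vset {opair (check P y) p | y p. y \<in> elts x \<and> p \<in> elts P}"
    by (subst check_def, subst wfrec[OF wf_mem], simp only: 1 check_def[symmetric])
  also have "{opair (check P y) p | y p. y \<in> elts x \<and> p \<in> elts P} =
      {opair (mrec (check_step P) y) p | y p. y \<in> elts x \<and> p \<in> elts P}"
    using step by (metis (no_types, lifting))
  finally show ?case by (simp only: elts_mrec_check[symmetric] vset_elts)
qed

lemma elts_check: "elts (check P x) = {opair (check P y) p | y p. y \<in> elts x \<and> p \<in> elts P}"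
  unfolding check_eq_mrec by (rule elts_mrec_check)

subsection \<open>Ordinals and natural numbers\<close>

lemma ordinal_mem: "ordinal x \<Longrightarrow> y \<in> elts x \<Longrightarrow> ordinal y"
  unfolding ordinal_def transitive_def by blast

lemma ordinal_linear: "ordinal x \<Longrightarrow> ordinal y \<Longrightarrow> x \<in> elts y \<or> x = y \<or> y \<in> elts x"
proof (induction x arbitrary: y rule: mem_induct)
  case (step x)
  note IHx = step
  show ?case using \<open>ordinal y\<close>
  proof (induction y rule: mem_induct)
    case (step y)
    have y: "y' \<in> elts x" if "y' \<in> elts y" "x \<notin> elts y" for y'
    proof -
      have "x \<in> elts y' \<or> x = y' \<or> y' \<in> elts x"
        using step.IH[OF that(1)] ordinal_mem[OF step.prems that(1)] by blast
      then show ?thesis using that step.prems transitiveD unfolding ordinal_def by blast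
    qed
    have x: "x' \<in> elts y" if "x' \<in> elts x" "y \<notin> elts x" for x'
      using IHx(1)[OF that(1) ordinal_mem[OF IHx(2) that(1)] step.prems] that IHx(2) transitiveD
      unfolding ordinal_def by blast
    show ?case
      using x y elts_inject[of x y] by blast
  qed
qed

section \<open>The natural numbers of V are the standard ones\<close>

definition vsuc :: "'v \<Rightarrow> 'v" where "vsuc x = vset (insert x (elts x))"

lemma elts_vsuc [simp]: "elts (vsuc x) = insert x (elts x)"
  unfolding vsuc_def by (simp add: elts_vset small_insert)

primrec nv :: "nat \<Rightarrow> 'v" where
  "nv 0 = vset {}" | "nv (Suc n) = vsuc (nv n)"

lemma elts_nv: "elts (nv n) = nv ` {..<n}"
  by (induction n) (auto simp: elts_vset lessThan_Suc)

lemma nv_inject [simp]: "nv m = nv n \<longleftrightarrow> m = n"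
proof -
  have "nv m \<noteq> nv n" if "m < n" for m n
    using mem_irrefl[of "nv n"] elts_nv[of n] that by (metis imageI lessThan_iff)
  then show ?thesis by (metis linorder_neqE_nat)
qed

lemma nv_mem [simp]: "nv m \<in> elts (nv n) \<longleftrightarrow> m < n"
  by (auto simp: elts_nv)

lemma ordinal_nv: "ordinal (nv n)"
  unfolding ordinal_def transitive_def by (auto simp: elts_nv)

text \<open>Membership is well-founded from outside, so passing from a natural number of V to its
  predecessors ends at the empty set after a standard number of steps.\<close>

lemma natural_iff: "natural x \<longleftrightarrow> x \<in> range nv"
proof
  have "natural x \<longrightarrow> x \<in> range nv"
  proof (induction x rule: mem_induct)
    case (step x)
    show ?case
    proof
      assume n: "natural x"
      then have "elts x = {} \<or> (\<exists>k. elts x = insert k (elts k))" unfolding natural_def by blast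
      then show "x \<in> range nv"
      proof
        assume "elts x = {}"
        then have "x = nv 0" using elts_nv[of 0] elts_inject[of x "nv 0"] by simp
        then show ?thesis by blast
      next
        assume "\<exists>k. elts x = insert k (elts k)"
        then obtain k where k: "elts x = insert k (elts k)" by blast
        have "natural k" using n k ordinal_mem[of x k] unfolding natural_def by auto
        then obtain m where "k = nv m" using step k by blast
        then have "x = nv (Suc m)" using k elts_inject[of x "nv (Suc m)"] by simp
        then show ?thesis by blast
      qed
    qed
  qed
  then show "natural x \<Longrightarrow> x \<in> range nv" by blast
next
  assume "x \<in> range nv"
  then obtain n where n: "x = nv n" by blast
  have 1: "elts (nv m) = {} \<or> (\<exists>k. elts (nv m) = insert k (elts k))" for m
    by (cases m) (auto simp: elts_vset)
  have "insert x (elts x) \<subseteq> range nv" using n elts_nv[of n] by auto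
  then show "natural x" unfolding natural_def using n ordinal_nv 1 by blast
qed

lemma small_natural: "small {n. natural n}"
proof -
  have "\<exists>w. (\<exists>z\<in>elts w. elts z = {}) \<and> (\<forall>x\<in>elts w. \<exists>y\<in>elts w. elts y = insert x (elts x))"
    using zfc unfolding transitive_ZFC_model_def by - (elim conjE, assumption)
  then obtain w z where z: "z \<in> elts w" "elts z = {}"
    and s: "\<And>x. x \<in> elts w \<Longrightarrow> \<exists>y\<in>elts w. elts y = insert x (elts x)" by blast
  have "nv n \<in> elts w" for n
  proof (induction n)
    case 0
    then show ?case using z by (metis nv.simps(1) vset_elts)
  next
    case (Suc n)
    then show ?case using s[OF Suc] elts_inject by (metis elts_vsuc nv.simps(2))
  qed
  then have "{n. natural n} \<subseteq> elts w" using natural_iff by auto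
  moreover have "dfn (\<lambda>e. e 0 \<in> {n. natural n})"
  proof -
    have i: "elts m = insert k (elts k) \<longleftrightarrow> (\<forall>z. z \<in> elts m \<longleftrightarrow> z = k \<or> z \<in> elts k)" for m k by auto
    have n: "elts m = {} \<longleftrightarrow> \<not> (\<exists>z. z \<in> elts m)" for m by auto
    have b: "(\<forall>m\<in>insert n (elts n). Q m) \<longleftrightarrow> Q n \<and> (\<forall>m\<in>elts n. Q m)" for Q n by auto
    show ?thesis unfolding mem_Collect_eq natural_def i n b
      by (intro dfn_intros dfn_ordinal)
  qed
  ultimately show ?thesis by (rule small_mono[OF small_elts])
qed

lemma elts_omega: "elts omega = range nv"
  unfolding omega_def by (auto simp: elts_vset[OF small_natural] natural_iff)

subsection \<open>Cardinality and well-orderings\<close>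

definition lepoll :: "'v \<Rightarrow> 'v \<Rightarrow> bool" where
  "lepoll a b \<longleftrightarrow> (\<exists>f. func f a b \<and> inj_on (app f) (elts a))"

text \<open>A relation suffices in which no y is shared by different x; a point may have several
  codes, among which choice picks one.\<close>

lemma lepollI:
  assumes "dfn (\<lambda>e. Q (e 0) (e (Suc 0)))" "\<And>x. x \<in> elts a \<Longrightarrow> \<exists>y\<in>elts b. Q x y"
    and "\<And>x x' y. x \<in> elts a \<Longrightarrow> x' \<in> elts a \<Longrightarrow> Q x y \<Longrightarrow> Q x' y \<Longrightarrow> x = x'"
  shows "lepoll a b"
proof -
  obtain f where f: "func f a b" "\<And>x. x \<in> elts a \<Longrightarrow> Q x (app f x)"
    using choice[OF assms(1,2)] by blast
  have "inj_on (app f) (elts a)"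
  proof (rule inj_onI)
    fix x x' assume x: "x \<in> elts a" "x' \<in> elts a" "app f x = app f x'"
    then show "x = x'" using f(2)[OF x(1)] f(2)[OF x(2)] assms(3) by simp
  qed
  then show ?thesis using f(1) unfolding lepoll_def by blast
qed

lemma lepollE:
  assumes "lepoll a b"
  obtains f where "func f a b"
    "\<And>x x' y. opair x y \<in> elts f \<Longrightarrow> opair x' y \<in> elts f \<Longrightarrow> x = x'"
proof -
  obtain f where f: "func f a b" "inj_on (app f) (elts a)" using assms unfolding lepoll_def by blast
  have "x = x'" if "opair x y \<in> elts f" "opair x' y \<in> elts f" for x x' y
    using func_mem[OF f(1) that(1)] func_mem[OF f(1) that(2)] f(2) by (auto dest: inj_onD)
  with f(1) show ?thesis by (rule that)
qed

lemma lepoll_iff: "lepoll a b \<longleftrightarrow>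
  (\<exists>f. func f a b \<and> (\<forall>x x' y. opair x y \<in> elts f \<and> opair x' y \<in> elts f \<longrightarrow> x = x'))"
proof
  show "lepoll a b \<Longrightarrow> \<exists>f. func f a b \<and> (\<forall>x x' y. opair x y \<in> elts f \<and> opair x' y \<in> elts f \<longrightarrow> x = x')"
    by (erule lepollE) blast
next
  assume "\<exists>f. func f a b \<and> (\<forall>x x' y. opair x y \<in> elts f \<and> opair x' y \<in> elts f \<longrightarrow> x = x')"
  then obtain f where f: "func f a b" "\<And>x x' y. opair x y \<in> elts f \<Longrightarrow> opair x' y \<in> elts f \<Longrightarrow> x = x'"
    by blast
  have "inj_on (app f) (elts a)"
    using f(2) func_app[OF f(1)] by (metis inj_onI)
  then show "lepoll a b" using f(1) unfolding lepoll_def by blast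
qed

lemma dfn_func: "dft s \<Longrightarrow> dft t \<Longrightarrow> dft u \<Longrightarrow> dfn (\<lambda>e. func (s e) (t e) (u e))"
  by (rule dfn_subst3[OF dfn_func0])

lemma dfn_lepoll: "dft s \<Longrightarrow> dft t \<Longrightarrow> dfn (\<lambda>e. lepoll (s e) (t e))"
proof (rule dfn_subst2)
  show "dfn (\<lambda>e. lepoll (e 0) (e (Suc 0)))"
    unfolding lepoll_iff by (intro dfn_intros dfn_func dft_opair)
qed

lemma lepoll_subset: "elts a \<subseteq> elts b \<Longrightarrow> lepoll a b"
  by (rule lepollI[of "\<lambda>x y. y = x"]) (intro dfn_intros, auto)

lemma lepoll_trans: assumes "lepoll a b" "lepoll b c" shows "lepoll a c"
proof -
  obtain f where f: "func f a b" "\<And>x x' y. opair x y \<in> elts f \<Longrightarrow> opair x' y \<in> elts f \<Longrightarrow> x = x'"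
    using assms(1) by (rule lepollE) blast
  obtain g where g: "func g b c" "\<And>x x' y. opair x y \<in> elts g \<Longrightarrow> opair x' y \<in> elts g \<Longrightarrow> x = x'"
    using assms(2) by (rule lepollE) blast
  show ?thesis
  proof (rule lepollI[of "\<lambda>x y. \<exists>w. opair x w \<in> elts f \<and> opair w y \<in> elts g"])
    show "dfn (\<lambda>e. \<exists>w. opair (e 0) w \<in> elts f \<and> opair w (e (Suc 0)) \<in> elts g)"
      by (intro dfn_intros dft_opair)
    show "\<exists>y\<in>elts c. \<exists>w. opair x w \<in> elts f \<and> opair w y \<in> elts g" if "x \<in> elts a" for x
      using func_app[OF f(1) that] func_app[OF g(1) func_in[OF f(1) that]]
        func_in[OF g(1) func_in[OF f(1) that]] by blast
    fix x x' y
    assume "\<exists>w. opair x w \<in> elts f \<and> opair w y \<in> elts g" "\<exists>w. opair x' w \<in> elts f \<and> opair w y \<in> elts g"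
    then show "x = x'" using f(2) g(2) by metis
  qed
qed

lemma equipollentI:
  assumes "dfn (\<lambda>e. Q (e 0) (e (Suc 0)))"
    and "\<And>x. x \<in> elts a \<Longrightarrow> \<exists>y\<in>elts b. Q x y" "\<And>y. y \<in> elts b \<Longrightarrow> \<exists>x\<in>elts a. Q x y"
    and "\<And>x x' y. x \<in> elts a \<Longrightarrow> x' \<in> elts a \<Longrightarrow> Q x y \<Longrightarrow> Q x' y \<Longrightarrow> x = x'"
    and "\<And>x y y'. x \<in> elts a \<Longrightarrow> y \<in> elts b \<Longrightarrow> y' \<in> elts b \<Longrightarrow> Q x y \<Longrightarrow> Q x y' \<Longrightarrow> y = y'"
  shows "equipollent a b"
proof -
  obtain f where f: "func f a b" "\<And>x. x \<in> elts a \<Longrightarrow> Q x (app f x)"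
    using choice[OF assms(1,2)] by blast
  have "bij_betw (app f) (elts a) (elts b)"
  proof (rule bij_betw_imageI)
    show "inj_on (app f) (elts a)"
    proof (rule inj_onI)
      fix x x' assume x: "x \<in> elts a" "x' \<in> elts a" "app f x = app f x'"
      then show "x = x'" using f(2)[OF x(1)] f(2)[OF x(2)] assms(4) by simp
    qed
    show "app f ` elts a = elts b"
    proof
      show "app f ` elts a \<subseteq> elts b" using func_in[OF f(1)] by blast
      show "elts b \<subseteq> app f ` elts a"
      proof
        fix y assume y: "y \<in> elts b"
        obtain x where x: "x \<in> elts a" "Q x y" using assms(3)[OF y] by blast
        then have "y = app f x" using assms(5)[OF x(1) y func_in[OF f(1) x(1)] x(2) f(2)[OF x(1)]] by simp
        then show "y \<in> app f ` elts a" using x(1) by blast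
      qed
    qed
  qed
  then show ?thesis using f(1) unfolding equipollent_def by blast
qed

lemma equipollentE:
  assumes "equipollent a b"
  obtains f where "func f a b" "\<And>x x' y. opair x y \<in> elts f \<Longrightarrow> opair x' y \<in> elts f \<Longrightarrow> x = x'"
    "\<And>y. y \<in> elts b \<Longrightarrow> \<exists>x\<in>elts a. opair x y \<in> elts f"
proof -
  obtain f where f: "func f a b"
    "\<forall>x\<in>elts a. \<forall>x'\<in>elts a. \<forall>y\<in>elts b. opair x y \<in> elts f \<and> opair x' y \<in> elts f \<longrightarrow> x = x'"
    "\<forall>y\<in>elts b. \<exists>x\<in>elts a. opair x y \<in> elts f"
    using assms unfolding equipollent_alt by (elim exE conjE)
  then show ?thesis using func_mem[OF f(1)] by (intro that[of f]) blast+
qed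

lemma equipollent_sym: assumes "equipollent a b" shows "equipollent b a"
proof -
  obtain f where f: "func f a b" "\<And>x x' y. opair x y \<in> elts f \<Longrightarrow> opair x' y \<in> elts f \<Longrightarrow> x = x'"
    "\<And>y. y \<in> elts b \<Longrightarrow> \<exists>x\<in>elts a. opair x y \<in> elts f" using assms by (rule equipollentE) blast
  show ?thesis
  proof (rule equipollentI[of "\<lambda>y x. opair x y \<in> elts f"])
    show "dfn (\<lambda>e. opair (e (Suc 0)) (e 0) \<in> elts f)" by (intro dfn_intros dft_opair)
    show "\<And>x. x \<in> elts a \<Longrightarrow> \<exists>y\<in>elts b. opair x y \<in> elts f"
      using func_app[OF f(1)] func_in[OF f(1)] by blast
    show "\<And>x x' y. opair y x \<in> elts f \<Longrightarrow> opair y x' \<in> elts f \<Longrightarrow> x = x'"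
      using func_mem[OF f(1)] by metis
  qed (use f in blast)+
qed

lemma equipollent_lepoll: assumes "equipollent a b" shows "lepoll a b"
  using assms unfolding equipollent_def lepoll_def bij_betw_def by blast

section \<open>The well-ordering theorem\<close>

lemma ordinalI: "(\<And>y. y \<in> elts x \<Longrightarrow> ordinal y \<and> elts y \<subseteq> elts x) \<Longrightarrow> ordinal x"
  unfolding ordinal_def transitive_def by blast

lemma ordinal_elts_sub: "ordinal x \<Longrightarrow> y \<in> elts x \<Longrightarrow> elts y \<subseteq> elts x"
  unfolding ordinal_def transitive_def by blast

lemma no_set_of_ordinals: "\<not> small {\<alpha>. ordinal \<alpha>}"
proof
  assume "small {\<alpha>. ordinal \<alpha>}"
  then obtain x where x: "elts x = {\<alpha>. ordinal \<alpha>}" by (auto simp: small_iff)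
  then have "ordinal x" using ordinal_mem by (intro ordinalI) auto
  then show False using x mem_irrefl[of x] by blast
qed

text \<open>Zermelo's argument: G lists a by choosing at each ordinal a member of a not yet listed.
  If it never stopped, it would be injective on the ordinals, and Replacement applied to its inverse
  would collect all of them in a set.\<close>

lemma well_ordering: "\<exists>\<alpha>. ordinal \<alpha> \<and> equipollent a \<alpha>"
proof -
  \<comment> \<open>The choice function returns a itself on the empty set. Since a is not a member
    of a, this value signals that a is exhausted.\<close>
  have "dfn (\<lambda>e. (\<not> (\<exists>z. z \<in> elts (e 0)) \<and> e (Suc 0) = a) \<or> e (Suc 0) \<in> elts (e 0))"
    by (intro dfn_intros)
  then obtain c where c: "func c (powr a) (vsuc a)"
    "\<And>x. x \<in> elts (powr a) \<Longrightarrow> (\<not> (\<exists>z. z \<in> elts x) \<and> app c x = a) \<or> app c x \<in> elts x"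
    by (rule choice[where a = "powr a" and b = "vsuc a"]) auto
  define d where "d = (\<lambda>g. vset {z. z \<in> elts a \<and> \<not> (\<exists>u. opair u z \<in> elts g)})"
  have sd: "small {z. z \<in> elts a \<and> \<not> (\<exists>u. opair u z \<in> elts g)}" for g
    by (rule small_sep) (simp, intro dfn_intros dft_opair)
  have d: "elts (d g) = {z. z \<in> elts a \<and> \<not> (\<exists>u. opair u z \<in> elts g)}" for g
    unfolding d_def by (rule elts_vset[OF sd])
  have dd: "dft (\<lambda>e. d (e 0))" unfolding d_def by (rule dft_vset) (rule sd, intro dfn_intros dft_opair)
  define T where "T = (\<lambda>g. app c (d g))"
  have T_iff: "y = T g \<longleftrightarrow> opair (d g) y \<in> elts c" for y g
    unfolding T_def using func_app_iff[OF c(1), of "d g" y] by (auto simp: d)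
  have T: "dft (\<lambda>e. T (e 0))"
    unfolding dft_def T_iff by (intro dfn_intros dft_opair dft_subst1[OF dd])
  define G where "G = mrec T"
  define D where "D = (\<lambda>x. d (vset {opair y (G y) | y. y \<in> elts x}))"
  have D: "elts (D x) = {z. z \<in> elts a \<and> z \<notin> G ` elts x}" for x
    unfolding D_def d G_def elts_vset[OF small_mrec_graph[OF T]] by auto
  have G_eq: "G x = app c (D x)" for x
    unfolding G_def D_def by (subst mrec) (simp add: T_def)
  have G1: "G x \<in> elts a \<and> G x \<notin> G ` elts x" if "G x \<noteq> a" for x
    using c(2)[of "D x"] that unfolding G_eq[symmetric] by (auto simp: D)
  have G2: "elts a \<subseteq> G ` elts x" if "G x = a" for x
    using c(2)[of "D x"] that mem_irrefl[of a] unfolding G_eq[symmetric] by (auto simp: D)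
  have dG: "dft s \<Longrightarrow> dft (\<lambda>e. G (s e))" for s unfolding G_def by (rule dft_mrec[OF T])
  have inj: "\<alpha> = \<beta>" if "ordinal \<alpha>" "ordinal \<beta>" "G \<alpha> \<noteq> a" "G \<alpha> = G \<beta>" for \<alpha> \<beta>
    using ordinal_linear[OF that(1,2)] G1[of \<alpha>] G1[of \<beta>] that(3,4) by (metis imageI)
  have "\<exists>\<alpha>. ordinal \<alpha> \<and> G \<alpha> = a"
  proof (rule ccontr)
    assume "\<not> (\<exists>\<alpha>. ordinal \<alpha> \<and> G \<alpha> = a)"
    then have no: "G \<alpha> \<noteq> a" if "ordinal \<alpha>" for \<alpha> using that by blast
    have "small {z \<in> elts a. \<exists>\<alpha>. ordinal \<alpha> \<and> z = G \<alpha>}"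
      by (rule small_sep) (simp, intro dfn_intros dfn_ordinal dG)
    then have "small {\<alpha>. \<exists>z\<in>{z \<in> elts a. \<exists>\<alpha>. ordinal \<alpha> \<and> z = G \<alpha>}. ordinal \<alpha> \<and> z = G \<alpha>}"
    proof (rule small_repl_rel)
      show "dfn (\<lambda>e. ordinal (e (Suc 0)) \<and> e 0 = G (e (Suc 0)))"
        by (intro dfn_intros dfn_ordinal dG)
      show "\<exists>!\<alpha>. ordinal \<alpha> \<and> z = G \<alpha>" if "z \<in> {z \<in> elts a. \<exists>\<alpha>. ordinal \<alpha> \<and> z = G \<alpha>}" for z
        using that inj no by auto
    qed
    moreover have "{\<alpha>. \<exists>z\<in>{z \<in> elts a. \<exists>\<alpha>. ordinal \<alpha> \<and> z = G \<alpha>}. ordinal \<alpha> \<and> z = G \<alpha>} = {\<alpha>. ordinal \<alpha>}"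
      using G1 no by auto
    ultimately show False using no_set_of_ordinals by simp
  qed
  then obtain \<alpha>0 where "ordinal \<alpha>0 \<and> G \<alpha>0 = a" by blast
  \<comment> \<open>The least such ordinal is taken, so that all earlier values lie in a.\<close>
  then have "\<exists>\<alpha>. (ordinal \<alpha> \<and> G \<alpha> = a) \<and> (\<forall>\<beta>\<in>elts \<alpha>. \<not> (ordinal \<beta> \<and> G \<beta> = a))"
  proof (induction \<alpha>0 rule: mem_induct)
    case (step x)
    then show ?case by blast
  qed
  then obtain \<alpha> where \<alpha>: "ordinal \<alpha>" "G \<alpha> = a" "\<And>\<beta>. \<beta> \<in> elts \<alpha> \<Longrightarrow> G \<beta> \<noteq> a"
    using ordinal_mem by blast
  have "equipollent \<alpha> a"
  proof (rule equipollentI[of "\<lambda>x y. y = G x"])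
    show "dfn (\<lambda>e. e (Suc 0) = G (e 0))" by (intro dfn_intros dG)
    show "\<And>x. x \<in> elts \<alpha> \<Longrightarrow> \<exists>y\<in>elts a. y = G x" using G1 \<alpha>(3) by blast
    show "\<And>y. y \<in> elts a \<Longrightarrow> \<exists>x\<in>elts \<alpha>. y = G x" using G2[OF \<alpha>(2)] by blast
    show "\<And>x x' y. x \<in> elts \<alpha> \<Longrightarrow> x' \<in> elts \<alpha> \<Longrightarrow> y = G x \<Longrightarrow> y = G x' \<Longrightarrow> x = x'"
      using inj \<alpha>(1,3) ordinal_mem by metis
  qed simp
  then show ?thesis using \<alpha>(1) equipollent_sym by blast
qed

text \<open>A transitive set that injects into X is the transitive collapse of a relation on X.\<close>

definition collapse_of :: "'v \<Rightarrow> 'v \<Rightarrow> 'v \<Rightarrow> bool" where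
  "collapse_of X r t \<longleftrightarrow> transitive t \<and> (\<exists>f. func f t X \<and>
     (\<forall>x x' y. opair x y \<in> elts f \<and> opair x' y \<in> elts f \<longrightarrow> x = x') \<and>
     (\<forall>u v. opair u v \<in> elts r \<longleftrightarrow>
       (\<exists>a\<in>elts t. \<exists>b\<in>elts t. opair a u \<in> elts f \<and> opair b v \<in> elts f \<and> (a = b \<or> a \<in> elts b))))"

text \<open>By induction on membership, points of t and t' with the same image in X are equal, as r
  determines the images of their members. The reflexive pairs of r record which elements of X are
  images at all, and so give every point of t a partner in t'.\<close>

lemma collapse_sub:
  assumes "collapse_of X r t" "collapse_of X r t'" shows "elts t \<subseteq> elts t'"
proof -
  obtain f where t: "transitive t" and f: "func f t X"
    "\<And>x x' y. opair x y \<in> elts f \<Longrightarrow> opair x' y \<in> elts f \<Longrightarrow> x = x'"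
    "\<And>u v. opair u v \<in> elts r \<longleftrightarrow>
       (\<exists>a\<in>elts t. \<exists>b\<in>elts t. opair a u \<in> elts f \<and> opair b v \<in> elts f \<and> (a = b \<or> a \<in> elts b))"
    using assms(1) unfolding collapse_of_def by blast
  obtain f' where t': "transitive t'" and f': "func f' t' X"
    "\<And>x x' y. opair x y \<in> elts f' \<Longrightarrow> opair x' y \<in> elts f' \<Longrightarrow> x = x'"
    "\<And>u v. opair u v \<in> elts r \<longleftrightarrow>
       (\<exists>a\<in>elts t'. \<exists>b\<in>elts t'. opair a u \<in> elts f' \<and> opair b v \<in> elts f' \<and> (a = b \<or> a \<in> elts b))"
    using assms(2) unfolding collapse_of_def by blast
  have eq: "a = a'" if "a \<in> elts t" "a' \<in> elts t'" "opair a u \<in> elts f" "opair a' u \<in> elts f'" for a a' u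
    using that
  proof (induction a arbitrary: a' u rule: mem_induct)
    case (step a)
    have "b \<in> elts a'" if b: "b \<in> elts a" for b
    proof -
      have bt: "b \<in> elts t" using transitiveD[OF t b] step.prems by blast
      have "opair (app f b) u \<in> elts r"
        unfolding f(3) using b bt func_app[OF f(1) bt] step.prems by blast
      then obtain b' a'' where b': "b' \<in> elts t'" "opair b' (app f b) \<in> elts f'"
        "opair a'' u \<in> elts f'" "b' = a'' \<or> b' \<in> elts a''" unfolding f'(3) by blast
      have a'': "a'' = a'" using b'(3) step.prems f'(2) by blast
      have "b' \<noteq> a'"
      proof
        assume "b' = a'"
        then have "app f b = u" using b'(2) step.prems func_mem[OF f'(1)] by metis
        then have "b = a" using func_app[OF f(1) bt] step.prems f(2) by blast
        then show False using b mem_irrefl by blast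
      qed
      moreover have "b = b'" using step.IH[OF b bt b'(1) func_app[OF f(1) bt] b'(2)] .
      ultimately show ?thesis using b' a'' by blast
    qed
    moreover have "b' \<in> elts a" if b': "b' \<in> elts a'" for b'
    proof -
      have bt: "b' \<in> elts t'" using transitiveD[OF t' b'] step.prems by blast
      have "opair (app f' b') u \<in> elts r"
        unfolding f'(3) using b' bt func_app[OF f'(1) bt] step.prems by blast
      then obtain b a'' where b: "b \<in> elts t" "opair b (app f' b') \<in> elts f"
        "opair a'' u \<in> elts f" "b = a'' \<or> b \<in> elts a''" unfolding f(3) by blast
      have a'': "a'' = a" using b(3) step.prems f(2) by blast
      have "b \<noteq> a"
      proof
        assume "b = a"
        then have "app f' b' = u" using b(2) step.prems func_mem[OF f(1)] by metis
        then have "b' = a'" using func_app[OF f'(1) bt] step.prems f'(2) by blast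
        then show False using b' mem_irrefl by blast
      qed
      then have ba: "b \<in> elts a" using b a'' by blast
      then have "b = b'" using step.IH[OF ba b(1) bt b(2) func_app[OF f'(1) bt]] by blast
      then show ?thesis using ba by blast
    qed
    ultimately show ?case using elts_inject by blast
  qed
  show ?thesis
  proof
    fix a assume a: "a \<in> elts t"
    have "opair (app f a) (app f a) \<in> elts r" unfolding f(3) using a func_app[OF f(1) a] by blast
    then obtain a' where "a' \<in> elts t'" "opair a' (app f a) \<in> elts f'" unfolding f'(3) by blast
    then show "a \<in> elts t'" using eq[OF a _ func_app[OF f(1) a]] by blast
  qed
qed

lemma collapse_unique: "collapse_of X r t \<Longrightarrow> collapse_of X r t' \<Longrightarrow> t = t'"
  using collapse_sub by (metis elts_inject subset_antisym)

lemma dfn_collapse_of: "dft s \<Longrightarrow> dft t \<Longrightarrow> dfn (\<lambda>e. collapse_of X (s e) (t e))"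
proof (rule dfn_subst2)
  show "dfn (\<lambda>e. collapse_of X (e 0) (e (Suc 0)))"
    unfolding collapse_of_def by (intro dfn_intros dfn_transitive dfn_func dft_opair)
qed

text \<open>As collapses are unique, Replacement obtains these sets from the subsets of X \<times>
  X. A subset without collapse is sent to the empty set, because Replacement asks for a value
  everywhere. Both H \<theta> and the Hartogs numbers owe their existence to this bound.\<close>

lemma small_lepoll_transitive: "small {t. transitive t \<and> lepoll t X}"
proof -
  let ?Q = "\<lambda>r t. collapse_of X r t \<or> ((\<forall>t. \<not> collapse_of X r t) \<and> t = nv 0)"
  have "small {t. \<exists>r\<in>elts (powr (prods X X)). ?Q r t}"
  proof (rule small_repl_rel)
    show "dfn (\<lambda>e. ?Q (e 0) (e (Suc 0)))" by (intro dfn_intros dfn_collapse_of)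
    show "\<exists>!t. ?Q r t" for r using collapse_unique by metis
  qed (rule small_elts)
  moreover have "{t. transitive t \<and> lepoll t X} \<subseteq> {t. \<exists>r\<in>elts (powr (prods X X)). ?Q r t}"
  proof clarify
    fix t assume t: "transitive t" "lepoll t X"
    obtain f where f: "func f t X"
      "\<And>x x' y. opair x y \<in> elts f \<Longrightarrow> opair x' y \<in> elts f \<Longrightarrow> x = x'"
      using t(2) by (rule lepollE) blast
    have "small {z \<in> elts (prods X X). \<exists>u v. z = opair u v \<and> (\<exists>a\<in>elts t. \<exists>b\<in>elts t.
        opair a u \<in> elts f \<and> opair b v \<in> elts f \<and> (a = b \<or> a \<in> elts b))}"
      by (rule small_sep) (simp, intro dfn_intros dft_opair)
    then obtain r where r: "elts r = {z \<in> elts (prods X X). \<exists>u v. z = opair u v \<and> (\<exists>a\<in>elts t. \<exists>b\<in>elts t.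
        opair a u \<in> elts f \<and> opair b v \<in> elts f \<and> (a = b \<or> a \<in> elts b))}" by (auto simp: small_iff)
    have "opair u v \<in> elts r \<longleftrightarrow> (\<exists>a\<in>elts t. \<exists>b\<in>elts t.
        opair a u \<in> elts f \<and> opair b v \<in> elts f \<and> (a = b \<or> a \<in> elts b))" for u v
      unfolding r using func_mem[OF f(1)] by auto
    then have "collapse_of X r t" unfolding collapse_of_def using t(1) f by blast
    moreover have "r \<in> elts (powr (prods X X))" using r by auto
    ultimately show "\<exists>r\<in>elts (powr (prods X X)). ?Q r t" by blast
  qed
  ultimately show ?thesis
    by (rule small_mono) (unfold mem_Collect_eq, intro dfn_intros dfn_transitive dfn_lepoll)
qed

subsection \<open>The sets \<open>H \<theta>\<close> and regular cardinals\<close>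

text \<open>A member of H \<theta> is a subset of its transitive closure, which injects into
  \<theta> because each \<alpha> \<in> \<theta> is a subset of \<theta>. Such closures form a
  set.\<close>

lemma elts_H:
  assumes "transitive \<theta>" shows "elts (H \<theta>) = {x. \<exists>\<alpha>\<in>elts \<theta>. equipollent (trcl x) \<alpha>}"
  unfolding H_def
proof (rule elts_vset, rule small_mono)
  show "small (\<Union>u\<in>powr ` {t. transitive t \<and> lepoll t \<theta>}. elts u)"
    by (intro small_Union small_image small_lepoll_transitive dft_powr0)
  show "{x. \<exists>\<alpha>\<in>elts \<theta>. equipollent (trcl x) \<alpha>} \<subseteq> (\<Union>u\<in>powr ` {t. transitive t \<and> lepoll t \<theta>}. elts u)"
  proof clarify
    fix x \<alpha> assume "\<alpha> \<in> elts \<theta>" "equipollent (trcl x) \<alpha>"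
    then have "lepoll (trcl x) \<theta>"
      using assms equipollent_lepoll lepoll_trans lepoll_subset unfolding transitive_def by blast
    then show "x \<in> (\<Union>u\<in>powr ` {t. transitive t \<and> lepoll t \<theta>}. elts u)"
      using transitive_trcl trcl_sub by auto
  qed
  show "dfn (\<lambda>e. e 0 \<in> {x. \<exists>\<alpha>\<in>elts \<theta>. equipollent (trcl x) \<alpha>})"
    unfolding mem_Collect_eq by (intro dfn_intros dfn_equipollent dft_trcl)
qed

lemma dft_vsuc: "dft s \<Longrightarrow> dft (\<lambda>e. vsuc (s e))"
proof (erule dft_subst1[rotated])
  have i: "insert x (elts x) = {z. z = x \<or> z \<in> elts x}" for x by blast
  have s: "small {z. z = x \<or> z \<in> elts x}" for x
    using small_insert[OF small_elts, of x x] by (simp add: i)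
  show "dft (\<lambda>e. vsuc (e 0))" unfolding vsuc_def i
    by (rule dft_vset) (rule s, intro dfn_intros)
qed

text \<open>
  If X is closed under pairing, so that \<open>X \<times> X\<close> injects into X, its Hartogs number is regular, and no
  cardinal arithmetic is needed.
\<close>

definition hartogs :: "'v \<Rightarrow> 'v" where
  "hartogs X = vset {\<alpha>. ordinal \<alpha> \<and> lepoll \<alpha> X}"

lemma elts_hartogs: "elts (hartogs X) = {\<alpha>. ordinal \<alpha> \<and> lepoll \<alpha> X}"
  unfolding hartogs_def
  by (rule elts_vset, rule small_mono[OF small_lepoll_transitive[of X]], force simp: ordinal_def,
    unfold mem_Collect_eq, intro dfn_intros dfn_ordinal dfn_lepoll)

lemma ordinal_hartogs: "ordinal (hartogs X)"
proof (rule ordinalI)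
  fix \<alpha> assume "\<alpha> \<in> elts (hartogs X)"
  then have \<alpha>: "ordinal \<alpha>" "lepoll \<alpha> X" by (auto simp: elts_hartogs)
  have "ordinal \<beta> \<and> lepoll \<beta> X" if "\<beta> \<in> elts \<alpha>" for \<beta>
    using lepoll_trans[OF lepoll_subset[OF ordinal_elts_sub[OF \<alpha>(1) that]] \<alpha>(2)]
      ordinal_mem[OF \<alpha>(1) that] by blast
  then show "ordinal \<alpha> \<and> elts \<alpha> \<subseteq> elts (hartogs X)" using \<alpha>(1) by (auto simp: elts_hartogs)
qed

lemma opair_not_empty: "opair x y \<noteq> nv 0"
  using elts_opair[of x y] by (auto simp: elts_vset)

lemma regular_cardinal_hartogs:
  assumes pair: "\<And>x y. x \<in> elts X \<Longrightarrow> y \<in> elts X \<Longrightarrow> opair x y \<in> elts X"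
    and om: "elts omega \<subseteq> elts X"
  shows "regular_cardinal (hartogs X)"
proof -
  have z: "nv 0 \<in> elts X" using om elts_omega by blast
  have car: "cardinal (hartogs X)" unfolding cardinal_def
  proof (intro conjI ordinal_hartogs ballI notI)
    fix \<alpha> assume \<alpha>: "\<alpha> \<in> elts (hartogs X)" "equipollent \<alpha> (hartogs X)"
    then have "lepoll (hartogs X) X"
      using equipollent_lepoll[OF equipollent_sym[OF \<alpha>(2)]] lepoll_trans unfolding elts_hartogs by blast
    then have "hartogs X \<in> elts (hartogs X)" using ordinal_hartogs[of X] by (simp add: elts_hartogs)
    then show False using mem_irrefl by blast
  qed
  have sub: "elts omega \<subseteq> elts (hartogs X)"
  proof
    fix x assume "x \<in> elts omega"
    then obtain n where n: "x = nv n" using elts_omega by auto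
    have "elts (nv n) \<subseteq> elts X" using om elts_omega elts_nv[of n] by auto
    then show "x \<in> elts (hartogs X)" unfolding elts_hartogs n using ordinal_nv lepoll_subset by blast
  qed
  have suc: "vsuc \<alpha> \<in> elts (hartogs X)" if "\<alpha> \<in> elts (hartogs X)" for \<alpha>
  proof -
    have o: "ordinal \<alpha>" "lepoll \<alpha> X" using that by (auto simp: elts_hartogs)
    obtain f where f: "func f \<alpha> X" "\<And>x x' y. opair x y \<in> elts f \<Longrightarrow> opair x' y \<in> elts f \<Longrightarrow> x = x'"
      using o(2) by (rule lepollE) blast
    \<comment> \<open>The new point goes to the empty set, which is not a pair; the old ones go to
      pairs.\<close>
    have "lepoll (vsuc \<alpha>) X"
    proof (rule lepollI[of "\<lambda>x y. (x = \<alpha> \<and> y = nv 0) \<or> (\<exists>w. opair x w \<in> elts f \<and> y = opair w (nv 0))"])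
      show "dfn (\<lambda>e. (e 0 = \<alpha> \<and> e (Suc 0) = nv 0) \<or> (\<exists>w. opair (e 0) w \<in> elts f \<and> e (Suc 0) = opair w (nv 0)))"
        by (intro dfn_intros dft_opair)
      show "\<exists>y\<in>elts X. (x = \<alpha> \<and> y = nv 0) \<or> (\<exists>w. opair x w \<in> elts f \<and> y = opair w (nv 0))"
        if "x \<in> elts (vsuc \<alpha>)" for x
        using that z func_app[OF f(1), of x] pair[OF func_in[OF f(1)] z, of x] by auto
      fix x x' y
      assume "(x = \<alpha> \<and> y = nv 0) \<or> (\<exists>w. opair x w \<in> elts f \<and> y = opair w (nv 0))"
        "(x' = \<alpha> \<and> y = nv 0) \<or> (\<exists>w. opair x' w \<in> elts f \<and> y = opair w (nv 0))"
      then show "x = x'" using f(2) opair_not_empty by (metis opair_inject)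
    qed
    moreover have "ordinal (vsuc \<alpha>)" using o(1) unfolding ordinal_def transitive_def by auto
    ultimately show ?thesis by (simp add: elts_hartogs)
  qed
  have reg: "\<exists>\<beta>\<in>elts (hartogs X). \<forall>\<xi>\<in>elts \<alpha>. app f \<xi> \<in> elts \<beta>"
    if \<alpha>: "\<alpha> \<in> elts (hartogs X)" and f: "func f \<alpha> (hartogs X)" for \<alpha> f
  proof -
    have f': "app f \<xi> \<in> elts (hartogs X)" if "\<xi> \<in> elts \<alpha>" for \<xi> using func_in[OF f that] .
    obtain i where i: "func i \<alpha> X" "\<And>x x' y. opair x y \<in> elts i \<Longrightarrow> opair x' y \<in> elts i \<Longrightarrow> x = x'"
      using \<alpha> by (auto simp: elts_hartogs elim: lepollE)
    \<comment> \<open>Injections are chosen for the successors of the values of f, because \<beta>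
      must have the values themselves as members.\<close>
    let ?Q = "\<lambda>\<xi> g. \<exists>w. opair \<xi> w \<in> elts f \<and> func g (vsuc w) X \<and>
        (\<forall>x x' y. opair x y \<in> elts g \<and> opair x' y \<in> elts g \<longrightarrow> x = x')"
    have Qd: "dfn (\<lambda>e. ?Q (e 0) (e (Suc 0)))" by (intro dfn_intros dfn_func dft_opair dft_vsuc)
    have Qex: "\<exists>g\<in>elts (powr (prods (hartogs X) X)). ?Q \<xi> g" if \<xi>: "\<xi> \<in> elts \<alpha>" for \<xi>
    proof -
      have "lepoll (vsuc (app f \<xi>)) X" using suc[OF f'[OF \<xi>]] by (simp add: elts_hartogs)
      then obtain g where g: "func g (vsuc (app f \<xi>)) X"
        "\<And>x x' y. opair x y \<in> elts g \<Longrightarrow> opair x' y \<in> elts g \<Longrightarrow> x = x'"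
        by (rule lepollE) blast
      have "elts (vsuc (app f \<xi>)) \<subseteq> elts (hartogs X)"
        using f'[OF \<xi>] ordinal_hartogs[of X] unfolding ordinal_def transitive_def by auto
      then have "g \<in> elts (powr (prods (hartogs X) X))"
        using g(1) unfolding func_alt by fastforce
      then show ?thesis using g func_app[OF f \<xi>] by blast
    qed
    obtain h where h: "func h \<alpha> (powr (prods (hartogs X) X))" "\<And>\<xi>. \<xi> \<in> elts \<alpha> \<Longrightarrow> ?Q \<xi> (app h \<xi>)"
      using choice[OF Qd Qex] by blast
    have "small {z \<in> elts (hartogs X). \<exists>\<xi>\<in>elts \<alpha>. \<exists>w. opair \<xi> w \<in> elts f \<and> z \<in> elts (vsuc w)}"
      by (rule small_sep) (simp, intro dfn_intros dft_opair dft_vsuc)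
    then obtain \<beta> where
      b: "elts \<beta> = {z \<in> elts (hartogs X). \<exists>\<xi>\<in>elts \<alpha>. \<exists>w. opair \<xi> w \<in> elts f \<and> z \<in> elts (vsuc w)}"
      by (auto simp: small_iff)
    have \<beta>: "z \<in> elts \<beta> \<longleftrightarrow> (\<exists>\<xi>\<in>elts \<alpha>. z \<in> elts (vsuc (app f \<xi>)))" for z
    proof
      show "z \<in> elts \<beta> \<Longrightarrow> \<exists>\<xi>\<in>elts \<alpha>. z \<in> elts (vsuc (app f \<xi>))"
        unfolding b using func_mem[OF f] by blast
      assume "\<exists>\<xi>\<in>elts \<alpha>. z \<in> elts (vsuc (app f \<xi>))"
      then obtain \<xi> where \<xi>: "\<xi> \<in> elts \<alpha>" "z \<in> elts (vsuc (app f \<xi>))" by blast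
      then have "z \<in> elts (hartogs X)"
        using f'[OF \<xi>(1)] ordinal_hartogs[of X] unfolding ordinal_def transitive_def by auto
      then show "z \<in> elts \<beta>" unfolding b using \<xi> func_app[OF f \<xi>(1)] by blast
    qed
    have ob: "ordinal \<beta>"
    proof (rule ordinalI)
      fix z assume "z \<in> elts \<beta>"
      then obtain \<xi> where \<xi>: "\<xi> \<in> elts \<alpha>" "z \<in> elts (vsuc (app f \<xi>))" unfolding \<beta> by blast
      have o: "ordinal (vsuc (app f \<xi>))" using suc[OF f'[OF \<xi>(1)]] by (simp add: elts_hartogs)
      then show "ordinal z \<and> elts z \<subseteq> elts \<beta>"
        using ordinal_mem[OF o \<xi>(2)] ordinal_elts_sub[OF o \<xi>(2)] \<beta> \<xi>(1) by blast
    qed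
    \<comment> \<open>A point z of \<beta> is coded by the code of some \<xi> paired with the code
      of z under the injection chosen for \<xi>. There may be several such \<xi>, but the pair
      determines z.\<close>
    have "lepoll \<beta> X"
    proof (rule lepollI[of "\<lambda>z y. \<exists>\<xi> g u v. opair \<xi> g \<in> elts h \<and> opair \<xi> u \<in> elts i \<and>
          opair z v \<in> elts g \<and> y = opair u v"])
      show "dfn (\<lambda>e. \<exists>\<xi> g u v. opair \<xi> g \<in> elts h \<and> opair \<xi> u \<in> elts i \<and>
          opair (e 0) v \<in> elts g \<and> (e (Suc 0)) = opair u v)" by (intro dfn_intros dft_opair)
      show "\<exists>y\<in>elts X. \<exists>\<xi> g u v. opair \<xi> g \<in> elts h \<and> opair \<xi> u \<in> elts i \<and>
          opair z v \<in> elts g \<and> y = opair u v" if z: "z \<in> elts \<beta>" for z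
      proof -
        obtain \<xi> where \<xi>: "\<xi> \<in> elts \<alpha>" "z \<in> elts (vsuc (app f \<xi>))" using z unfolding \<beta> by blast
        obtain w where "opair \<xi> w \<in> elts f" "func (app h \<xi>) (vsuc w) X" using h(2)[OF \<xi>(1)] by blast
        then have g: "func (app h \<xi>) (vsuc (app f \<xi>)) X" using func_mem[OF f] by blast
        show ?thesis
          using func_app[OF h(1) \<xi>(1)] func_app[OF i(1) \<xi>(1)] func_app[OF g \<xi>(2)]
            pair[OF func_in[OF i(1) \<xi>(1)] func_in[OF g \<xi>(2)]] by blast
      qed
      fix z z' y
      assume "\<exists>\<xi> g u v. opair \<xi> g \<in> elts h \<and> opair \<xi> u \<in> elts i \<and> opair z v \<in> elts g \<and> y = opair u v"
        "\<exists>\<xi> g u v. opair \<xi> g \<in> elts h \<and> opair \<xi> u \<in> elts i \<and> opair z' v \<in> elts g \<and> y = opair u v"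
      then obtain \<xi> g u v \<xi>' g' u' v' where
        1: "opair \<xi> g \<in> elts h" "opair \<xi> u \<in> elts i" "opair z v \<in> elts g" "y = opair u v" and
        2: "opair \<xi>' g' \<in> elts h" "opair \<xi>' u' \<in> elts i" "opair z' v' \<in> elts g'" "y = opair u' v'"
        by blast
      have "u' = u" "v' = v" using 1 2 by auto
      then have "\<xi>' = \<xi>" using i(2) 1 2 by blast
      then have "g' = g" "\<xi> \<in> elts \<alpha>" "g = app h \<xi>" using func_mem[OF h(1)] 1 2 by blast+
      then show "z = z'" using h(2)[of \<xi>] 1(3) 2(3) \<open>v' = v\<close> by blast
    qed
    then have "\<beta> \<in> elts (hartogs X)" using ob by (simp add: elts_hartogs)
    moreover have "\<forall>\<xi>\<in>elts \<alpha>. app f \<xi> \<in> elts \<beta>" unfolding \<beta> by auto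
    ultimately show ?thesis by blast
  qed
  show ?thesis unfolding regular_cardinal_def using car sub reg by blast
qed

text \<open>X is stage \<omega> of the hierarchy over a transitive set that includes w,
  \<open>\<theta>\<^sub>0\<close> and \<omega>. As there is no last finite stage, X is closed under
  pairing, and its Hartogs number \<theta> is regular. The closure of a member of X is a subset of
  X, so its order type is below \<theta>. The conclusion keeps the transitive X inside H \<theta>,
  because it makes formulas about pairs absolute.\<close>

lemma large_regular_cardinal:
  assumes "ordinal \<theta>\<^sub>0"
  obtains \<theta> X where "regular_cardinal \<theta>" "\<theta>\<^sub>0 \<in> elts \<theta>" "transitive X" "elts w \<subseteq> elts X"
    "elts omega \<subseteq> elts X" "elts X \<subseteq> elts (H \<theta>)"
proof -
  have "small (elts w \<union> elts \<theta>\<^sub>0 \<union> elts omega)" by (intro small_Un small_elts)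
  then obtain s where s: "elts s = elts w \<union> elts \<theta>\<^sub>0 \<union> elts omega" by (auto simp: small_iff)
  define X where "X = hier (trcl s) omega"
  have X1: "elts (trcl s) \<subseteq> elts X" unfolding X_def using elts_hier[of "trcl s" omega] by blast
  have tX: "transitive X" unfolding X_def by (rule transitive_hier[OF transitive_trcl])
  have mono: "elts (hier (trcl s) (nv m)) \<subseteq> elts (hier (trcl s) (nv n))" if "m \<le> n" for m n
    using that hier_mono[OF transitive_trcl, of "nv m" "nv n" s] by (cases "m = n") auto
  have X: "x \<in> elts X \<longleftrightarrow> (\<exists>n. x \<in> elts (hier (trcl s) (nv n)))" for x
  proof
    assume "x \<in> elts X"
    then consider "x \<in> elts (trcl s)" | n where "elts x \<subseteq> elts (hier (trcl s) (nv n))"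
      unfolding X_def elts_hier[of "trcl s" omega] elts_omega by blast
    then show "\<exists>n. x \<in> elts (hier (trcl s) (nv n))"
    proof cases
      case 1
      then show ?thesis using elts_hier[of "trcl s"] by blast
    next
      case 2
      then have "x \<in> elts (hier (trcl s) (nv (Suc n)))" using elts_hier[of "trcl s" "nv (Suc n)"] by auto
      then show ?thesis by blast
    qed
  next
    assume "\<exists>n. x \<in> elts (hier (trcl s) (nv n))"
    then show "x \<in> elts X"
      unfolding X_def using hier_mono[OF transitive_trcl, of _ omega s] elts_omega by blast
  qed
  have pair: "opair x y \<in> elts X" if xy: "x \<in> elts X" "y \<in> elts X" for x y
  proof -
    obtain m n where "x \<in> elts (hier (trcl s) (nv m))" "y \<in> elts (hier (trcl s) (nv n))" using xy X by blast
    then have "x \<in> elts (hier (trcl s) (nv (max m n)))" "y \<in> elts (hier (trcl s) (nv (max m n)))"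
      using mono[of m "max m n"] mono[of n "max m n"] by auto
    then have "vset {x} \<in> elts (hier (trcl s) (nv (Suc (max m n))))"
      "vset {x, y} \<in> elts (hier (trcl s) (nv (Suc (max m n))))"
      unfolding elts_hier[of "trcl s" "nv (Suc (max m n))"] by (auto simp: elts_vset)
    then have "opair x y \<in> elts (hier (trcl s) (nv (Suc (Suc (max m n)))))"
      unfolding elts_hier[of "trcl s" "nv (Suc (Suc (max m n)))"]
      by (auto simp: elts_opair simp del: nv.simps)
    then show ?thesis using X by blast
  qed
  have om: "elts omega \<subseteq> elts X" using X1 trcl_sub[of s] s by blast
  have reg: "regular_cardinal (hartogs X)" by (rule regular_cardinal_hartogs[OF pair om])
  have th: "\<theta>\<^sub>0 \<in> elts (hartogs X)"
    unfolding elts_hartogs using assms lepoll_subset[of \<theta>\<^sub>0 X] X1 trcl_sub[of s] s by blast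
  have w: "elts w \<subseteq> elts X" using X1 trcl_sub[of s] s by blast
  have XH: "elts X \<subseteq> elts (H (hartogs X))"
  proof
    fix a assume "a \<in> elts X"
    then have "elts (trcl a) \<subseteq> elts X" using tX trcl_least unfolding transitive_def by blast
    moreover obtain \<alpha> where \<alpha>: "ordinal \<alpha>" "equipollent (trcl a) \<alpha>" using well_ordering by blast
    ultimately have "lepoll \<alpha> X"
      using lepoll_trans[OF equipollent_lepoll[OF equipollent_sym[OF \<alpha>(2)]]] lepoll_subset by blast
    then have "\<alpha> \<in> elts (hartogs X)" using \<alpha>(1) by (simp add: elts_hartogs)
    moreover have "transitive (hartogs X)" using ordinal_hartogs unfolding ordinal_def by blast
    ultimately show "a \<in> elts (H (hartogs X))" using \<alpha>(2) by (auto simp: elts_H)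
  qed
  show ?thesis by (rule that[OF reg th tX w om XH])
qed

subsection \<open>Elementary submodels\<close>

lemma sat_pair_fm: "sat A (pair_fm z x y) e \<longleftrightarrow> (\<forall>u\<in>A. u \<in> elts (e z) \<longleftrightarrow> u = e x \<or> u = e y)"
  by (auto simp: pair_fm_def all_fm_def iff_fm_def or_fm_def)

text \<open>A itself is not assumed transitive. Since \<open>e z\<close> lies in a transitive subset
  of A, its members and their members are in A, and these are all that a Kuratowski pair depends
  on.\<close>

lemma sat_opair_fm:
  assumes t: "transitive t" "elts t \<subseteq> A" "e z \<in> elts t" and e: "range e \<subseteq> A"
  shows "sat A (opair_fm z x y) e \<longleftrightarrow> e z = opair (e x) (e y)"
proof -
  have sub: "elts u \<subseteq> A" if "u = e z \<or> u \<in> elts (e z)" for u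
    using that t unfolding transitive_def by blast
  have eA: "e n \<in> A" for n using e by blast
  have 1: "sat A (opair_fm z x y) e \<longleftrightarrow> (\<exists>s\<in>A. \<exists>d\<in>A. (\<forall>u\<in>A. u \<in> elts (e z) \<longleftrightarrow> u = s \<or> u = d) \<and>
    (\<forall>u\<in>A. u \<in> elts s \<longleftrightarrow> u = e x \<or> u = e x) \<and> (\<forall>u\<in>A. u \<in> elts d \<longleftrightarrow> u = e x \<or> u = e y))"
    by (simp add: opair_fm_def sat_pair_fm)
  show ?thesis
  proof
    assume "sat A (opair_fm z x y) e"
    then obtain s d where sd: "s \<in> A" "d \<in> A" "\<forall>u\<in>A. u \<in> elts (e z) \<longleftrightarrow> u = s \<or> u = d"
      "\<forall>u\<in>A. u \<in> elts s \<longleftrightarrow> u = e x \<or> u = e x" "\<forall>u\<in>A. u \<in> elts d \<longleftrightarrow> u = e x \<or> u = e y"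
      unfolding 1 by (elim bexE conjE)
    have z: "elts (e z) = {s, d}" using sub[of "e z"] sd(1-3) by blast
    have "elts s = {e x}" using sub[of s] z sd(4) eA[of x] by blast
    moreover have "elts d = {e x, e y}" using sub[of d] z sd(5) eA[of x] eA[of y] by blast
    ultimately show "e z = opair (e x) (e y)"
      using z unfolding opair_def by (metis vset_elts)
  next
    assume z: "e z = opair (e x) (e y)"
    have "vset {e x} \<in> A" "vset {e x, e y} \<in> A" using sub[of "e z"] z elts_opair by auto
    then show "sat A (opair_fm z x y) e" unfolding 1 z elts_opair
      by (intro bexI[of _ "vset {e x}"] bexI[of _ "vset {e x, e y}"]) (auto simp: elts_vset)
  qed
qed

text \<open>An instance of the Tarski-Vaught property. By the transitive set t, the formula has in N
  the meaning that it has in V; elementarity gives a witness in M, and applied again it shows that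
  the witness is a true one.\<close>

lemma elementary_witness:
  assumes el: "elementary M N" and t: "transitive t" "elts t \<subseteq> elts N" "E \<in> elts t"
    and M: "E \<in> elts M" "a \<in> elts M" "b \<in> elts M" and y: "opair (opair a b) y \<in> elts E"
  shows "\<exists>y\<in>elts M. opair (opair a b) y \<in> elts E"
proof -
  \<comment> \<open>The free variables are y, E, a, b at 0, 1, 2, 3. Below the two quantifiers u is
    0, z is 1 and the others move up by two; the conjuncts say that z is in E, that z is (u, y) and
    that u is (a, b).\<close>
  define \<psi> where "\<psi> = Exists (Exists (Conj (Mem 1 3) (Conj (opair_fm 1 0 2) (opair_fm 0 4 5))))"
  define e where "e = case_nat E (case_nat a (\<lambda>_::nat. b))"
  have eM: "range e \<subseteq> elts M" unfolding e_def using M by (auto split: nat.splits)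
  have MN: "elts M \<subseteq> elts N" using el unfolding elementary_def by blast
  have t2: "z \<in> elts t" if "z \<in> elts E" for z using t(1,3) that unfolding transitive_def by blast
  have t3: "u \<in> elts t \<and> y' \<in> elts t" if "opair u y' \<in> elts E" for u y'
  proof -
    have 1: "opair u y' \<in> elts t" using t2[OF that] .
    then have "vset {u, y'} \<in> elts t" using transitiveD[OF t(1) _ 1] elts_opair by blast
    then show ?thesis using transitiveD[OF t(1), of _ "vset {u, y'}"] by (simp add: elts_vset)
  qed
  have \<psi>: "sat (elts N) \<psi> (case_nat y' e) \<longleftrightarrow> opair (opair a b) y' \<in> elts E" if y': "y' \<in> elts N" for y'
  proof -
    have "sat (elts N) \<psi> (case_nat y' e) \<longleftrightarrow> (\<exists>z\<in>elts N. \<exists>u\<in>elts N. z \<in> elts E \<and>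
      sat (elts N) (opair_fm 1 0 2) (case_nat u (case_nat z (case_nat y' e))) \<and>
      sat (elts N) (opair_fm 0 4 5) (case_nat u (case_nat z (case_nat y' e))))"
      unfolding \<psi>_def e_def by (simp add: eval_nat_numeral)
    also have "\<dots> \<longleftrightarrow> (\<exists>z\<in>elts N. \<exists>u\<in>elts N. z \<in> elts E \<and> z = opair u y' \<and> u = opair a b)"
    proof (intro bex_cong[OF refl] conj_cong[OF refl])
      fix z u assume z: "z \<in> elts N" "u \<in> elts N" "z \<in> elts E"
      let ?e = "case_nat u (case_nat z (case_nat y' e))"
      have "e n \<in> elts N" for n using eM MN by blast
      then have r: "range ?e \<subseteq> elts N" using z y' by (auto split: nat.splits)
      have e: "?e 0 = u" "?e 1 = z" "?e 2 = y'" "?e 4 = a" "?e 5 = b"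
        unfolding e_def by (simp_all add: eval_nat_numeral)
      have 1: "sat (elts N) (opair_fm 1 0 2) ?e \<longleftrightarrow> z = opair u y'"
        using sat_opair_fm[OF t(1,2), of ?e 1 0 2] r t2[OF z(3)] e by simp
      have 2: "sat (elts N) (opair_fm 0 4 5) ?e \<longleftrightarrow> u = opair a b" if "z = opair u y'"
        using sat_opair_fm[OF t(1,2), of ?e 0 4 5] r t3[of u y'] z(3) that e by simp
      show "sat (elts N) (opair_fm 1 0 2) ?e \<and> sat (elts N) (opair_fm 0 4 5) ?e \<longleftrightarrow>
          z = opair u y' \<and> u = opair a b" using 1 2 by blast
    qed
    also have "\<dots> \<longleftrightarrow> opair (opair a b) y' \<in> elts E" using t2 t3 t(2) by blast
    finally show ?thesis .
  qed
  have "sat (elts N) (Exists \<psi>) e" using \<psi>[of y] y t3[OF y] t(2) by auto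
  then have "sat (elts M) (Exists \<psi>) e" using el eM unfolding elementary_def by blast
  then obtain y' where y': "y' \<in> elts M" "sat (elts M) \<psi> (case_nat y' e)" by auto
  have "e n \<in> elts M" for n using eM by blast
  then have "range (case_nat y' e) \<subseteq> elts M" using y'(1) by (auto split: nat.splits)
  then have "sat (elts N) \<psi> (case_nat y' e)" using el y'(2) unfolding elementary_def by blast
  then show ?thesis using \<psi> y'(1) MN by blast
qed

subsection \<open>Finite and countable sets\<close>

lemma elts_ctbl_subsets: "elts (ctbl_subsets Z) = {Y. elts Y \<subseteq> elts Z \<and> equipollent Y omega}"
proof -
  have "small {Y \<in> elts (powr Z). equipollent Y omega}"
    by (rule small_sep) (rule small_elts, intro dfn_equipollent dft_var dft_const)
  then show ?thesis unfolding ctbl_subsets_def by (simp add: elts_vset)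
qed

lemma elts_fin_subsets:
  "elts (fin_subsets Z) = {s. elts s \<subseteq> elts Z \<and> (\<exists>n. natural n \<and> equipollent s n)}"
proof -
  have i: "(\<exists>n. natural n \<and> equipollent s n) \<longleftrightarrow> (\<exists>n\<in>elts omega. equipollent s n)" for s
    by (auto simp: natural_iff elts_omega)
  have "small {s \<in> elts (powr Z). \<exists>n\<in>elts omega. equipollent s n}"
    by (rule small_sep) (rule small_elts, intro dfn_intros dfn_equipollent)
  then show ?thesis unfolding fin_subsets_def i by (simp add: elts_vset)
qed

lemma pair_fin_subsets:
  assumes "q \<in> elts A" "r \<in> elts A" shows "vset {q, r} \<in> elts (fin_subsets A)"
proof -
  have "\<exists>n. equipollent (vset {q, r}) (nv n)"
  proof (cases "q = r")
    case True
    have "equipollent (vset {q, r}) (nv (Suc 0))"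
      by (rule equipollentI[of "\<lambda>x y. x = q \<and> y = nv 0"])
        (intro dfn_intros, auto simp: elts_vset True)
    then show ?thesis by blast
  next
    case False
    have "equipollent (vset {q, r}) (nv (Suc (Suc 0)))"
    proof (rule equipollentI[of "\<lambda>x y. (x = q \<and> y = nv 0) \<or> (x = r \<and> y = nv (Suc 0))"])
      show "dfn (\<lambda>e. (e 0 = q \<and> e (Suc 0) = nv 0) \<or> (e 0 = r \<and> e (Suc 0) = nv (Suc 0)))"
        by (intro dfn_intros)
      have "elts (nv (Suc (Suc 0))) = {nv 0, nv (Suc 0)}" by (auto simp: elts_vset)
      moreover have "nv 0 \<noteq> nv (Suc 0)" unfolding nv_inject by simp
      moreover have "elts (vset {q, r}) = {q, r}" by (simp add: elts_vset)
      ultimately show "\<And>x. x \<in> elts (vset {q, r}) \<Longrightarrow>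
         \<exists>y\<in>elts (nv (Suc (Suc 0))). (x = q \<and> y = nv 0) \<or> (x = r \<and> y = nv (Suc 0))"
        "\<And>y. y \<in> elts (nv (Suc (Suc 0))) \<Longrightarrow>
         \<exists>x\<in>elts (vset {q, r}). (x = q \<and> y = nv 0) \<or> (x = r \<and> y = nv (Suc 0))"
        "\<And>x x' y. (x = q \<and> y = nv 0) \<or> (x = r \<and> y = nv (Suc 0)) \<Longrightarrow>
           (x' = q \<and> y = nv 0) \<or> (x' = r \<and> y = nv (Suc 0)) \<Longrightarrow> x = x'"
        "\<And>x y y'. (x = q \<and> y = nv 0) \<or> (x = r \<and> y = nv (Suc 0)) \<Longrightarrow>
           (x = q \<and> y' = nv 0) \<or> (x = r \<and> y' = nv (Suc 0)) \<Longrightarrow> y = y'"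
        using False by (simp_all only:) (blast, blast, metis, metis)
    qed
    then show ?thesis by blast
  qed
  then show ?thesis using assms by (auto simp: elts_fin_subsets natural_iff elts_vset)
qed

lemma equipollent_omega: "equipollent omega omega"
  by (rule equipollentI[of "\<lambda>x y. x = y"]) (intro dfn_intros, auto)

lemma vsuc_omega: "w \<in> elts omega \<Longrightarrow> vsuc w \<in> elts omega"
proof -
  assume "w \<in> elts omega"
  then obtain n where "w = nv n" unfolding elts_omega by blast
  then have "vsuc w = nv (Suc n)" by simp
  then show ?thesis unfolding elts_omega by blast
qed

text \<open>Hilbert's hotel: the new point goes to 0 and the codes of the old ones move up by one.
  Clubs are unbounded with respect to sets equipollent to \<omega>, so parameters will be added to
  \<omega> one at a time.\<close>

lemma equipollent_omega_insert:
  assumes "equipollent Y omega" shows "\<exists>Z. elts Z = insert a (elts Y) \<and> equipollent Z omega"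
proof -
  obtain Z where Z: "elts Z = insert a (elts Y)"
    using small_insert[OF small_elts, of a Y] by (auto simp: small_iff)
  show ?thesis
  proof (cases "a \<in> elts Y")
    case True
    then have "Z = Y" using Z elts_inject by (metis insert_absorb)
    then show ?thesis using assms Z by blast
  next
    case False
    obtain f where f: "func f Y omega" "\<And>x x' y. opair x y \<in> elts f \<Longrightarrow> opair x' y \<in> elts f \<Longrightarrow> x = x'"
      "\<And>y. y \<in> elts omega \<Longrightarrow> \<exists>x\<in>elts Y. opair x y \<in> elts f" using assms by (rule equipollentE) blast
    have om: "nv n \<in> elts omega" for n unfolding elts_omega by blast
    have sne: "vsuc w \<noteq> nv 0" for w using elts_vsuc[of w] elts_nv[of 0] by (metis insert_not_empty lessThan_0 image_empty)
    have si: "w = w'" if w: "vsuc w = vsuc w'" "w \<in> elts omega" "w' \<in> elts omega" for w w'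
    proof -
      obtain m n where "w = nv m" "w' = nv n" using w(2,3) unfolding elts_omega by blast
      then show ?thesis using w(1) nv_inject[of "Suc m" "Suc n"] by simp
    qed
    have "equipollent Z omega"
    proof (rule equipollentI[of "\<lambda>x y. (x = a \<and> y = nv 0) \<or> (\<exists>w. opair x w \<in> elts f \<and> y = vsuc w)"])
      show "dfn (\<lambda>e. (e 0 = a \<and> e (Suc 0) = nv 0) \<or> (\<exists>w. opair (e 0) w \<in> elts f \<and> e (Suc 0) = vsuc w))"
        by (intro dfn_intros dft_opair dft_vsuc)
      show "\<exists>y\<in>elts omega. (x = a \<and> y = nv 0) \<or> (\<exists>w. opair x w \<in> elts f \<and> y = vsuc w)"
        if x: "x \<in> elts Z" for x
      proof (cases "x = a")
        case True
        then show ?thesis using om by blast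
      next
        case False
        then have "x \<in> elts Y" using x Z by blast
        then have "opair x (app f x) \<in> elts f" "app f x \<in> elts omega"
          using func_app[OF f(1)] func_in[OF f(1)] by blast+
        moreover from this have "vsuc (app f x) \<in> elts omega" by (simp add: vsuc_omega)
        ultimately show ?thesis by blast
      qed
      show "\<exists>x\<in>elts Z. (x = a \<and> y = nv 0) \<or> (\<exists>w. opair x w \<in> elts f \<and> y = vsuc w)"
        if y: "y \<in> elts omega" for y
      proof -
        obtain n where n: "y = nv n" using y unfolding elts_omega by blast
        show ?thesis
        proof (cases n)
          case 0
          then show ?thesis using n Z by blast
        next
          case (Suc m)
          then show ?thesis using f(3)[OF om[of m]] n Z by (metis insertI2 nv.simps(2))
        qed
      qed
      show "x = x'" if "x \<in> elts Z" "x' \<in> elts Z"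
        "(x = a \<and> y = nv 0) \<or> (\<exists>w. opair x w \<in> elts f \<and> y = vsuc w)"
        "(x' = a \<and> y = nv 0) \<or> (\<exists>w. opair x' w \<in> elts f \<and> y = vsuc w)" for x x' y
        using that(3,4) sne si f(2) func_mem[OF f(1)] by metis
      show "y = y'" if "x \<in> elts Z"
        "(x = a \<and> y = nv 0) \<or> (\<exists>w. opair x w \<in> elts f \<and> y = vsuc w)"
        "(x = a \<and> y' = nv 0) \<or> (\<exists>w. opair x w \<in> elts f \<and> y' = vsuc w)" for x y y'
        using that(2,3) False func_mem[OF f(1)] by metis
    qed
    then show ?thesis using Z by blast
  qed
qed

subsection \<open>Values of names\<close>

lemma same_value_iff: "same_value G \<sigma> \<tau> \<longleftrightarrow>
    (\<forall>\<rho> p. p \<in> G \<and> opair \<rho> p \<in> elts \<sigma> \<longrightarrow>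
      (\<exists>\<rho>' p'. p' \<in> G \<and> opair \<rho>' p' \<in> elts \<tau> \<and> same_value G \<rho> \<rho>')) \<and>
    (\<forall>\<rho>' p'. p' \<in> G \<and> opair \<rho>' p' \<in> elts \<tau> \<longrightarrow>
      (\<exists>\<rho> p. p \<in> G \<and> opair \<rho> p \<in> elts \<sigma> \<and> same_value G \<rho> \<rho>'))"
  by (subst same_value.simps) simp

text \<open>A name occurring in \<sigma> sits inside a Kuratowski pair, three membership steps down;
  inductions on names therefore follow the transitive closure of membership.\<close>

lemma name_mem: assumes "opair \<rho> p \<in> elts \<sigma>" shows "(\<rho>, \<sigma>) \<in> {(x, y). x \<in> elts y}\<^sup>+"
proof -
  have 1: "(opair \<rho> p, \<sigma>) \<in> {(x, y). x \<in> elts y}" using assms by simp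
  have 2: "(vset {\<rho>, p}, opair \<rho> p) \<in> {(x, y). x \<in> elts y}" by (simp add: elts_opair)
  have 3: "(\<rho>, vset {\<rho>, p}) \<in> {(x, y). x \<in> elts y}" by (simp add: elts_vset)
  show ?thesis
    by (rule trancl_trans[OF r_into_trancl[OF 3] trancl_trans[OF r_into_trancl[OF 2] r_into_trancl[OF 1]]])
qed

lemma same_value_refl: "same_value G \<sigma> \<sigma>"
proof (induction \<sigma> rule: mem_trancl_induct)
  case (step \<sigma>)
  have "same_value G \<rho> \<rho>" if "opair \<rho> p \<in> elts \<sigma>" for \<rho> p using step name_mem[OF that] .
  then show ?case by (subst same_value_iff) blast
qed

lemma same_value_sym: "same_value G \<sigma> \<tau> \<Longrightarrow> same_value G \<tau> \<sigma>"
proof (induction rule: same_value.induct)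
  case (1 \<sigma> \<tau>)
  then show ?case by (subst same_value_iff) blast
qed

lemma same_value_trans: "same_value G \<sigma> \<tau> \<Longrightarrow> same_value G \<tau> \<upsilon> \<Longrightarrow> same_value G \<sigma> \<upsilon>"
proof (induction arbitrary: \<upsilon> rule: same_value.induct)
  case (1 \<sigma> \<tau>)
  note u = 1(3)[unfolded same_value_iff[of G \<tau>]]
  show ?case
  proof (subst same_value_iff, intro conjI allI impI; elim conjE)
    fix \<rho> p assume "p \<in> G" "opair \<rho> p \<in> elts \<sigma>"
    then obtain \<rho>' p' where "p' \<in> G" "opair \<rho>' p' \<in> elts \<tau>"
      "\<And>\<upsilon>. same_value G \<rho>' \<upsilon> \<Longrightarrow> same_value G \<rho> \<upsilon>" using 1(1) by blast
    then show "\<exists>\<rho>' p'. p' \<in> G \<and> opair \<rho>' p' \<in> elts \<upsilon> \<and> same_value G \<rho> \<rho>'" using u by blast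
  next
    fix \<rho>' p' assume "p' \<in> G" "opair \<rho>' p' \<in> elts \<upsilon>"
    then obtain \<rho>1 p1 where 2: "p1 \<in> G" "opair \<rho>1 p1 \<in> elts \<tau>" "same_value G \<rho>1 \<rho>'" using u by blast
    then obtain \<rho> p where "p \<in> G" "opair \<rho> p \<in> elts \<sigma>"
      "\<And>\<upsilon>. same_value G \<rho>1 \<upsilon> \<Longrightarrow> same_value G \<rho> \<upsilon>" using 1(2) by blast
    then show "\<exists>\<rho> p. p \<in> G \<and> opair \<rho> p \<in> elts \<sigma> \<and> same_value G \<rho> \<rho>'" using 2(3) by blast
  qed
qed

lemma val_eq_iff: "val G \<sigma> = val G \<tau> \<longleftrightarrow> same_value G \<sigma> \<tau>"
  unfolding val_def using same_value_refl same_value_sym same_value_trans by blast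

text \<open>Members were defined through all names of the same value; the clauses of
  \<open>same_value\<close> show that any single one of these names yields all of them.\<close>

lemma ext_elts_val: "ext_elts G (val G \<tau>) = {val G \<sigma> | \<sigma> p. p \<in> G \<and> opair \<sigma> p \<in> elts \<tau>}"
proof
  show "{val G \<sigma> | \<sigma> p. p \<in> G \<and> opair \<sigma> p \<in> elts \<tau>} \<subseteq> ext_elts G (val G \<tau>)"
    unfolding ext_elts_def by blast
  show "ext_elts G (val G \<tau>) \<subseteq> {val G \<sigma> | \<sigma> p. p \<in> G \<and> opair \<sigma> p \<in> elts \<tau>}"
  proof
    fix z assume "z \<in> ext_elts G (val G \<tau>)"
    then obtain \<sigma> \<tau>' p where z: "z = val G \<sigma>" "val G \<tau> = val G \<tau>'" "p \<in> G" "opair \<sigma> p \<in> elts \<tau>'"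
      unfolding ext_elts_def by blast
    have "same_value G \<tau> \<tau>'" using z(2) val_eq_iff by blast
    then obtain \<rho> p' where "p' \<in> G" "opair \<rho> p' \<in> elts \<tau>" "same_value G \<rho> \<sigma>"
      using z(3,4) unfolding same_value_iff[of G \<tau>] by blast
    then show "z \<in> {val G \<sigma> | \<sigma> p. p \<in> G \<and> opair \<sigma> p \<in> elts \<tau>}"
      unfolding z(1) val_eq_iff[symmetric] by blast
  qed
qed

lemma val_extensional:
  assumes "ext_elts G (val G \<sigma>) = ext_elts G (val G \<tau>)" shows "val G \<sigma> = val G \<tau>"
proof -
  have sub: "\<exists>\<rho>' p'. p' \<in> G \<and> opair \<rho>' p' \<in> elts \<tau>' \<and> same_value G \<rho> \<rho>'"
    if "ext_elts G (val G \<sigma>') \<subseteq> ext_elts G (val G \<tau>')" "p \<in> G" "opair \<rho> p \<in> elts \<sigma>'" for \<sigma>' \<tau>' \<rho> p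
  proof -
    have "val G \<rho> \<in> ext_elts G (val G \<tau>')" using that unfolding ext_elts_val by blast
    then show ?thesis unfolding ext_elts_val val_eq_iff[symmetric] by auto
  qed
  have "same_value G \<sigma> \<tau>"
    using sub[of \<sigma> \<tau>] sub[of \<tau> \<sigma>] assms same_value_sym by (subst same_value_iff) blast
  then show ?thesis by (simp add: val_eq_iff)
qed

end

subsection \<open>The approximation argument\<close>

locale forcing_notion = zfc_model elts for elts :: "'v \<Rightarrow> 'v set" +
  fixes P le :: 'v
  assumes forcing: "forcing P le"
begin

section \<open>Conditions and generic filters\<close>

abbreviation below :: "'v \<Rightarrow> 'v \<Rightarrow> bool" (infix "\<preceq>" 50) where
  "p \<preceq> q \<equiv> opair p q \<in> elts le"

lemma below_refl: "p \<in> elts P \<Longrightarrow> p \<preceq> p"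
  using forcing unfolding forcing_def by blast

lemma below_trans: "p \<preceq> q \<Longrightarrow> q \<preceq> r \<Longrightarrow> p \<preceq> r"
  using forcing unfolding forcing_def by blast

lemma below_mem: assumes "p \<preceq> q" shows "p \<in> elts P" "q \<in> elts P"
proof -
  have "elts le \<subseteq> {opair p q | p q. p \<in> elts P \<and> q \<in> elts P}"
    using forcing unfolding forcing_def by - (elim conjE)
  then have "opair p q \<in> {opair p q | p q. p \<in> elts P \<and> q \<in> elts P}" using assms by (rule subsetD)
  then show "p \<in> elts P" "q \<in> elts P" by auto
qed

lemma dfn_compatible: "dft s \<Longrightarrow> dft t \<Longrightarrow> dfn (\<lambda>e. compatible P le (s e) (t e))"
  by (rule dfn_subst2, unfold compatible_def, intro dfn_intros dft_opair)

text \<open>G meets the dense sets that are elements of V, and definability turns the dense class Q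
  into one of these.\<close>

lemma generic_meets:
  assumes G: "generic_filter P le G" and Q: "dfn (\<lambda>e. Q (e 0))"
    and ex: "\<And>p. p \<in> elts P \<Longrightarrow> \<exists>q. q \<preceq> p \<and> Q q"
  shows "\<exists>q\<in>G. Q q"
proof -
  obtain D where D: "elts D = {q \<in> elts P. Q q}"
    using small_sep[OF small_elts Q, of P] by (auto simp: small_iff)
  have 1: "\<forall>p\<in>elts P. \<exists>d\<in>elts D. d \<preceq> p" using ex below_mem unfolding D by blast
  have 2: "elts D \<subseteq> elts P" using D by blast
  have 3: "\<forall>D. elts D \<subseteq> elts P \<and> (\<forall>p\<in>elts P. \<exists>d\<in>elts D. d \<preceq> p) \<longrightarrow> G \<inter> elts D \<noteq> {}"
    using G unfolding generic_filter_def by - (elim conjE)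
  have "G \<inter> elts D \<noteq> {}" by (rule 3[THEN spec, THEN mp, OF conjI, OF 2 1])
  then show ?thesis using D by blast
qed

lemma generic_sub: "generic_filter P le G \<Longrightarrow> p \<in> G \<Longrightarrow> p \<in> elts P"
  unfolding generic_filter_def by (elim conjE) (rule subsetD)

lemma generic_up: "generic_filter P le G \<Longrightarrow> p \<in> G \<Longrightarrow> p \<preceq> q \<Longrightarrow> q \<in> G"
  unfolding generic_filter_def by (elim conjE) (simp add: below_mem(2))

lemma generic_directed:
  "generic_filter P le G \<Longrightarrow> p \<in> G \<Longrightarrow> q \<in> G \<Longrightarrow> \<exists>r\<in>G. r \<preceq> p \<and> r \<preceq> q"
  unfolding generic_filter_def by (elim conjE) simp

lemma generic_nonempty: "generic_filter P le G \<Longrightarrow> \<exists>p. p \<in> G"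
  unfolding generic_filter_def by (elim conjE) auto

text \<open>Adding the conditions incompatible with p turns density below p into density; none of
  the added ones is in G.\<close>

lemma generic_meets_below:
  assumes G: "generic_filter P le G" and Q: "dfn (\<lambda>e. Q (e 0))" and p: "p \<in> G"
    and ex: "\<And>r. r \<preceq> p \<Longrightarrow> \<exists>q. q \<preceq> r \<and> Q q"
  shows "\<exists>q\<in>G. Q q"
proof -
  have "\<exists>q\<in>G. Q q \<or> \<not> compatible P le q p"
  proof (rule generic_meets[OF G])
    show "dfn (\<lambda>e. Q (e 0) \<or> \<not> compatible P le (e 0) p)"
      by (intro dfn_intros dfn_compatible Q)
    fix r assume r: "r \<in> elts P"
    show "\<exists>q. q \<preceq> r \<and> (Q q \<or> \<not> compatible P le q p)"
    proof (cases "compatible P le r p")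
      case True
      then obtain s where "s \<preceq> r" "s \<preceq> p" unfolding compatible_def by blast
      then show ?thesis using ex below_trans by blast
    next
      case False
      then show ?thesis using below_refl[OF r] by blast
    qed
  qed
  then obtain q where q: "q \<in> G" "Q q \<or> \<not> compatible P le q p" by blast
  obtain s where "s \<in> G" "s \<preceq> q" "s \<preceq> p" using generic_directed[OF G q(1) p] by blast
  then have "compatible P le q p" using generic_sub[OF G] unfolding compatible_def by blast
  then show ?thesis using q by blast
qed

text \<open>
  A set W of pairs (y, p) stands for a name of a subset of V: the condition p forces y into the
  set if and only if (y, p) is in W.
\<close>

definition excludes :: "'v \<Rightarrow> 'v \<Rightarrow> 'v \<Rightarrow> bool" where
  "excludes W y p \<longleftrightarrow> (\<forall>q. q \<preceq> p \<longrightarrow> opair y q \<notin> elts W)"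

definition disagree :: "'v \<Rightarrow> 'v \<Rightarrow> 'v \<Rightarrow> bool" where
  "disagree W p q \<longleftrightarrow> (\<exists>y. opair y p \<in> elts W \<and> excludes W y q)"

definition splits :: "'v \<Rightarrow> 'v \<Rightarrow> bool" where
  "splits W p \<longleftrightarrow> (\<exists>q r. q \<preceq> p \<and> r \<preceq> p \<and> disagree W q r)"

lemma dfn_excludes: "dft s \<Longrightarrow> dft t \<Longrightarrow> dfn (\<lambda>e. excludes W (s e) (t e))"
  by (rule dfn_subst2, unfold excludes_def, intro dfn_intros dft_opair)

lemma dfn_disagree: "dft s \<Longrightarrow> dft t \<Longrightarrow> dfn (\<lambda>e. disagree W (s e) (t e))"
  by (rule dfn_subst2, unfold disagree_def, intro dfn_intros dft_opair dfn_excludes)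

lemma dfn_splits: "dft s \<Longrightarrow> dfn (\<lambda>e. splits W (s e))"
  by (rule dfn_subst1, unfold splits_def, intro dfn_intros dft_opair dfn_disagree)

text \<open>
  On a singleton the algebra picks one half of a pair of disagreeing extensions, and on the
  resulting two-element set it picks the other half.
\<close>

lemma splitting_algebra:
  obtains F where "algebra F P"
    "\<And>A q. closed_under F A \<Longrightarrow> elts A \<subseteq> elts P \<Longrightarrow> q \<in> elts A \<Longrightarrow> splits W q \<Longrightarrow>
      \<exists>v\<in>elts A. \<exists>r\<in>elts A. v \<preceq> q \<and> r \<preceq> q \<and> disagree W v r"
proof -
  define dis where "dis = (\<lambda>v r. disagree W v r \<or> disagree W r v)"
  \<comment> \<open>A finite set does not tell a condition from its extension, so u and v range over
    all of s. For r1 below q, either reading of {q, r1} yields conditions below q.\<close>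
  define Q1 where "Q1 = (\<lambda>s r. \<exists>u\<in>elts s. \<exists>v\<in>elts s. v \<preceq> u \<and> r \<preceq> u \<and> dis v r)"
  define Q2 where "Q2 = (\<lambda>s r. \<exists>u\<in>elts s. r \<preceq> u \<and> (\<exists>r'. r' \<preceq> u \<and> dis r r'))"
  have d1: "dft s \<Longrightarrow> dft t \<Longrightarrow> dfn (\<lambda>e. Q1 (s e) (t e))" for s t
    by (rule dfn_subst2, unfold Q1_def dis_def, intro dfn_intros dft_opair dfn_disagree)
  have d2: "dft s \<Longrightarrow> dft t \<Longrightarrow> dfn (\<lambda>e. Q2 (s e) (t e))" for s t
    by (rule dfn_subst2, unfold Q2_def dis_def, intro dfn_intros dft_opair dfn_disagree)
  \<comment> \<open>Completing a disagreeing pair has priority over starting one; where neither is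
    possible, any condition serves.\<close>
  let ?Q = "\<lambda>s r. Q1 s r \<or> ((\<forall>z. \<not> Q1 s z) \<and> (Q2 s r \<or> (\<forall>z. \<not> Q2 s z)))"
  have Q: "dfn (\<lambda>e. ?Q (e 0) (e (Suc 0)))" by (intro dfn_intros d1 d2)
  have P: "Q1 s r \<Longrightarrow> r \<in> elts P" "Q2 s r \<Longrightarrow> r \<in> elts P" for s r
    unfolding Q1_def Q2_def using below_mem by blast+
  have ne: "\<exists>r. r \<in> elts P" using forcing unfolding forcing_def by blast
  have ex: "\<exists>r\<in>elts P. ?Q s r" for s
    using P[of s] ne by (cases "\<exists>z. Q1 s z"; cases "\<exists>z. Q2 s z") blast+
  obtain F where F: "func F (fin_subsets P) P" "\<And>s. s \<in> elts (fin_subsets P) \<Longrightarrow> ?Q s (app F s)"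
    using choice[OF Q ex, of "fin_subsets P"] by blast
  show ?thesis
  proof (rule that[of F])
    show "algebra F P" unfolding algebra_def by (rule F(1))
    fix A q assume A: "closed_under F A" "elts A \<subseteq> elts P" and q: "q \<in> elts A" "splits W q"
    have cl: "app F s \<in> elts A \<and> ?Q s (app F s)" if "s \<in> elts (fin_subsets A)" for s
    proof -
      have "s \<in> elts (fin_subsets P)" using that A(2) unfolding elts_fin_subsets by blast
      then show ?thesis using F(2) A(1) that unfolding closed_under_def by blast
    qed
    have main: "\<exists>v\<in>elts A. \<exists>r\<in>elts A. v \<preceq> q \<and> r \<preceq> q \<and> dis v r"
      if r1: "r1 \<in> elts A" "r1 \<preceq> q" and ex1: "\<exists>z. Q1 (vset {q, r1}) z" for r1
    proof -
      have "Q1 (vset {q, r1}) (app F (vset {q, r1}))" "app F (vset {q, r1}) \<in> elts A"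
        using cl[OF pair_fin_subsets[OF q(1) r1(1)]] ex1 by blast+
      then obtain u v where "u \<in> {q, r1}" "v \<in> {q, r1}" "v \<preceq> u"
        "app F (vset {q, r1}) \<preceq> u" "dis v (app F (vset {q, r1}))"
        unfolding Q1_def elts_vset[OF small_pair] by blast
      moreover have "q \<preceq> q" using q(1) A(2) below_refl by blast
      ultimately show ?thesis using \<open>app F (vset {q, r1}) \<in> elts A\<close> r1 q(1) below_trans by blast
    qed
    have "q \<preceq> q" using q(1) A(2) below_refl by blast
    have "\<exists>v\<in>elts A. \<exists>r\<in>elts A. v \<preceq> q \<and> r \<preceq> q \<and> dis v r"
    proof (cases "\<exists>z. Q1 (vset {q, q}) z")
      \<comment> \<open>Here q itself disagrees with one of its extensions, which can happen because
        W is not assumed to be closed downward in this lemma.\<close>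
      case True
      then show ?thesis using main q(1) \<open>q \<preceq> q\<close> by blast
    next
      case False
      obtain v r where "v \<preceq> q" "r \<preceq> q" "dis v r" using q(2) unfolding splits_def dis_def by blast
      then have "Q2 (vset {q, q}) v" unfolding Q2_def elts_vset[OF small_pair] by blast
      then have Q2: "Q2 (vset {q, q}) (app F (vset {q, q}))" and r1: "app F (vset {q, q}) \<in> elts A"
        using cl[OF pair_fin_subsets[OF q(1) q(1)]] False by blast+
      obtain r' where r': "app F (vset {q, q}) \<preceq> q" "r' \<preceq> q" "dis (app F (vset {q, q})) r'"
        using Q2 unfolding Q2_def elts_vset[OF small_pair] by blast
      then have "Q1 (vset {q, app F (vset {q, q})}) r'"
        unfolding Q1_def elts_vset[OF small_pair] by blast
      then show ?thesis using main r1 r'(1) by blast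
    qed
    then show "\<exists>v\<in>elts A. \<exists>r\<in>elts A. v \<preceq> q \<and> r \<preceq> q \<and> disagree W v r"
      unfolding dis_def by blast
  qed
qed

text \<open>For every Y an injection into \<omega> is chosen, and E relates Y and n to the point
  with code n. Each point of Y is thus the only one related to Y and some n, so an elementary
  submodel with E and Y as members contains it, once all natural numbers are in the model.\<close>

lemma ctbl_enumeration:
  obtains E where
    "\<And>Y y. Y \<in> elts (ctbl_subsets Z) \<Longrightarrow> y \<in> elts Y \<Longrightarrow> \<exists>n\<in>elts omega. opair (opair Y n) y \<in> elts E"
    "\<And>Y n y y'. opair (opair Y n) y \<in> elts E \<Longrightarrow> opair (opair Y n) y' \<in> elts E \<Longrightarrow> y = y'"
proof -
  let ?Q = "\<lambda>Y f. func f Y omega \<and>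
    (\<forall>x x' y. opair x y \<in> elts f \<and> opair x' y \<in> elts f \<longrightarrow> x = x')"
  have Q: "dfn (\<lambda>e. ?Q (e 0) (e (Suc 0)))" by (intro dfn_intros dfn_func dft_opair)
  have ex: "\<exists>f\<in>elts (powr (prods Z omega)). ?Q Y f" if Y: "Y \<in> elts (ctbl_subsets Z)" for Y
  proof -
    have 1: "elts Y \<subseteq> elts Z" "lepoll Y omega"
      using Y equipollent_lepoll by (auto simp: elts_ctbl_subsets)
    obtain f where f: "func f Y omega" "\<And>x x' y. opair x y \<in> elts f \<Longrightarrow> opair x' y \<in> elts f \<Longrightarrow> x = x'"
      using 1(2) by (rule lepollE) blast
    have "f \<in> elts (powr (prods Z omega))" using f(1) 1(1) unfolding func_alt by fastforce
    then show ?thesis using f by blast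
  qed
  obtain h where h: "func h (ctbl_subsets Z) (powr (prods Z omega))"
    "\<And>Y. Y \<in> elts (ctbl_subsets Z) \<Longrightarrow> ?Q Y (app h Y)"
    using choice[OF Q ex] by blast
  have "small {z \<in> elts (prods (prods (ctbl_subsets Z) omega) Z).
      \<exists>Y n y f. z = opair (opair Y n) y \<and> opair Y f \<in> elts h \<and> opair y n \<in> elts f}"
    by (rule small_sep) (rule small_elts, intro dfn_intros dft_opair)
  then obtain E where E: "elts E = {z \<in> elts (prods (prods (ctbl_subsets Z) omega) Z).
      \<exists>Y n y f. z = opair (opair Y n) y \<and> opair Y f \<in> elts h \<and> opair y n \<in> elts f}"
    by (auto simp: small_iff)
  have E': "opair (opair Y n) y \<in> elts E \<longleftrightarrow> Y \<in> elts (ctbl_subsets Z) \<and> n \<in> elts omega \<and> y \<in> elts Z \<and>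
      opair y n \<in> elts (app h Y)" for Y n y
    unfolding E using func_mem[OF h(1)] func_app[OF h(1)] by (auto, blast)
  show ?thesis
  proof (rule that[of E])
    fix Y y assume Y: "Y \<in> elts (ctbl_subsets Z)" "y \<in> elts Y"
    have f: "func (app h Y) Y omega" using h(2)[OF Y(1)] by blast
    show "\<exists>n\<in>elts omega. opair (opair Y n) y \<in> elts E"
      using func_app[OF f Y(2)] func_in[OF f Y(2)] Y unfolding E' elts_ctbl_subsets by blast
  next
    fix Y n y y' assume "opair (opair Y n) y \<in> elts E" "opair (opair Y n) y' \<in> elts E"
    then show "y = y'" unfolding E' using h(2)[of Y] by blast
  qed
qed

text \<open>What almost strong genericity leaves behind for W: a condition below q all of whose
  extensions split is compatible with both sides of some disagreement at a point of M. Neither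
  formulas nor \<theta> occur in it, so it is definable and genericity applies.\<close>

definition good_model :: "'v \<Rightarrow> 'v \<Rightarrow> 'v \<Rightarrow> bool" where
  "good_model W M q \<longleftrightarrow> (\<forall>q'. q' \<preceq> q \<and> (\<forall>u. u \<preceq> q' \<longrightarrow> splits W u) \<longrightarrow>
     (\<exists>v r. \<exists>y\<in>elts M. opair y v \<in> elts W \<and> excludes W y r \<and>
        compatible P le v q' \<and> compatible P le r q'))"

lemma dfn_good_model: "dft s \<Longrightarrow> dft t \<Longrightarrow> dfn (\<lambda>e. good_model W (s e) (t e))"
  by (rule dfn_subst2, unfold good_model_def,
      intro dfn_intros dft_opair dfn_splits dfn_excludes dfn_compatible)

text \<open>C is the club for a suitable \<theta>, and by unboundedness some M in C contains p, F,
  E, D and all natural numbers. As p is in M, it has an almost strongly generic extension q.\<close>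

lemma good_model_dense:
  assumes asp: "almost_strongly_proper P le"
  obtains C where "\<And>M. M \<in> elts C \<Longrightarrow> equipollent M omega"
    "\<And>p. p \<in> elts P \<Longrightarrow> \<exists>q. q \<preceq> p \<and> (\<exists>M\<in>elts C. good_model W M q)"
proof -
  obtain \<theta>\<^sub>0 where o: "ordinal \<theta>\<^sub>0" and asp': "\<And>\<theta>. regular_cardinal \<theta> \<Longrightarrow> \<theta>\<^sub>0 \<in> elts \<theta> \<Longrightarrow>
       (\<exists>C. club C (H \<theta>) \<and>
         (\<forall>M\<in>elts C. elementary M (H \<theta>) \<and> ctbl_subsets P \<in> elts M \<and>
           (\<forall>p\<in>elts M \<inter> elts P. \<exists>q\<in>elts P. opair q p \<in> elts le \<and>
              almost_strongly_generic M P le q)))"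
    using asp unfolding almost_strongly_proper_def by blast
  obtain F where F: "algebra F P"
    "\<And>A q. closed_under F A \<Longrightarrow> elts A \<subseteq> elts P \<Longrightarrow> q \<in> elts A \<Longrightarrow> splits W q \<Longrightarrow>
      \<exists>v\<in>elts A. \<exists>r\<in>elts A. v \<preceq> q \<and> r \<preceq> q \<and> disagree W v r"
    by (rule splitting_algebra) blast
  obtain E where E:
    "\<And>Y y. Y \<in> elts (ctbl_subsets P) \<Longrightarrow> y \<in> elts Y \<Longrightarrow> \<exists>n\<in>elts omega. opair (opair Y n) y \<in> elts E"
    "\<And>Y n y y'. opair (opair Y n) y \<in> elts E \<Longrightarrow> opair (opair Y n) y' \<in> elts E \<Longrightarrow> y = y'"
    by (rule ctbl_enumeration) blast
  \<comment> \<open>The domain of W bounds the points y, so that Separation gives D.\<close>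
  obtain U where "elts U = {y. \<exists>p. opair y p \<in> elts W}"
    using small_domain[of W] by (auto simp: small_iff)
  then have U: "\<And>y p. opair y p \<in> elts W \<Longrightarrow> y \<in> elts U" by blast
  have "small {z \<in> elts (prods (prods P P) U).
      \<exists>v r y. z = opair (opair v r) y \<and> opair y v \<in> elts W \<and> excludes W y r}"
    by (rule small_sep) (rule small_elts, intro dfn_intros dft_opair dfn_excludes)
  then obtain D where "elts D = {z \<in> elts (prods (prods P P) U).
      \<exists>v r y. z = opair (opair v r) y \<and> opair y v \<in> elts W \<and> excludes W y r}"
    by (auto simp: small_iff)
  then have D: "opair (opair v r) y \<in> elts D \<longleftrightarrow> v \<in> elts P \<and> r \<in> elts P \<and>
      opair y v \<in> elts W \<and> excludes W y r" for v r y
    using U by auto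
  \<comment> \<open>P is included so that every p \<in> P is in X by transitivity, and hence in H
    \<theta>.\<close>
  obtain w where w: "elts w = {F, E, D, P}"
    using small_insert[OF small_insert[OF small_pair[of D P]], of F E] by (auto simp: small_iff)
  obtain \<theta> X where \<theta>: "regular_cardinal \<theta>" "\<theta>\<^sub>0 \<in> elts \<theta>" and X: "transitive X" "elts w \<subseteq> elts X"
    "elts omega \<subseteq> elts X" "elts X \<subseteq> elts (H \<theta>)"
    by (rule large_regular_cardinal[OF o]) blast
  obtain C where C: "club C (H \<theta>)" and CM: "\<And>M. M \<in> elts C \<Longrightarrow> elementary M (H \<theta>)"
    "\<And>M p. M \<in> elts C \<Longrightarrow> p \<in> elts M \<Longrightarrow> p \<in> elts P \<Longrightarrow>
        \<exists>q. q \<preceq> p \<and> almost_strongly_generic M P le q"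
    using asp'[OF \<theta>] by blast
  show ?thesis
  proof (rule that[of C])
    show "equipollent M omega" if "M \<in> elts C" for M
      using C that unfolding club_def elts_ctbl_subsets by blast
    fix p assume p: "p \<in> elts P"
    obtain Y1 where Y1: "elts Y1 = insert F (elts omega)" "equipollent Y1 omega"
      using equipollent_omega_insert[OF equipollent_omega] by blast
    obtain Y2 where Y2: "elts Y2 = insert E (elts Y1)" "equipollent Y2 omega"
      using equipollent_omega_insert[OF Y1(2)] by blast
    obtain Y3 where Y3: "elts Y3 = insert D (elts Y2)" "equipollent Y3 omega"
      using equipollent_omega_insert[OF Y2(2)] by blast
    obtain Y where Y: "elts Y = insert p (elts Y3)" "equipollent Y omega"
      using equipollent_omega_insert[OF Y3(2)] by blast
    have wX: "F \<in> elts X" "E \<in> elts X" "D \<in> elts X" "P \<in> elts X"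
      using X(2) unfolding w by simp_all
    have Y_eq: "elts Y = insert p (insert D (insert E (insert F (elts omega))))"
      unfolding Y(1) Y3(1) Y2(1) Y1(1) ..
    have "p \<in> elts X" using transitiveD[OF X(1) p wX(4)] .
    then have "elts Y \<subseteq> elts (H \<theta>)" unfolding Y_eq using X(3,4) wX(1-3) by auto
    then obtain M where M: "M \<in> elts C" "elts Y \<subseteq> elts M"
      using C Y(2) unfolding club_def elts_ctbl_subsets by blast
    have MF: "F \<in> elts M" "E \<in> elts M" "D \<in> elts M" "p \<in> elts M" "elts omega \<subseteq> elts M"
      using M(2) unfolding Y_eq by auto
    obtain q where q: "q \<preceq> p" "almost_strongly_generic M P le q" using CM(2)[OF M(1) MF(4) p] by blast
    note wit = elementary_witness[OF CM(1)[OF M(1)] X(1) X(4)]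
    have "good_model W M q" unfolding good_model_def
    proof (intro allI impI, elim conjE)
      fix q' assume q': "q' \<preceq> q" and sp: "\<forall>u. u \<preceq> q' \<longrightarrow> splits W u"
      have "stationary M P (S P le q')"
        using q(2) q' below_mem(1)[OF q'] unfolding almost_strongly_generic_def by blast
      then obtain A where A: "A \<in> elts M" "A \<in> S P le q'" "closed_under F A"
        using MF(1) F(1) unfolding stationary_def by blast
      obtain t where At: "A \<in> elts (ctbl_subsets P)" and t: "t \<in> elts A"
        and comp: "\<And>r. r \<in> elts A \<Longrightarrow> r \<preceq> t \<Longrightarrow> compatible P le r q'"
        using A(2) unfolding S_def by blast
      have AP: "elts A \<subseteq> elts P" using At unfolding elts_ctbl_subsets by blast
      \<comment> \<open>As t is itself a member of A below t, it has a common extension u with q'.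
        Splitting passes from u up to t, and t is in A, where F can act on it.\<close>
      have "compatible P le t q'" using comp[OF t] below_refl t AP by blast
      then obtain u where u: "u \<preceq> t" "u \<preceq> q'" unfolding compatible_def by blast
      have "splits W u" using sp u(2) by blast
      then have "splits W t" using u(1) below_trans unfolding splits_def by blast
      then obtain v r where vr: "v \<in> elts A" "r \<in> elts A" "v \<preceq> t" "r \<preceq> t" "disagree W v r"
        using F(2)[OF A(3) AP t] by blast
      have AM: "y \<in> elts M" if y: "y \<in> elts A" for y
      proof -
        obtain n where n: "n \<in> elts omega" "opair (opair A n) y \<in> elts E" using E(1)[OF At y] by blast
        have "\<exists>y\<in>elts M. opair (opair A n) y \<in> elts E"
          by (rule wit[OF _ MF(2) A(1) _ n(2)]) (use wX(2) MF(5) n(1) in blast)+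
        then show ?thesis using E(2)[OF n(2)] by blast
      qed
      \<comment> \<open>This y0 may lie outside M; elementarity replaces it by a point of M at which
        the same v and r disagree.\<close>
      obtain y0 where "opair y0 v \<in> elts W" "excludes W y0 r" using vr(5) unfolding disagree_def by blast
      then have y0: "opair (opair v r) y0 \<in> elts D" unfolding D using vr(1,2) AP by blast
      have "\<exists>y\<in>elts M. opair (opair v r) y \<in> elts D"
        by (rule wit[OF _ MF(3) AM[OF vr(1)] AM[OF vr(2)] y0]) (rule wX(3))
      then show "\<exists>v r. \<exists>y\<in>elts M. opair y v \<in> elts W \<and> excludes W y r \<and>
        compatible P le v q' \<and> compatible P le r q'"
        unfolding D using comp vr by blast
    qed
    then show "\<exists>q. q \<preceq> p \<and> (\<exists>M\<in>elts C. good_model W M q)" using q(1) M(1) by blast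
  qed
qed

text \<open>The combinatorial core, free of names: x has become the set of those y that W selects
  with the help of G, and smallness expresses membership in V.\<close>

lemma approximation:
  assumes asp: "almost_strongly_proper P le" and G: "generic_filter P le G"
    and down: "\<And>y p q. opair y p \<in> elts W \<Longrightarrow> q \<preceq> p \<Longrightarrow> opair y q \<in> elts W"
    and approx: "\<And>a. countable_in_V a \<Longrightarrow> small {y \<in> elts a. \<exists>p\<in>G. opair y p \<in> elts W}"
  shows "small {y. \<exists>p\<in>G. opair y p \<in> elts W}"
proof (rule ccontr)
  assume not: "\<not> small {y. \<exists>p\<in>G. opair y p \<in> elts W}"
  obtain C where C: "\<And>M. M \<in> elts C \<Longrightarrow> equipollent M omega"
    "\<And>p. p \<in> elts P \<Longrightarrow> \<exists>q. q \<preceq> p \<and> (\<exists>M\<in>elts C. good_model W M q)"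
    by (rule good_model_dense[OF asp]) blast
  have excl: "False" if "opair y p \<in> elts W" "p \<in> G" "excludes W y r" "r \<in> G" for y p r
    using generic_directed[OF G that(2,4)] down[OF that(1)] that(3) unfolding excludes_def by blast
  have "\<exists>p\<in>G. (\<forall>u. u \<preceq> p \<longrightarrow> splits W u) \<or> \<not> splits W p"
  proof (rule generic_meets[OF G])
    show "dfn (\<lambda>e. (\<forall>u. u \<preceq> e 0 \<longrightarrow> splits W u) \<or> \<not> splits W (e 0))"
      by (intro dfn_intros dft_opair dfn_splits)
    show "\<exists>q. q \<preceq> p \<and> ((\<forall>u. u \<preceq> q \<longrightarrow> splits W u) \<or> \<not> splits W q)" if "p \<in> elts P" for p
      using below_refl[OF that] by blast
  qed
  then obtain p0 where p0: "p0 \<in> G" "(\<forall>u. u \<preceq> p0 \<longrightarrow> splits W u) \<or> \<not> splits W p0" by blast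
  have "splits W p0"
  proof (rule ccontr)
    assume ns: "\<not> splits W p0"
    \<comment> \<open>Without splitting, no two extensions of p0 disagree, so what one of them puts
      into the set is in it. The set is then computed in V from p0.\<close>
    have "{y. \<exists>p\<in>G. opair y p \<in> elts W} = {y. \<exists>r. r \<preceq> p0 \<and> opair y r \<in> elts W}"
    proof (intro set_eqI iffI; clarsimp)
      fix y p assume "p \<in> G" "opair y p \<in> elts W"
      then show "\<exists>r. r \<preceq> p0 \<and> opair y r \<in> elts W"
        using generic_directed[OF G p0(1)] down by blast
    next
      fix y r assume r: "r \<preceq> p0" "opair y r \<in> elts W"
      have "\<exists>s\<in>G. opair y s \<in> elts W \<or> excludes W y s"
      proof (rule generic_meets[OF G])
        show "dfn (\<lambda>e. opair y (e 0) \<in> elts W \<or> excludes W y (e 0))"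
          by (intro dfn_intros dft_opair dfn_excludes)
        show "\<exists>q. q \<preceq> p \<and> (opair y q \<in> elts W \<or> excludes W y q)" if "p \<in> elts P" for p
          using below_refl[OF that] unfolding excludes_def by blast
      qed
      then obtain s where s: "s \<in> G" "opair y s \<in> elts W \<or> excludes W y s" by blast
      have "\<not> excludes W y s"
      proof
        assume e: "excludes W y s"
        obtain s' where "s' \<preceq> s" "s' \<preceq> p0" using generic_directed[OF G s(1) p0(1)] by blast
        moreover from this have "excludes W y s'" using e below_trans unfolding excludes_def by blast
        ultimately show False using ns r unfolding splits_def disagree_def by blast
      qed
      then show "\<exists>p\<in>G. opair y p \<in> elts W" using s by blast
    qed
    moreover have "small {y. \<exists>r. r \<preceq> p0 \<and> opair y r \<in> elts W}"
    proof (rule small_mono[OF small_domain[of W]])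
      show "dfn (\<lambda>e. e 0 \<in> {y. \<exists>r. r \<preceq> p0 \<and> opair y r \<in> elts W})"
        unfolding mem_Collect_eq by (intro dfn_intros dft_opair)
    qed blast
    ultimately show False using not by simp
  qed
  then have p0s: "\<And>u. u \<preceq> p0 \<Longrightarrow> splits W u" using p0(2) by blast
  have "\<exists>q\<in>G. \<exists>M\<in>elts C. good_model W M q"
    by (rule generic_meets[OF G]) (intro dfn_intros dfn_good_model, rule C(2))
  then obtain q M where q: "q \<in> G" and M: "M \<in> elts C" "good_model W M q" by blast
  have cM: "countable_in_V M"
    using equipollent_lepoll[OF C(1)[OF M(1)]] unfolding countable_in_V_def lepoll_def .
  then obtain b where b: "elts b = {y \<in> elts M. \<exists>p\<in>G. opair y p \<in> elts W}"
    using approx[OF cM] by (auto simp: small_iff)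
  \<comment> \<open>Error about b at a point of M. No condition in G errs, so by genericity some
    condition in G has no erring extension at all; in this sense it decides the part of the set in
    M.\<close>
  define Er where "Er = (\<lambda>r. \<exists>y\<in>elts M. (y \<in> elts b \<and> excludes W y r) \<or> (y \<notin> elts b \<and> opair y r \<in> elts W))"
  have dEr: "dft s \<Longrightarrow> dfn (\<lambda>e. Er (s e))" for s
    by (rule dfn_subst1, unfold Er_def, intro dfn_intros dft_opair dfn_excludes)
  have "\<exists>r\<in>G. Er r \<or> (\<forall>s. s \<preceq> r \<longrightarrow> \<not> Er s)"
  proof (rule generic_meets[OF G])
    show "dfn (\<lambda>e. Er (e 0) \<or> (\<forall>s. s \<preceq> e 0 \<longrightarrow> \<not> Er s))" by (intro dfn_intros dft_opair dEr)
    show "\<exists>q. q \<preceq> p \<and> (Er q \<or> (\<forall>s. s \<preceq> q \<longrightarrow> \<not> Er s))" if "p \<in> elts P" for p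
      using below_refl[OF that] by blast
  qed
  then obtain q1 where q1: "q1 \<in> G" "Er q1 \<or> (\<forall>s. s \<preceq> q1 \<longrightarrow> \<not> Er s)" by blast
  have "\<not> Er q1"
  proof
    assume "Er q1"
    then obtain y where y: "y \<in> elts M"
      "(y \<in> elts b \<and> excludes W y q1) \<or> (y \<notin> elts b \<and> opair y q1 \<in> elts W)" unfolding Er_def by blast
    then show False using excl q1(1) b by blast
  qed
  then have q1s: "\<And>s. s \<preceq> q1 \<Longrightarrow> \<not> Er s" using q1(2) by blast
  obtain q' where q': "q' \<in> G" "q' \<preceq> p0" "q' \<preceq> q1" using generic_directed[OF G p0(1) q1(1)] by blast
  obtain q2 where q2: "q2 \<in> G" "q2 \<preceq> q'" "q2 \<preceq> q" using generic_directed[OF G q'(1) q] by blast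
  have "\<forall>u. u \<preceq> q2 \<longrightarrow> splits W u" using p0s q'(2) q2(2) below_trans by blast
  then obtain v r y where y: "y \<in> elts M" "opair y v \<in> elts W" "excludes W y r"
    "compatible P le v q2" "compatible P le r q2"
    using M(2) q2(3) unfolding good_model_def by blast
  obtain s where s: "s \<preceq> v" "s \<preceq> q2" using y(4) unfolding compatible_def by blast
  obtain s' where s': "s' \<preceq> r" "s' \<preceq> q2" using y(5) unfolding compatible_def by blast
  \<comment> \<open>One of s and s' must err about b at y, since s puts y in and s' keeps it out;
    but both extend q1.\<close>
  have nE: "\<not> Er s" "\<not> Er s'" using q1s s(2) s'(2) q2(2) q'(3) below_trans by blast+
  show False
  proof (cases "y \<in> elts b")
    case True
    have "excludes W y s'" using y(3) s'(1) below_trans unfolding excludes_def by blast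
    then show False using nE(2) True y(1) unfolding Er_def by blast
  next
    case False
    have "opair y s \<in> elts W" using down[OF y(2) s(1)] .
    then show False using nE(1) False y(1) unfolding Er_def by blast
  qed
qed

subsection \<open>Names of subsets of the ground model\<close>

context
  fixes G assumes G: "generic_filter P le G"
begin

lemma ext_elts_ground: "ext_elts G (ground P G a) = ground P G ` elts a"
  unfolding ground_def ext_elts_val elts_check
  using generic_nonempty[OF G] generic_sub[OF G] by auto

text \<open>Canonical names attach every condition and G is nonempty, so the conditions on their
  side drop out of the clauses.\<close>

lemma same_value_check_iff: "same_value G \<sigma> (check P y) \<longleftrightarrow>
    (\<forall>\<rho> p. p \<in> G \<and> opair \<rho> p \<in> elts \<sigma> \<longrightarrow> (\<exists>z\<in>elts y. same_value G \<rho> (check P z))) \<and>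
    (\<forall>z\<in>elts y. \<exists>\<rho> p. p \<in> G \<and> opair \<rho> p \<in> elts \<sigma> \<and> same_value G \<rho> (check P z))"
proof -
  have 1: "p \<in> G \<and> opair \<rho> p \<in> elts (check P y) \<longleftrightarrow> p \<in> G \<and> (\<exists>z\<in>elts y. \<rho> = check P z)" for \<rho> p
    unfolding elts_check using generic_sub[OF G] by auto
  have 2: "\<exists>p. p \<in> G" using generic_nonempty[OF G] .
  show ?thesis
    unfolding same_value_iff[of G \<sigma>] conj_assoc[symmetric] 1 using 2 by blast
qed

lemma check_inject: "same_value G (check P y) (check P z) \<Longrightarrow> y = z"
proof (induction y arbitrary: z rule: mem_induct)
  case (step y)
  obtain p where p: "p \<in> G" "p \<in> elts P" using generic_nonempty[OF G] generic_sub[OF G] by blast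
  have c: "opair (check P x) p \<in> elts (check P y)" if "x \<in> elts y" for x y
    using that p(2) unfolding elts_check by blast
  note s = iffD1[OF same_value_check_iff step.prems]
  have "x \<in> elts z" if "x \<in> elts y" for x
    using s c[OF that] p(1) step.IH[OF that] by blast
  moreover have "x \<in> elts y" if x: "x \<in> elts z" for x
  proof -
    obtain \<rho> q where "opair \<rho> q \<in> elts (check P y)" "same_value G \<rho> (check P x)" using s x by blast
    then obtain x' where "x' \<in> elts y" "same_value G (check P x') (check P x)"
      unfolding elts_check by auto
    then show ?thesis using step.IH by blast
  qed
  ultimately show ?case using elts_inject by blast
qed

lemma ground_inject: "ground P G y = ground P G z \<longleftrightarrow> y = z"
  unfolding ground_def val_eq_iff using check_inject same_value_refl by blast

text \<open>A set in V of candidate values is required before forcing can be a relation in V. Each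
  member of y is the value of a name occurring in \<sigma>, and so appears in the hierarchy by the
  stage \<sigma>.\<close>

lemma same_value_check_bound:
  "same_value G \<sigma> (check P y) \<Longrightarrow> elts y \<subseteq> elts (hier (nv 0) \<sigma>)"
proof (induction \<sigma> arbitrary: y rule: mem_trancl_induct)
  case (step \<sigma>)
  show ?case
  proof
    fix z assume "z \<in> elts y"
    then obtain \<rho> p where \<rho>: "opair \<rho> p \<in> elts \<sigma>" "same_value G \<rho> (check P z)"
      using iffD1[OF same_value_check_iff step.prems] by blast
    have t: "transitive (nv 0)" using ordinal_nv[of 0] unfolding ordinal_def by blast
    have "elts z \<subseteq> elts (hier (nv 0) \<rho>)" using step.IH[OF name_mem[OF \<rho>(1)] \<rho>(2)] .
    then have "z \<in> elts (hier (nv 0) (vset {\<rho>, p}))"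
      unfolding elts_hier[of "nv 0" "vset {\<rho>, p}"] elts_vset[OF small_pair] by blast
    moreover have "vset {\<rho>, p} \<in> elts (opair \<rho> p)" by (simp add: elts_opair)
    ultimately show "z \<in> elts (hier (nv 0) \<sigma>)"
      using hier_mono[OF t] \<rho>(1) by blast
  qed
qed

end

text \<open>
  The clause for "p forces the name \<open>\<sigma>\<close> to be y", where X is the set of triples at which the same
  relation is already known.
\<close>

definition eq_clause :: "'v \<Rightarrow> 'v \<Rightarrow> 'v \<Rightarrow> 'v \<Rightarrow> bool" where
  "eq_clause X \<sigma> y p \<longleftrightarrow>
    (\<forall>\<rho> s q. opair \<rho> s \<in> elts \<sigma> \<and> q \<preceq> p \<and> q \<preceq> s \<longrightarrow>
      (\<exists>q' z. q' \<preceq> q \<and> z \<in> elts y \<and> opair (opair \<rho> z) q' \<in> elts X)) \<and>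
    (\<forall>z q. z \<in> elts y \<and> q \<preceq> p \<longrightarrow>
      (\<exists>q' \<rho> s. q' \<preceq> q \<and> opair \<rho> s \<in> elts \<sigma> \<and> q' \<preceq> s \<and> opair (opair \<rho> z) q' \<in> elts X))"

lemma eq_clause_mono: "eq_clause X \<sigma> y p \<Longrightarrow> elts X \<subseteq> elts X' \<Longrightarrow> eq_clause X' \<sigma> y p"
  unfolding eq_clause_def by fast

lemma dfn_eq_clause0: "dfn (\<lambda>e. eq_clause (e i) (e j) (e k) (e l))"
  unfolding eq_clause_def by (intro dfn_intros dft_opair)

text \<open>Knaster-Tarski inside V: F is the union of all sets of triples that satisfy their own
  clause, and the image F' of F is one of these. Bounding the triples by T, B and P lets Separation
  form F. The equation is all that is passed on, because induction on names derives the meaning of F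
  from it.\<close>

lemma ex_forces_eq:
  obtains F where "\<And>\<sigma> y p. \<sigma> \<in> elts T \<Longrightarrow> y \<in> elts B \<Longrightarrow> p \<in> elts P \<Longrightarrow>
    opair (opair \<sigma> y) p \<in> elts F \<longleftrightarrow> eq_clause F \<sigma> y p"
proof -
  define post where "post = (\<lambda>X. \<forall>\<sigma> y p. opair (opair \<sigma> y) p \<in> elts X \<longrightarrow> eq_clause X \<sigma> y p)"
  have dp: "dfn (\<lambda>e. post (e i))" for i
    unfolding post_def by (intro dfn_intros dft_opair dfn_eq_clause0)
  have "small {w \<in> elts (prods (prods T B) P). \<exists>X. elts X \<subseteq> elts (prods (prods T B) P) \<and> post X \<and> w \<in> elts X}"
    by (rule small_sep) (rule small_elts, intro dfn_intros dp)
  then obtain F where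
    F: "elts F = {w \<in> elts (prods (prods T B) P). \<exists>X. elts X \<subseteq> elts (prods (prods T B) P) \<and> post X \<and> w \<in> elts X}"
    by (auto simp: small_iff)
  have sub: "elts X \<subseteq> elts F" if "elts X \<subseteq> elts (prods (prods T B) P)" "post X" for X
    using that F by blast
  have Fp: "eq_clause F \<sigma> y p" if "opair (opair \<sigma> y) p \<in> elts F" for \<sigma> y p
  proof -
    obtain X where X: "elts X \<subseteq> elts (prods (prods T B) P)" "post X" "opair (opair \<sigma> y) p \<in> elts X"
      using \<open>opair (opair \<sigma> y) p \<in> elts F\<close> unfolding F by blast
    then show ?thesis using eq_clause_mono[OF _ sub[OF X(1,2)]] unfolding post_def by blast
  qed
  have "small {w \<in> elts (prods (prods T B) P). \<exists>\<sigma> y p. w = opair (opair \<sigma> y) p \<and> eq_clause F \<sigma> y p}"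
  proof (rule small_sep[OF small_elts])
    \<comment> \<open>The clause was shown definable in variables only, so F enters as the value of
      a bound variable.\<close>
    have "dfn (\<lambda>e. \<exists>f \<sigma> y p. f = F \<and> e 0 = opair (opair \<sigma> y) p \<and> eq_clause f \<sigma> y p)"
      by (intro dfn_intros dft_opair dfn_eq_clause0)
    then show "dfn (\<lambda>e. \<exists>\<sigma> y p. e 0 = opair (opair \<sigma> y) p \<and> eq_clause F \<sigma> y p)" by simp
  qed
  then obtain F' where F': "elts F' =
      {w \<in> elts (prods (prods T B) P). \<exists>\<sigma> y p. w = opair (opair \<sigma> y) p \<and> eq_clause F \<sigma> y p}"
    by (auto simp: small_iff)
  have "elts F \<subseteq> elts F'"
  proof
    fix w assume w: "w \<in> elts F"
    then have 1: "w \<in> elts (prods (prods T B) P)" unfolding F by blast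
    then obtain \<sigma> y p where "w = opair (opair \<sigma> y) p" by (auto simp: elts_prods)
    then show "w \<in> elts F'" using Fp w 1 unfolding F' by blast
  qed
  then have "post F'" unfolding post_def F' using eq_clause_mono by (auto simp: F')
  moreover have "elts F' \<subseteq> elts (prods (prods T B) P)" unfolding F' by blast
  ultimately have "elts F' \<subseteq> elts F" by (rule sub[rotated])
  then show ?thesis using Fp unfolding F' by (intro that[of F]) auto
qed

lemma eq_clause_below: "eq_clause X \<sigma> y p \<Longrightarrow> q \<preceq> p \<Longrightarrow> eq_clause X \<sigma> y q"
  unfolding eq_clause_def using below_trans by (elim conjE, intro conjI) blast+

text \<open>From F to \<open>same_value\<close>, genericity below p realizes the existential parts
  of the clause. Conversely, a condition at which the clause fails has an extension that refutes one
  half of it for good, and G contains no such extension if the values agree.\<close>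

lemma eq_truth:
  assumes G: "generic_filter P le G" and T: "transitive T" and B: "transitive B"
    and F: "\<And>\<sigma> y p. \<sigma> \<in> elts T \<Longrightarrow> y \<in> elts B \<Longrightarrow> p \<in> elts P \<Longrightarrow>
      opair (opair \<sigma> y) p \<in> elts F \<longleftrightarrow> eq_clause F \<sigma> y p"
  shows "\<sigma> \<in> elts T \<Longrightarrow> y \<in> elts B \<Longrightarrow>
    same_value G \<sigma> (check P y) \<longleftrightarrow> (\<exists>p\<in>G. opair (opair \<sigma> y) p \<in> elts F)"
proof (induction \<sigma> arbitrary: y rule: mem_trancl_induct)
  case (step \<sigma>)
  have \<rho>T: "\<rho> \<in> elts T" if "opair \<rho> s \<in> elts \<sigma>" for \<rho> s
  proof -
    have "opair \<rho> s \<in> elts T" using transitiveD[OF T that step.prems(1)] .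
    then have "vset {\<rho>, s} \<in> elts T" using transitiveD[OF T _ \<open>opair \<rho> s \<in> elts T\<close>] elts_opair by blast
    then show ?thesis using transitiveD[OF T, of \<rho> "vset {\<rho>, s}"] by (simp add: elts_vset)
  qed
  have zB: "z \<in> elts B" if "z \<in> elts y" for z using transitiveD[OF B that step.prems(2)] .
  have IH: "same_value G \<rho> (check P z) \<longleftrightarrow> (\<exists>p\<in>G. opair (opair \<rho> z) p \<in> elts F)"
    if "opair \<rho> s \<in> elts \<sigma>" "z \<in> elts y" for \<rho> s z
    using step.IH[OF name_mem[OF that(1)] \<rho>T[OF that(1)] zB[OF that(2)]] .
  have down: "opair (opair \<rho> z) q \<in> elts F"
    if "opair \<rho> s \<in> elts \<sigma>" "z \<in> elts y" "opair (opair \<rho> z) p \<in> elts F" "q \<preceq> p" for \<rho> s z p q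
    using F[OF \<rho>T[OF that(1)] zB[OF that(2)]] that(3,4) below_mem[OF that(4)] eq_clause_below by blast
  show ?case
  proof
    assume "\<exists>p\<in>G. opair (opair \<sigma> y) p \<in> elts F"
    then obtain p where p: "p \<in> G" "opair (opair \<sigma> y) p \<in> elts F" by blast
    have c: "eq_clause F \<sigma> y p" using F[OF step.prems generic_sub[OF G p(1)]] p(2) by blast
    show "same_value G \<sigma> (check P y)"
    proof (subst same_value_check_iff[OF G], intro conjI allI impI ballI; (elim conjE)?)
      fix \<rho> s assume s: "s \<in> G" "opair \<rho> s \<in> elts \<sigma>"
      obtain p1 where p1: "p1 \<in> G" "p1 \<preceq> p" "p1 \<preceq> s" using generic_directed[OF G p(1) s(1)] by blast
      have "\<exists>q\<in>G. \<exists>z\<in>elts y. opair (opair \<rho> z) q \<in> elts F"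
      proof (rule generic_meets_below[OF G _ p1(1)])
        show "dfn (\<lambda>e. \<exists>z\<in>elts y. opair (opair \<rho> z) (e 0) \<in> elts F)" by (intro dfn_intros dft_opair)
        fix r assume "r \<preceq> p1"
        then have "r \<preceq> p" "r \<preceq> s" using p1 below_trans by blast+
        then show "\<exists>q. q \<preceq> r \<and> (\<exists>z\<in>elts y. opair (opair \<rho> z) q \<in> elts F)"
          using c s(2) unfolding eq_clause_def by blast
      qed
      then show "\<exists>z\<in>elts y. same_value G \<rho> (check P z)" using IH[OF s(2)] by blast
    next
      fix z assume z: "z \<in> elts y"
      have "\<exists>q\<in>G. \<exists>\<rho> s. opair \<rho> s \<in> elts \<sigma> \<and> q \<preceq> s \<and> opair (opair \<rho> z) q \<in> elts F"
      proof (rule generic_meets_below[OF G _ p(1)])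
        show "dfn (\<lambda>e. \<exists>\<rho> s. opair \<rho> s \<in> elts \<sigma> \<and> e 0 \<preceq> s \<and> opair (opair \<rho> z) (e 0) \<in> elts F)"
          by (intro dfn_intros dft_opair)
        fix r assume "r \<preceq> p"
        then show "\<exists>q. q \<preceq> r \<and> (\<exists>\<rho> s. opair \<rho> s \<in> elts \<sigma> \<and> q \<preceq> s \<and> opair (opair \<rho> z) q \<in> elts F)"
          using c z unfolding eq_clause_def by blast
      qed
      then obtain q \<rho> s where "q \<in> G" "opair \<rho> s \<in> elts \<sigma>" "q \<preceq> s" "opair (opair \<rho> z) q \<in> elts F" by blast
      then show "\<exists>\<rho> p. p \<in> G \<and> opair \<rho> p \<in> elts \<sigma> \<and> same_value G \<rho> (check P z)"
        using IH[OF _ z] generic_up[OF G] by blast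
    qed
  next
    assume sv: "same_value G \<sigma> (check P y)"
    \<comment> \<open>These negate the two halves of the clause, with the refuting extension taken
      as the condition itself.\<close>
    define bad1 where "bad1 = (\<lambda>p. \<exists>\<rho> s. opair \<rho> s \<in> elts \<sigma> \<and> p \<preceq> s \<and>
      (\<forall>q' z. q' \<preceq> p \<and> z \<in> elts y \<longrightarrow> opair (opair \<rho> z) q' \<notin> elts F))"
    define bad2 where "bad2 = (\<lambda>p. \<exists>z\<in>elts y. \<forall>q' \<rho> s. q' \<preceq> p \<and> opair \<rho> s \<in> elts \<sigma> \<and> q' \<preceq> s \<longrightarrow>
      opair (opair \<rho> z) q' \<notin> elts F)"
    have "\<exists>p\<in>G. opair (opair \<sigma> y) p \<in> elts F \<or> bad1 p \<or> bad2 p"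
    proof (rule generic_meets[OF G])
      show "dfn (\<lambda>e. opair (opair \<sigma> y) (e 0) \<in> elts F \<or> bad1 (e 0) \<or> bad2 (e 0))"
        unfolding bad1_def bad2_def by (intro dfn_intros dft_opair)
      fix p assume p: "p \<in> elts P"
      show "\<exists>q. q \<preceq> p \<and> (opair (opair \<sigma> y) q \<in> elts F \<or> bad1 q \<or> bad2 q)"
      proof (cases "eq_clause F \<sigma> y p")
        case True
        then show ?thesis using F[OF step.prems p] below_refl[OF p] by blast
      next
        case False
        then have "\<exists>q. q \<preceq> p \<and> (bad1 q \<or> bad2 q)"
          unfolding eq_clause_def bad1_def bad2_def by blast
        then show ?thesis by blast
      qed
    qed
    then obtain p where p: "p \<in> G" "opair (opair \<sigma> y) p \<in> elts F \<or> bad1 p \<or> bad2 p" by blast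
    have "\<not> bad1 p"
    proof
      assume "bad1 p"
      then obtain \<rho> s where s: "opair \<rho> s \<in> elts \<sigma>" "p \<preceq> s"
        and no: "\<And>q' z. q' \<preceq> p \<Longrightarrow> z \<in> elts y \<Longrightarrow> opair (opair \<rho> z) q' \<notin> elts F"
        unfolding bad1_def by blast
      obtain z where z: "z \<in> elts y" "same_value G \<rho> (check P z)"
        using iffD1[OF same_value_check_iff[OF G] sv] s(1) generic_up[OF G p(1) s(2)] by blast
      obtain r where r: "r \<in> G" "opair (opair \<rho> z) r \<in> elts F" using IH[OF s(1) z(1)] z(2) by blast
      obtain q where "q \<preceq> p" "q \<preceq> r" using generic_directed[OF G p(1) r(1)] by blast
      then show False using no z(1) down[OF s(1) z(1) r(2)] by blast
    qed
    moreover have "\<not> bad2 p"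
    proof
      assume "bad2 p"
      then obtain z where z: "z \<in> elts y" and
        no: "\<And>q' \<rho> s. q' \<preceq> p \<Longrightarrow> opair \<rho> s \<in> elts \<sigma> \<Longrightarrow> q' \<preceq> s \<Longrightarrow> opair (opair \<rho> z) q' \<notin> elts F"
        unfolding bad2_def by blast
      obtain \<rho> s where s: "s \<in> G" "opair \<rho> s \<in> elts \<sigma>" "same_value G \<rho> (check P z)"
        using iffD1[OF same_value_check_iff[OF G] sv] z by blast
      obtain r where r: "r \<in> G" "opair (opair \<rho> z) r \<in> elts F" using IH[OF s(2) z] s(3) by blast
      obtain q where q: "q \<in> G" "q \<preceq> p" "q \<preceq> s" using generic_directed[OF G p(1) s(1)] by blast
      obtain q' where q': "q' \<preceq> q" "q' \<preceq> r" using generic_directed[OF G q(1) r(1)] by blast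
      have "q' \<preceq> p" "q' \<preceq> s" using q' q below_trans by blast+
      then show False using no s(2) down[OF s(2) z r(2) q'(2)] by blast
    qed
    ultimately show "\<exists>p\<in>G. opair (opair \<sigma> y) p \<in> elts F" using p by blast
  qed
qed

text \<open>A set y of V is in the value of \<tau> if some (\<rho>, s) in \<tau> with s \<in> G has
  \<rho> denoting y. So W collects the pairs (y, p) for which p is below such an s and forces \<rho>
  to be y. The names in question lie in the closure T of \<tau>, and the sets they denote in the
  stage B.\<close>

lemma subset_name:
  assumes G: "generic_filter P le G"
  obtains W where "\<And>y p q. opair y p \<in> elts W \<Longrightarrow> q \<preceq> p \<Longrightarrow> opair y q \<in> elts W"
    "\<And>y. ground P G y \<in> ext_elts G (val G \<tau>) \<longleftrightarrow> (\<exists>p\<in>G. opair y p \<in> elts W)"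
proof -
  define T where "T = trcl \<tau>"
  define B where "B = hier (nv 0) \<tau>"
  have t0: "transitive (nv 0)" using ordinal_nv[of 0] unfolding ordinal_def by blast
  have T: "transitive T" unfolding T_def by (rule transitive_trcl)
  have B: "transitive B" unfolding B_def by (rule transitive_hier[OF t0])
  obtain F where F: "\<And>\<sigma> y p. \<sigma> \<in> elts T \<Longrightarrow> y \<in> elts B \<Longrightarrow> p \<in> elts P \<Longrightarrow>
      opair (opair \<sigma> y) p \<in> elts F \<longleftrightarrow> eq_clause F \<sigma> y p" by (rule ex_forces_eq) blast
  have truth: "same_value G \<sigma> (check P y) \<longleftrightarrow> (\<exists>p\<in>G. opair (opair \<sigma> y) p \<in> elts F)"
    if "\<sigma> \<in> elts T" "y \<in> elts B" for \<sigma> y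
    by (rule eq_truth[OF G T B _ that]) (rule F)
  have \<rho>T: "\<rho> \<in> elts T" if "opair \<rho> s \<in> elts \<tau>" for \<rho> s
  proof -
    have 1: "opair \<rho> s \<in> elts T" using trcl_sub[of \<tau>] that unfolding T_def by blast
    then have "vset {\<rho>, s} \<in> elts T" using transitiveD[OF T _ 1] elts_opair by blast
    then show ?thesis using transitiveD[OF T, of \<rho> "vset {\<rho>, s}"] by (simp add: elts_vset)
  qed
  have yB: "y \<in> elts B" if "opair \<rho> s \<in> elts \<tau>" "same_value G \<rho> (check P y)" for y \<rho> s
  proof -
    have "elts y \<subseteq> elts (hier (nv 0) \<rho>)" by (rule same_value_check_bound[OF G that(2)])
    then have "y \<in> elts (hier (nv 0) (vset {\<rho>, s}))"
      unfolding elts_hier[of "nv 0" "vset {\<rho>, s}"] elts_vset[OF small_pair] by blast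
    moreover have "vset {\<rho>, s} \<in> elts (opair \<rho> s)" by (simp add: elts_opair)
    ultimately show ?thesis
      using hier_mono[OF t0] that(1) unfolding B_def by blast
  qed
  have "small {w \<in> elts (prods B P). \<exists>y p \<rho> s. w = opair y p \<and> opair \<rho> s \<in> elts \<tau> \<and> p \<preceq> s \<and>
      opair (opair \<rho> y) p \<in> elts F}"
    by (rule small_sep) (rule small_elts, intro dfn_intros dft_opair)
  then obtain W where "elts W = {w \<in> elts (prods B P). \<exists>y p \<rho> s. w = opair y p \<and>
      opair \<rho> s \<in> elts \<tau> \<and> p \<preceq> s \<and> opair (opair \<rho> y) p \<in> elts F}" by (auto simp: small_iff)
  then have W: "opair y p \<in> elts W \<longleftrightarrow> y \<in> elts B \<and> p \<in> elts P \<and>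
      (\<exists>\<rho> s. opair \<rho> s \<in> elts \<tau> \<and> p \<preceq> s \<and> opair (opair \<rho> y) p \<in> elts F)" for y p
    by auto
  show ?thesis
  proof (rule that[of W])
    fix y p q assume "opair y p \<in> elts W" "q \<preceq> p"
    then show "opair y q \<in> elts W"
      unfolding W using below_mem below_trans F \<rho>T eq_clause_below by meson
  next
    fix y
    have "ground P G y \<in> ext_elts G (val G \<tau>) \<longleftrightarrow>
        (\<exists>\<rho> s. s \<in> G \<and> opair \<rho> s \<in> elts \<tau> \<and> same_value G \<rho> (check P y))"
      unfolding ext_elts_val ground_def val_eq_iff[symmetric] by auto
    also have "\<dots> \<longleftrightarrow> (\<exists>p\<in>G. opair y p \<in> elts W)"
    proof
      assume "\<exists>\<rho> s. s \<in> G \<and> opair \<rho> s \<in> elts \<tau> \<and> same_value G \<rho> (check P y)"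
      then obtain \<rho> s where s: "s \<in> G" "opair \<rho> s \<in> elts \<tau>" "same_value G \<rho> (check P y)" by blast
      have y: "y \<in> elts B" using yB[OF s(2,3)] .
      obtain r where r: "r \<in> G" "opair (opair \<rho> y) r \<in> elts F" using truth[OF \<rho>T[OF s(2)] y] s(3) by blast
      obtain q where q: "q \<in> G" "q \<preceq> r" "q \<preceq> s" using generic_directed[OF G r(1) s(1)] by blast
      have "opair (opair \<rho> y) q \<in> elts F"
        using F[OF \<rho>T[OF s(2)] y] r(2) below_mem[OF q(2)] eq_clause_below[OF _ q(2)] by blast
      then show "\<exists>p\<in>G. opair y p \<in> elts W" unfolding W using q s(2) y generic_sub[OF G] by blast
    next
      assume "\<exists>p\<in>G. opair y p \<in> elts W"
      then obtain p \<rho> s where p: "p \<in> G" "y \<in> elts B" "opair \<rho> s \<in> elts \<tau>" "p \<preceq> s"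
        "opair (opair \<rho> y) p \<in> elts F" unfolding W by blast
      then show "\<exists>\<rho> s. s \<in> G \<and> opair \<rho> s \<in> elts \<tau> \<and> same_value G \<rho> (check P y)"
        using truth[OF \<rho>T[OF p(3)] p(2)] generic_up[OF G] by blast
    qed
    finally show "ground P G y \<in> ext_elts G (val G \<tau>) \<longleftrightarrow> (\<exists>p\<in>G. opair y p \<in> elts W)" .
  qed
qed

lemma almost_strongly_proper_approximation:
  assumes "almost_strongly_proper P le"
  shows "omega1_approximation P le"
  unfolding omega1_approximation_def
proof (intro allI impI ballI, elim conjE)
  fix G x
  assume G: "generic_filter P le G" and "x \<in> extension G"
    and ord: "ext_elts G x \<subseteq> ground P G ` {\<alpha>. ordinal \<alpha>}"
    and approx: "\<forall>a. countable_in_V a \<longrightarrow>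
      (\<exists>b. ext_elts G (ground P G b) = ext_elts G x \<inter> ext_elts G (ground P G a))"
  then obtain \<tau> where \<tau>: "x = val G \<tau>" unfolding extension_def by blast
  obtain W where W: "\<And>y p q. opair y p \<in> elts W \<Longrightarrow> q \<preceq> p \<Longrightarrow> opair y q \<in> elts W"
    "\<And>y. ground P G y \<in> ext_elts G x \<longleftrightarrow> (\<exists>p\<in>G. opair y p \<in> elts W)"
    unfolding \<tau> by (rule subset_name[OF G]) blast
  have "small {y. \<exists>p\<in>G. opair y p \<in> elts W}"
  proof (rule approximation[OF assms G W(1)])
    fix a assume "countable_in_V a"
    then obtain b where "ext_elts G (ground P G b) = ext_elts G x \<inter> ext_elts G (ground P G a)"
      using approx by blast
    then have b: "ground P G ` elts b = ext_elts G x \<inter> ground P G ` elts a"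
      unfolding ext_elts_ground[OF G] .
    have im: "y \<in> elts c \<longleftrightarrow> ground P G y \<in> ground P G ` elts c" for y c
      by (auto simp: image_iff ground_inject[OF G])
    have "y \<in> elts b \<longleftrightarrow> y \<in> elts a \<and> (\<exists>p\<in>G. opair y p \<in> elts W)" for y
      by (simp only: im[of y b] b Int_iff im[of y a] W(2)) (rule conj_commute)
    then have "elts b = {y \<in> elts a. \<exists>p\<in>G. opair y p \<in> elts W}"
      by (intro set_eqI) (simp only: mem_Collect_eq)
    then show "small {y \<in> elts a. \<exists>p\<in>G. opair y p \<in> elts W}" unfolding small_iff by blast
  qed
  then obtain c where c: "elts c = {y. ground P G y \<in> ext_elts G x}"
    unfolding W(2) by (auto simp: small_iff)
  \<comment> \<open>Here it matters that x consists of ordinals: its members are elements of V, so c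
    accounts for all of them.\<close>
  have "ext_elts G (ground P G c) = ext_elts G x"
    unfolding ext_elts_ground[OF G] c using ord by blast
  then have "ground P G c = x" unfolding \<tau> ground_def by (rule val_extensional)
  then show "x \<in> range (ground P G)" by blast
qed

end

theorem proposition1p5:
  fixes elts :: "'v \<Rightarrow> 'v set" and P le :: 'v
  assumes "membership.transitive_ZFC_model elts"
    and "membership.forcing elts P le"
    and "membership.almost_strongly_proper elts P le"
  shows "membership.omega1_approximation elts P le"
proof -
  interpret forcing_notion elts P le
    using assms(1,2) by unfold_locales
  show ?thesis using assms(3) by (rule almost_strongly_proper_approximation)
qed

end
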